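(* Let $\phi:\mathbb{R}^2\to\mathbb{R}$ be smooth with $|\partial^\alpha\phi|\le C_\alpha$ on $\mathbb{R}^2$ for every multi-index $|\alpha|\ge 2$. Let $$H=\Big(\tfrac{D_1}{2}-\tfrac{\partial_2\phi}{2}\Big)^2+\Big(\tfrac{D_2}{2}+\tfrac{\partial_1\phi}{2}\Big)^2-\tfrac{\Delta\phi}{4},\qquad D_j=-i\partial_{x_j}.$$ There is a constant $C$, depending only on $\phi$ and independent of the eigenvalue, such that for every $\lambda\ge 0$ and every $u\in L^2(\mathbb{R}^2)$ with $Hu=\lambda^2u$, one has $\|u\|_{L^\infty(\mathbb{R}^2)}\le C\|u\|_{L^2(\mathbb{R}^2)}$.
   Context: Writing $z=x_1+ix_2$, $H=D^*D$ with $D=\partial_z+\partial_z\phi$; it is the generalized Landau magnetic Laplacian with magnetic vector potential $(-\partial_2\phi,\partial_1\phi,0)$. $H$ is nonnegative, so its eigenvalues can be written $\lambda^2$, $\lambda\ge 0$. *)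

theory Defs
  imports "HOL-Analysis.Analysis"
begin

text \<open>The plane R^2 is identified with the complex numbers, z = x1 + i x2.
  Partial derivatives in the directions x1 (real axis) and x2 (imaginary axis).\<close>

definition pd1 :: "(complex \<Rightarrow> 'b::real_normed_vector) \<Rightarrow> complex \<Rightarrow> 'b" where
  "pd1 f z = vector_derivative (\<lambda>t::real. f (z + of_real t)) (at 0)"

definition pd2 :: "(complex \<Rightarrow> 'b::real_normed_vector) \<Rightarrow> complex \<Rightarrow> 'b" where
  "pd2 f z = vector_derivative (\<lambda>t::real. f (z + of_real t * \<i>)) (at 0)"

fun dpart :: "bool list \<Rightarrow> (complex \<Rightarrow> 'b::real_normed_vector) \<Rightarrow> complex \<Rightarrow> 'b" where
  "dpart [] f = f"
| "dpart (b # bs) f = (if b then pd1 (dpart bs f) else pd2 (dpart bs f))"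

definition smooth :: "(complex \<Rightarrow> 'b::real_normed_vector) \<Rightarrow> bool" where
  "smooth f \<longleftrightarrow> (\<forall>bs z. dpart bs f differentiable (at z))"

definition test_fun :: "(complex \<Rightarrow> complex) \<Rightarrow> bool" where
  "test_fun \<psi> \<longleftrightarrow> smooth \<psi> \<and> bounded {z. \<psi> z \<noteq> 0}"

definition laplacian :: "(complex \<Rightarrow> real) \<Rightarrow> complex \<Rightarrow> real" where
  "laplacian \<phi> z = pd1 (pd1 \<phi>) z + pd2 (pd2 \<phi>) z"

definition D1 :: "(complex \<Rightarrow> complex) \<Rightarrow> complex \<Rightarrow> complex" where
  "D1 f z = - \<i> * pd1 f z"
definition D2 :: "(complex \<Rightarrow> complex) \<Rightarrow> complex \<Rightarrow> complex" where
  "D2 f z = - \<i> * pd2 f z"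

definition opA :: "(complex \<Rightarrow> real) \<Rightarrow> (complex \<Rightarrow> complex) \<Rightarrow> complex \<Rightarrow> complex" where
  "opA \<phi> f z = D1 f z / 2 - of_real (pd2 \<phi> z / 2) * f z"
definition opB :: "(complex \<Rightarrow> real) \<Rightarrow> (complex \<Rightarrow> complex) \<Rightarrow> complex \<Rightarrow> complex" where
  "opB \<phi> f z = D2 f z / 2 + of_real (pd1 \<phi> z / 2) * f z"

definition magH :: "(complex \<Rightarrow> real) \<Rightarrow> (complex \<Rightarrow> complex) \<Rightarrow> complex \<Rightarrow> complex" where
  "magH \<phi> f z = opA \<phi> (opA \<phi> f) z + opB \<phi> (opB \<phi> f) z - of_real (laplacian \<phi> z / 4) * f z"

text \<open>u in L^2 solves H u = mu u in the sense of distributions (H is formally symmetric).\<close>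
definition weak_eigen :: "(complex \<Rightarrow> real) \<Rightarrow> real \<Rightarrow> (complex \<Rightarrow> complex) \<Rightarrow> bool" where
  "weak_eigen \<phi> \<mu> u \<longleftrightarrow> (\<forall>\<psi>. test_fun \<psi> \<longrightarrow>
     (LINT z|lborel. u z * cnj (magH \<phi> \<psi> z)) = of_real \<mu> * (LINT z|lborel. u z * cnj (\<psi> z)))"

end

theory Submission
  imports Defs
begin

text \<open>
  With the magnetic gradient N = grad - iA, A = (pd2 phi, - pd1 phi), the equation reads
  N^2 u + (Laplacian of phi) u + E u = 0 with E = 4 lam^2. The loss of a power of lam in a local
  elliptic estimate is avoided by a positive commutator (Morawetz) argument: the multiplier
  X.N u with X = grad sqrt (R^2 + |z - x|^2) and R = 1 / sqrt E gives
  int W (|N u|^2 + E |u|^2) \<le> K sqrt E (int |u|^2), where W = R^2 / (R^2 + |z - x|^2)^(3/2)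
  is of size 1 / R on the disc of radius R. The only magnetic contribution is the commutator
  [N1, N2], multiplication by the bounded function i (Laplacian of phi). Combined with the Agmon type inequality
  |w x|^2 \<le> K (E int |w|^2 + int |N^2 w|^2 / E), applied to w = R^2 u / (R^2 + |z - x|^2), the powers
  of E cancel. All of this tolerates an error of size ||u|| in the equation, uniformly in E. So an
  L^2 distributional solution u may be replaced by the mollification of u at scale eps, cut off at
  radius 1 / eps: by the linear growth of A this changes the equation by an error bounded by ||u||.
\<close>

section \<open>Directional derivatives and smooth functions\<close>

text \<open>The scaling can be read off a disc of radius 1 / sqrt E. A bound of |u|^2 by K ||u||^2
  would give it mass at most of order ||u||^2 / E, that is, mass proportional to area. Since W is of
  size sqrt E there, the weighted bound E int W |u|^2 \<le> K sqrt E ||u||^2 says precisely this,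
  and an elliptic estimate at the scale of the disc turns it into a bound at the centre. The
  obstacle is the linear growth of A. The multiplier estimate is global with |X| \<le> 1, and all
  its integrations by parts are done with N in place of grad, so A enters it only through its curl;
  hence the constants are the same for every centre x and every E. In the mollified equation A
  itself appears: coefficients are evaluated at y instead of x, and |A(x) - A(y)| = O(eps) has to
  pay for a derivative of the kernel, O(1 / eps), and for a factor |A| = O(1 / eps). The
  approximants are bounded uniformly in eps and converge weakly to a positive multiple of u. Testing
  against functions measured in L^1 hands the bound over to u almost everywhere.\<close>

definition pd :: "complex \<Rightarrow> (complex \<Rightarrow> 'b::real_normed_vector) \<Rightarrow> complex \<Rightarrow> 'b" where
  "pd e f z = vector_derivative (\<lambda>t::real. f (z + of_real t * e)) (at 0)"

lemma pd1_eq_pd: "pd1 = pd 1" and pd2_eq_pd: "pd2 = pd \<i>"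
  by (intro ext; simp add: pd1_def pd2_def pd_def)+

lemma has_vector_derivative_along:
  assumes "(f has_derivative f') (at z)"
  shows "((\<lambda>t::real. f (z + of_real t * e)) has_vector_derivative f' e) (at 0)"
proof -
  have l: "((\<lambda>t::real. z + of_real t * e) has_derivative (\<lambda>t. of_real t * e)) (at 0)"
    by (auto intro!: derivative_eq_intros simp: of_real_def)
  have "((\<lambda>t::real. f (z + of_real t * e)) has_derivative (\<lambda>t. f' (of_real t * e))) (at 0)"
    using diff_chain_at[OF l, of f f'] assms by (simp add: o_def)
  moreover have "(\<lambda>t::real. f' (of_real t * e)) = (\<lambda>t. t *\<^sub>R f' e)"
    using linear_cmul[OF has_derivative_linear[OF assms]] by (auto simp: scaleR_conv_of_real)
  ultimately show ?thesis by (simp add: has_vector_derivative_def)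
qed

lemma pd_has_derivative:
  "(f has_derivative f') (at z) \<Longrightarrow> pd e f z = f' e"
  unfolding pd_def by (rule vector_derivative_at[OF has_vector_derivative_along])

lemma pd_frechet:
  "f differentiable at z \<Longrightarrow> pd e f z = frechet_derivative f (at z) e"
  by (simp add: frechet_derivative_works[symmetric] pd_has_derivative)

lemma pd_const [simp]: "pd e (\<lambda>z. c) z = 0" by (simp add: pd_def)

lemma pd_add:
  assumes "f differentiable at z" "g differentiable at z"
  shows "pd e (\<lambda>z. f z + g z) z = pd e f z + pd e g z"
  using assms[unfolded frechet_derivative_works]
  by (subst pd_has_derivative[OF has_derivative_add]) (auto simp: pd_frechet assms)

lemma pd_bounded_linear:
  assumes "bounded_linear L" "f differentiable at z"
  shows "pd e (\<lambda>z. L (f z)) z = L (pd e f z)"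
  using assms(2)[unfolded frechet_derivative_works]
  by (subst pd_has_derivative[OF bounded_linear.has_derivative[OF assms(1)]])
     (auto simp: pd_frechet assms)

lemma pd_bilinear:
  assumes "bounded_bilinear P" "f differentiable at z" "g differentiable at z"
  shows "pd e (\<lambda>z. P (f z) (g z)) z = P (pd e f z) (g z) + P (f z) (pd e g z)"
  using assms(2,3)[unfolded frechet_derivative_works]
  by (subst pd_has_derivative[OF bounded_bilinear.FDERIV[OF assms(1)]])
     (auto simp: pd_frechet assms add.commute)

text \<open>\<open>dpart\<close> adds derivatives on the outside, whereas this recursion peels them
  off on the inside, so that an induction on the order can pass from \<open>f\<close> to its partial
  derivatives with \<open>f\<close> arbitrary.\<close>

primrec Ck :: "nat \<Rightarrow> (complex \<Rightarrow> 'b::real_normed_vector) \<Rightarrow> bool" where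
  "Ck 0 f \<longleftrightarrow> (\<forall>z. f differentiable at z)"
| "Ck (Suc n) f \<longleftrightarrow> (\<forall>z. f differentiable at z) \<and> Ck n (pd 1 f) \<and> Ck n (pd \<i> f)"

lemma dpart_snoc: "dpart (bs @ [b]) f = dpart bs (pd (if b then 1 else \<i>) f)"
  by (induction bs) (auto simp: pd1_eq_pd pd2_eq_pd)

lemma Ck_iff: "Ck n f \<longleftrightarrow> (\<forall>bs. length bs \<le> n \<longrightarrow> (\<forall>z. dpart bs f differentiable at z))"
proof (induction n arbitrary: f)
  case (Suc n)
  have "(\<forall>bs. length bs \<le> Suc n \<longrightarrow> (\<forall>z. dpart bs f differentiable at z)) \<longleftrightarrow>
    (\<forall>z. f differentiable at z) \<and>
    (\<forall>b bs. length bs \<le> n \<longrightarrow> (\<forall>z. dpart (bs @ [b]) f differentiable at z))" (is "?L \<longleftrightarrow> ?R")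
  proof
    assume ?L
    then show ?R by (metis dpart.simps(1) le0 length_append_singleton list.size(3) Suc_le_mono)
  next
    assume R: ?R
    show ?L
    proof (intro allI impI)
      fix bs z assume "length (bs::bool list) \<le> Suc n"
      then show "dpart bs f differentiable at z" using R by (cases bs rule: rev_cases) auto
    qed
  qed
  also have "\<dots> \<longleftrightarrow> Ck (Suc n) f"
    unfolding dpart_snoc Ck.simps Suc.IH by (auto simp: all_bool_eq)
  finally show ?case by blast
qed auto

lemma smooth_iff_Ck: "smooth f \<longleftrightarrow> (\<forall>n. Ck n f)"
  unfolding smooth_def Ck_iff by auto

lemma smooth_differentiable: "smooth f \<Longrightarrow> f differentiable at z"
  unfolding smooth_def by (metis dpart.simps(1))

lemma smooth_pd: "smooth f \<Longrightarrow> e = 1 \<or> e = \<i> \<Longrightarrow> smooth (pd e f)"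
  unfolding smooth_iff_Ck by (metis Ck.simps(2))

lemma smooth_pd_1 [intro]: "smooth f \<Longrightarrow> smooth (pd 1 f)"
  and smooth_pd_ii [intro]: "smooth f \<Longrightarrow> smooth (pd \<i> f)"
  by (simp_all add: smooth_pd)

lemma smooth_isCont: "smooth f \<Longrightarrow> isCont f z"
  by (simp add: differentiable_imp_continuous_within smooth_differentiable)

lemma smooth_continuous_on: "smooth f \<Longrightarrow> continuous_on S f"
  by (simp add: continuous_at_imp_continuous_on smooth_isCont)

lemma smooth_borel: "smooth f \<Longrightarrow> f \<in> borel_measurable borel"
  by (simp add: borel_measurable_continuous_onI smooth_continuous_on)

text \<open>All iterated derivatives of \<open>f\<close> stay in the class \<open>S\<close> and are
  therefore differentiable. This suits families such as convolutions, or products with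
  \<open>flat k\<close>, for which no closed formula of the higher derivatives is at hand.\<close>

lemma smooth_coinduct:
  assumes "S f" and "\<And>f z. S f \<Longrightarrow> f differentiable at z"
    and "\<And>f e. S f \<Longrightarrow> e = 1 \<or> e = \<i> \<Longrightarrow> S (pd e f)"
  shows "smooth f"
proof -
  have "S f \<Longrightarrow> Ck n f" for n f by (induction n arbitrary: f) (use assms(2,3) in auto)
  then show ?thesis using assms(1) by (simp add: smooth_iff_Ck)
qed

lemma smooth_const [simp, intro]: "smooth (\<lambda>z. c)"
proof -
  have "pd e (\<lambda>z. c) = (\<lambda>z. 0)" for e and c :: 'a by (rule ext) simp
  then have "Ck n (\<lambda>z. c)" for n and c :: 'a by (induction n arbitrary: c) auto
  then show ?thesis by (simp add: smooth_iff_Ck)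
qed

lemma smooth_bounded_linear:
  assumes L: "bounded_linear L" and "smooth f"
  shows "smooth (\<lambda>z. L (f z))"
proof (rule smooth_coinduct[where S = "\<lambda>h. \<exists>f. smooth f \<and> h = (\<lambda>z. L (f z))"])
  fix h z assume "\<exists>f. smooth f \<and> h = (\<lambda>z. L (f z))"
  then show "h differentiable at z" using bounded_linear.has_derivative[OF L] smooth_differentiable
    unfolding differentiable_def by blast
next
  fix h e assume "\<exists>f. smooth f \<and> h = (\<lambda>z. L (f z))" "e = 1 \<or> e = \<i>"
  then show "\<exists>f. smooth f \<and> pd e h = (\<lambda>z. L (f z))"
    by (metis (no_types, lifting) ext L pd_bounded_linear smooth_differentiable smooth_pd)
qed (use assms in auto)

lemma Ck_add: "Ck n f \<Longrightarrow> Ck n g \<Longrightarrow> Ck n (\<lambda>z. f z + g z)"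
proof (induction n arbitrary: f g)
  case (Suc n)
  have "pd e (\<lambda>z. f z + g z) = (\<lambda>z. pd e f z + pd e g z)" for e
    using Suc.prems by (intro ext pd_add) auto
  then show ?case using Suc by auto
qed auto

lemma Ck_Suc_imp: "Ck (Suc n) f \<Longrightarrow> Ck n f" by (simp add: Ck_iff)

lemma Ck_bilinear:
  assumes P: "bounded_bilinear P"
  shows "Ck n f \<Longrightarrow> Ck n g \<Longrightarrow> Ck n (\<lambda>z. P (f z) (g z))"
proof (induction n arbitrary: f g)
  case 0
  then show ?case using bounded_bilinear.FDERIV[OF P] unfolding Ck.simps differentiable_def by blast
next
  case (Suc n)
  have "pd e (\<lambda>z. P (f z) (g z)) = (\<lambda>z. P (pd e f z) (g z) + P (f z) (pd e g z))" for e
    using Suc.prems by (intro ext pd_bilinear[OF P]) auto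
  moreover have "(\<lambda>z. P (f z) (g z)) differentiable at z" for z
    using Suc.prems bounded_bilinear.FDERIV[OF P] unfolding Ck.simps differentiable_def by blast
  ultimately show ?case using Suc.prems Suc.IH Suc.prems[THEN Ck_Suc_imp] by (auto intro!: Ck_add)
qed

lemma smooth_add [intro]: "smooth f \<Longrightarrow> smooth g \<Longrightarrow> smooth (\<lambda>z. f z + g z)"
  by (simp add: smooth_iff_Ck Ck_add)

lemma smooth_mult [intro]:
  fixes f g :: "complex \<Rightarrow> 'a::real_normed_algebra"
  shows "smooth f \<Longrightarrow> smooth g \<Longrightarrow> smooth (\<lambda>z. f z * g z)"
  by (simp add: smooth_iff_Ck Ck_bilinear[OF bounded_bilinear_mult])

lemma smooth_of_real [intro]:
  "smooth f \<Longrightarrow> smooth (\<lambda>z. of_real (f z) :: 'a::{real_normed_algebra_1})"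
  by (rule smooth_bounded_linear[OF bounded_linear_of_real])

lemma smooth_cnj [intro]: "smooth f \<Longrightarrow> smooth (\<lambda>z. cnj (f z))"
  by (rule smooth_bounded_linear[OF bounded_linear_cnj])

lemma smooth_Re [intro]: "smooth f \<Longrightarrow> smooth (\<lambda>z. Re (f z))"
  by (rule smooth_bounded_linear[OF bounded_linear_Re])

lemma smooth_minus [intro]: "smooth f \<Longrightarrow> smooth (\<lambda>z. - f z)"
  by (rule smooth_bounded_linear[OF bounded_linear_minus[OF bounded_linear_ident]])

lemma smooth_diff [intro]: "smooth f \<Longrightarrow> smooth g \<Longrightarrow> smooth (\<lambda>z. f z - g z)"
  using smooth_add[OF _ smooth_minus, of f g] by simp

lemma smooth_power [intro]:
  fixes f :: "complex \<Rightarrow> 'a::real_normed_algebra_1"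
  shows "smooth f \<Longrightarrow> smooth (\<lambda>z. f z ^ n)" by (induction n) auto

lemma smooth_ident [simp, intro]: "smooth (\<lambda>z. z)"
proof -
  have "pd e (\<lambda>z. z) = (\<lambda>z. e)" for e
    by (rule ext, rule pd_has_derivative[OF has_derivative_ident])
  then show ?thesis unfolding smooth_iff_Ck
    by (metis Ck.simps differentiable_ident not0_implies_Suc smooth_const smooth_iff_Ck)
qed

lemma pd_coord [simp]: "pd e (\<lambda>z. z - c) z = e" "pd e Re z = Re e" "pd e Im z = Im e"
  "pd e (\<lambda>z. Re (z - c)) z = Re e" "pd e (\<lambda>z. Im (z - c)) z = Im e"
  by (rule pd_has_derivative, auto intro!: derivative_eq_intros)+

lemma pd_mult:
  fixes f g :: "complex \<Rightarrow> 'a::real_normed_algebra"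
  assumes "smooth f" "smooth g"
  shows "pd e (\<lambda>z. f z * g z) z = pd e f z * g z + f z * pd e g z"
  using assms by (simp add: pd_bilinear[OF bounded_bilinear_mult] smooth_differentiable)

lemma pd_add': "smooth f \<Longrightarrow> smooth g \<Longrightarrow> pd e (\<lambda>z. f z + g z) z = pd e f z + pd e g z"
  by (simp add: pd_add smooth_differentiable)

lemma pd_minus: "smooth f \<Longrightarrow> pd e (\<lambda>z. - f z) z = - pd e f z"
  by (rule pd_bounded_linear[OF bounded_linear_minus[OF bounded_linear_ident]])
     (auto simp: smooth_differentiable)

lemma pd_diff: "smooth f \<Longrightarrow> smooth g \<Longrightarrow> pd e (\<lambda>z. f z - g z) z = pd e f z - pd e g z"
  using pd_add'[OF _ smooth_minus, of f g] by (simp add: pd_minus)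

lemma pd_cnj: "smooth f \<Longrightarrow> pd e (\<lambda>z. cnj (f z)) z = cnj (pd e f z)"
  by (rule pd_bounded_linear[OF bounded_linear_cnj]) (simp add: smooth_differentiable)

lemma pd_Re: "smooth f \<Longrightarrow> pd e (\<lambda>z. Re (f z)) z = Re (pd e f z)"
  by (rule pd_bounded_linear[OF bounded_linear_Re]) (simp add: smooth_differentiable)

lemma pd_Im: "smooth f \<Longrightarrow> pd e (\<lambda>z. Im (f z)) z = Im (pd e f z)"
  by (rule pd_bounded_linear[OF bounded_linear_Im]) (simp add: smooth_differentiable)

lemma pd_of_real: "smooth f \<Longrightarrow> pd e (\<lambda>z. of_real (f z) :: complex) z = of_real (pd e f z)"
  by (rule pd_bounded_linear[OF bounded_linear_of_real]) (simp add: smooth_differentiable)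

lemmas pd_simps = pd_mult pd_add' pd_minus pd_diff pd_cnj pd_of_real

section \<open>Integration in the plane\<close>

lemma pd_along:
  assumes "f differentiable at (w + of_real t * e)"
  shows "((\<lambda>t::real. f (w + of_real t * e)) has_vector_derivative pd e f (w + of_real t * e)) (at t)"
proof -
  have l: "((\<lambda>t::real. w + of_real t * e) has_derivative (\<lambda>t. of_real t * e)) (at t)"
    by (auto intro!: derivative_eq_intros simp: of_real_def)
  have D: "(f has_derivative frechet_derivative f (at (w + of_real t * e))) (at (w + of_real t * e))"
    using assms by (simp add: frechet_derivative_works)
  have "(\<lambda>s::real. frechet_derivative f (at (w + of_real t * e)) (of_real s * e))
      = (\<lambda>s. s *\<^sub>R pd e f (w + of_real t * e))"
    using linear_cmul[OF has_derivative_linear[OF D]] pd_frechet[OF assms]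
    by (auto simp: scaleR_conv_of_real)
  then show ?thesis using diff_chain_at[OF l D] by (simp add: o_def has_vector_derivative_def)
qed

text \<open>The mean value theorem in direction \<open>e\<close> is applied to the difference of
  \<open>g\<close> and its translate by \<open>h\<close> times \<open>d\<close>, then in direction
  \<open>d\<close> to the derivative so obtained. The left side is symmetric in \<open>d\<close> and
  \<open>e\<close>, which is what the symmetry of mixed derivatives rests on.\<close>

lemma second_difference:
  fixes g :: "complex \<Rightarrow> real"
  assumes g: "smooth g" and ge: "smooth (pd e g)" and h: "0 < (h::real)"
  shows "\<exists>a b. 0 < a \<and> a < h \<and> 0 < b \<and> b < h \<and>
    g (z + of_real h * e + of_real h * d) - g (z + of_real h * e) - g (z + of_real h * d) + g z
      = h\<^sup>2 * pd d (pd e g) (z + of_real a * e + of_real b * d)"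
proof -
  define F where "F t = g ((z + of_real h * d) + of_real t * e) - g (z + of_real t * e)" for t :: real
  have F: "(F has_real_derivative
      pd e g ((z + of_real h * d) + of_real t * e) - pd e g (z + of_real t * e)) (at t)" for t
    unfolding F_def has_real_derivative_iff_has_vector_derivative
    by (intro has_vector_derivative_diff pd_along smooth_differentiable g)
  obtain a where a: "0 < a" "a < h" "F h - F 0 = (h - 0) *
      (pd e g ((z + of_real h * d) + of_real a * e) - pd e g (z + of_real a * e))"
    using MVT2[OF h F] by auto
  have G: "((\<lambda>t. pd e g ((z + of_real a * e) + of_real t * d)) has_real_derivative
      pd d (pd e g) ((z + of_real a * e) + of_real t * d)) (at t)" for t
    unfolding has_real_derivative_iff_has_vector_derivative
    by (intro pd_along smooth_differentiable ge)
  obtain b where b: "0 < b" "b < h"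
    "pd e g ((z + of_real a * e) + of_real h * d) - pd e g ((z + of_real a * e) + of_real 0 * d)
      = (h - 0) * pd d (pd e g) ((z + of_real a * e) + of_real b * d)" using MVT2[OF h G] by auto
  have "F h - F 0 = h\<^sup>2 * pd d (pd e g) (z + of_real a * e + of_real b * d)"
    using a(3) b(3) by (simp add: power2_eq_square algebra_simps)
  moreover have "F h - F 0 =
    g (z + of_real h * e + of_real h * d) - g (z + of_real h * e) - g (z + of_real h * d) + g z"
    by (simp add: F_def algebra_simps)
  ultimately show ?thesis using a b by metis
qed

text \<open>The symmetric second difference divided by h^2 is a value of either mixed derivative at
  some point near \<open>z\<close>; continuity of both then forces them to agree.\<close>

lemma pd_commute_real:
  fixes g :: "complex \<Rightarrow> real"
  assumes g: "smooth g" and e: "e = 1 \<or> e = \<i>" and d: "d = 1 \<or> d = \<i>"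
  shows "pd d (pd e g) z = pd e (pd d g) z"
proof (rule ccontr)
  define p q where "p = pd d (pd e g)" and "q = pd e (pd d g)"
  assume "pd d (pd e g) z \<noteq> pd e (pd d g) z"
  then have r: "0 < dist (p z) (q z) / 2" by (simp add: p_def q_def)
  have "isCont p z" "isCont q z" unfolding p_def q_def by (intro smooth_isCont smooth_pd g d e)+
  then obtain r1 r2 where r1: "0 < r1" "\<And>w. dist w z < r1 \<Longrightarrow> dist (p w) (p z) < dist (p z) (q z) / 2"
    and r2: "0 < r2" "\<And>w. dist w z < r2 \<Longrightarrow> dist (q w) (q z) < dist (p z) (q z) / 2"
    using r unfolding continuous_at_eps_delta by metis
  \<comment> \<open>Half of the smaller radius, since the two intermediate displacements add up to
    less than 2 h.\<close>
  define h where "h = min r1 r2 / 2"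
  have h: "0 < h" using r1 r2 by (simp add: h_def)
  have near: "dist (z + of_real a * c + of_real b * c') z < min r1 r2"
    if "0 < a" "a < h" "0 < b" "b < h" "cmod c = 1" "cmod c' = 1" for a b c c'
    using norm_triangle_ineq[of "of_real a * c" "of_real b * c'"] that
    by (simp add: dist_norm norm_mult h_def add.assoc)
  have 1: "cmod e = 1" "cmod d = 1" using e d by auto
  obtain a b where a: "0 < a" "a < h" "0 < b" "b < h"
    "g (z + of_real h * e + of_real h * d) - g (z + of_real h * e) - g (z + of_real h * d) + g z
      = h\<^sup>2 * p (z + of_real a * e + of_real b * d)"
    using second_difference[OF g smooth_pd[OF g e] h] unfolding p_def by metis
  obtain a' b' where a': "0 < a'" "a' < h" "0 < b'" "b' < h"
    "g (z + of_real h * d + of_real h * e) - g (z + of_real h * d) - g (z + of_real h * e) + g z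
      = h\<^sup>2 * q (z + of_real a' * d + of_real b' * e)"
    using second_difference[OF g smooth_pd[OF g d] h] unfolding q_def by metis
  have "h\<^sup>2 * p (z + of_real a * e + of_real b * d) = h\<^sup>2 * q (z + of_real a' * d + of_real b' * e)"
    unfolding a(5)[symmetric] a'(5)[symmetric] by (simp add: add_ac)
  then have "p (z + of_real a * e + of_real b * d) = q (z + of_real a' * d + of_real b' * e)"
    using h by simp
  moreover have "dist (p z) (q z) \<le> dist (p w) (p z) + dist (p w) (q z)" for w
    by (rule dist_triangle3)
  ultimately have "dist (p z) (q z) \<le> dist (p (z + of_real a * e + of_real b * d)) (p z)
      + dist (q (z + of_real a' * d + of_real b' * e)) (q z)" by metis
  moreover have "dist (p (z + of_real a * e + of_real b * d)) (p z) < dist (p z) (q z) / 2"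
    "dist (q (z + of_real a' * d + of_real b' * e)) (q z) < dist (p z) (q z) / 2"
    using near[OF a(1-4) 1] near[OF a'(1-4) 1(2,1)] by (intro r1(2) r2(2); simp)+
  ultimately show False by linarith
qed

text \<open>The mean value theorem is confined to real values, hence the passage to real and
  imaginary parts.\<close>

lemma pd_commute:
  fixes f :: "complex \<Rightarrow> complex"
  assumes f: "smooth f"
  shows "pd 1 (pd \<i> f) z = pd \<i> (pd 1 f) z"
proof (rule complex_eqI)
  have Re: "pd e (\<lambda>z. Re (g z)) = (\<lambda>z. Re (pd e g z))" and Im: "pd e (\<lambda>z. Im (g z)) = (\<lambda>z. Im (pd e g z))"
    if "smooth g" for e g using that by (auto simp: pd_Re pd_Im)
  have s: "smooth (\<lambda>z. Im (f z))" by (rule smooth_bounded_linear[OF bounded_linear_Im f])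
  show "Re (pd 1 (pd \<i> f) z) = Re (pd \<i> (pd 1 f) z)"
    using pd_commute_real[OF smooth_Re[OF f], of 1 \<i> z] by (simp add: Re f smooth_pd_1 smooth_pd_ii)
  show "Im (pd 1 (pd \<i> f) z) = Im (pd \<i> (pd 1 f) z)"
    using pd_commute_real[OF s, of 1 \<i> z] by (simp add: Im f smooth_pd_1 smooth_pd_ii)
qed

section \<open>Functions of bounded support and integrals of derivatives\<close>

abbreviation bsupp :: "(complex \<Rightarrow> 'b::zero) \<Rightarrow> bool" where
  "bsupp f \<equiv> bounded {z. f z \<noteq> 0}"

lemma bsupp_pd:
  assumes "bsupp f" shows "bsupp (pd e f)"
proof (rule bounded_subset[OF bounded_closure[OF assms]], clarify, rule ccontr)
  fix z assume n: "pd e f z \<noteq> 0" and "z \<notin> closure {z. f z \<noteq> 0}"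
  then obtain r where r: "r > 0" "\<And>w. dist w z < r \<Longrightarrow> f w = 0"
    unfolding closure_approachable by (auto simp: dist_commute)
  have "((\<lambda>w. 0) has_derivative (\<lambda>_. 0)) (at z)" by simp
  then have "(f has_derivative (\<lambda>_. 0)) (at z)"
    by (rule has_derivative_transform_within_open[of _ _ _ _ "ball z r"]) (use r in \<open>auto simp: dist_commute\<close>)
  then show False using n by (simp add: pd_has_derivative)
qed

lemma bsupp_bound:
  fixes f :: "complex \<Rightarrow> 'b::real_normed_vector"
  assumes "continuous_on UNIV f" "bsupp f"
  obtains M where "M \<ge> 0" "\<And>z. norm (f z) \<le> M"
proof -
  have "compact (closure {z. f z \<noteq> 0})" using assms(2) by (simp add: compact_closure)
  then have "bounded (f ` closure {z. f z \<noteq> 0})"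
    using assms(1) by (meson compact_continuous_image compact_imp_bounded continuous_on_subset subset_UNIV)
  then obtain M where "M > 0" "\<And>z. z \<in> closure {z. f z \<noteq> 0} \<Longrightarrow> norm (f z) \<le> M"
    unfolding bounded_pos by auto
  then have "norm (f z) \<le> M" for z
    using closure_subset[of "{z. f z \<noteq> 0}"] by (cases "f z = 0") auto
  then show ?thesis using that[of M] \<open>M > 0\<close> by simp
qed

lemma integrable_bsupp:
  fixes f :: "complex \<Rightarrow> 'b::{banach, second_countable_topology}"
  assumes "continuous_on UNIV f" "bsupp f"
  shows "integrable lborel f"
proof -
  have "integrable lborel (\<lambda>z. indicator (closure {z. f z \<noteq> 0}) z *\<^sub>R f z)"
    using assms by (intro borel_integrable_compact) (auto simp: compact_closure intro: continuous_on_subset)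
  moreover have "(\<lambda>z. indicator (closure {z. f z \<noteq> 0}) z *\<^sub>R f z) = f"
    using closure_subset[of "{z. f z \<noteq> 0}"] by (auto simp: fun_eq_iff indicator_def)
  ultimately show ?thesis by simp
qed

lemma integral_shift:
  fixes f :: "complex \<Rightarrow> 'b::{banach, second_countable_topology}"
  assumes [measurable]: "f \<in> borel_measurable borel"
  shows "(LINT z|lborel. f (z + c)) = (LINT z|lborel. f z)"
proof -
  have "(LINT z|lborel. f z) = (LINT z|distr lborel borel ((+) c). f z)"
    by (simp add: lborel_distr_plus)
  also have "\<dots> = (LINT z|lborel. f (c + z))" by (rule integral_distr) auto
  finally show ?thesis by (simp add: add.commute)
qed

text \<open>By translation invariance every difference quotient has integral zero; dominated
  convergence passes to the derivative.\<close>

lemma integral_pd: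
  fixes f :: "complex \<Rightarrow> complex"
  assumes f: "smooth f" "bsupp f" and e: "e = 1 \<or> e = \<i>"
  shows "(LINT z|lborel. pd e f z) = 0"
proof -
  have cf: "continuous_on UNIV f" "continuous_on UNIV (pd e f)"
    using f e by (auto intro: smooth_continuous_on smooth_pd)
  have if': "integrable lborel f" using integrable_bsupp[OF cf(1) f(2)] .
  have [measurable]: "f \<in> borel_measurable borel" "pd e f \<in> borel_measurable borel"
    using f e by (auto intro: smooth_borel smooth_pd)
  obtain M where M: "M \<ge> 0" "\<And>z. norm (pd e f z) \<le> M"
    using bsupp_bound[OF cf(2) bsupp_pd[OF f(2)]] by auto
  obtain K where K: "K > 0" "\<And>z. f z \<noteq> 0 \<Longrightarrow> norm z \<le> K"
    using f(2) unfolding bounded_pos by auto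
  have ne: "norm e = 1" using e by auto
  \<comment> \<open>Steps of at most 1 keep all difference quotients supported in the ball of radius
    \<open>K + 1\<close>, and the mean value inequality bounds them by \<open>M\<close> there; this
    is the dominating function.\<close>
  define h :: "nat \<Rightarrow> real" where "h n = 1 / real (Suc n)" for n
  have h: "h n > 0" "h n \<le> 1" for n by (simp_all add: h_def)
  have h0: "h \<longlonglongrightarrow> 0" unfolding h_def using LIMSEQ_Suc[OF lim_1_over_n] .
  define s where "s n z = (f (z + of_real (h n) * e) - f z) /\<^sub>R h n" for n z
  have "(\<lambda>n. LINT z|lborel. s n z) \<longlonglongrightarrow> (LINT z|lborel. pd e f z)"
  proof (rule integral_dominated_convergence[where w = "\<lambda>z. indicator (cball 0 (K + 1)) z *\<^sub>R M"])
    show "integrable lborel (\<lambda>z::complex. indicator (cball 0 (K + 1)) z *\<^sub>R M)"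
      by (intro borel_integrable_compact continuous_intros compact_cball)
    show "AE z in lborel. (\<lambda>n. s n z) \<longlonglongrightarrow> pd e f z"
    proof (rule AE_I2)
      fix z
      have "((\<lambda>t::real. norm (f (z + of_real (0 + t) * e) - f (z + of_real 0 * e) - t *\<^sub>R pd e f z) / norm t) \<longlongrightarrow> 0) (at 0)"
        using pd_along[where w = z and t = 0 and e = e, OF smooth_differentiable[OF f(1)]]
        by (simp add: has_vector_derivative_def has_derivative_at)
      moreover have "filterlim h (at 0) sequentially"
        unfolding filterlim_at using h0 h by (auto simp: less_imp_neq[symmetric])
      ultimately have "(\<lambda>n. norm (f (z + of_real (0 + h n) * e) - f (z + of_real 0 * e) - h n *\<^sub>R pd e f z) / norm (h n)) \<longlonglongrightarrow> 0"
        by (rule filterlim_compose)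
      moreover have "norm (f (z + of_real (0 + h n) * e) - f (z + of_real 0 * e) - h n *\<^sub>R pd e f z) / norm (h n)
          = norm (s n z - pd e f z)" for n
      proof -
        have "s n z - pd e f z = (f (z + of_real (h n) * e) - f z - h n *\<^sub>R pd e f z) /\<^sub>R h n"
          using h[of n] by (simp add: s_def scaleR_diff_right)
        then show ?thesis using h[of n] by (simp add: divide_inverse_commute)
      qed
      ultimately show "(\<lambda>n. s n z) \<longlonglongrightarrow> pd e f z"
        by (simp add: LIM_zero_iff tendsto_norm_zero_iff)
    qed
    show "AE z in lborel. norm (s n z) \<le> indicator (cball 0 (K + 1)) z *\<^sub>R M" for n
    proof (rule AE_I2)
      fix z
      show "norm (s n z) \<le> indicator (cball 0 (K + 1)) z *\<^sub>R M"
      proof (cases "norm z \<le> K + 1")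
        case False
        have "norm z \<le> norm (z + of_real (h n) * e) + h n"
          using norm_triangle_ineq4[of "z + of_real (h n) * e" "of_real (h n) * e"] ne h[of n]
          by (simp add: norm_mult)
        then have "f z = 0" "f (z + of_real (h n) * e) = 0"
          using False K(2)[of z] K(2)[of "z + of_real (h n) * e"] h[of n] by fastforce+
        then show ?thesis using False by (simp add: s_def)
      next
        case True
        have "norm (f (z + of_real (h n) * e) - f (z + of_real 0 * e)) \<le> M * norm (h n - 0)"
        proof (rule differentiable_bound[where S = "{0..h n}" and f = "\<lambda>t. f (z + of_real t * e)"])
          show "((\<lambda>t. f (z + of_real t * e)) has_derivative (\<lambda>s. s *\<^sub>R pd e f (z + of_real t * e))) (at t within {0..h n})" for t
            using pd_along[OF smooth_differentiable[OF f(1)]]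
            by (auto simp: has_vector_derivative_def intro: has_derivative_at_withinI)
          show "onorm (\<lambda>s. s *\<^sub>R pd e f (z + of_real t * e)) \<le> M" for t
            using M by (intro onorm_bound) (auto simp: mult.commute[of M] intro: mult_left_mono)
        qed (use h[of n] in auto)
        then show ?thesis using True h[of n] by (simp add: s_def divide_inverse_commute[symmetric] pos_divide_le_eq)
      qed
    qed
  qed (auto simp: s_def)
  moreover have "(LINT z|lborel. s n z) = 0" for n
  proof -
    have "integrable lborel (\<lambda>z. f (z + of_real (h n) * e))"
    proof (rule integrable_bsupp)
      show "continuous_on UNIV (\<lambda>z. f (z + of_real (h n) * e))"
        by (intro continuous_on_compose2[OF cf(1)] continuous_intros) auto
      have "{z. f (z + of_real (h n) * e) \<noteq> 0} = (\<lambda>z. - (of_real (h n) * e) + z) ` {z. f z \<noteq> 0}"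
        by (force simp: image_iff intro: exI[of _ "_ + of_real (h n) * e"])
      then show "bounded {z. f (z + of_real (h n) * e) \<noteq> 0}"
        using f(2) bounded_translation by metis
    qed
    then show ?thesis using if' by (simp add: s_def integral_shift)
  qed
  ultimately show ?thesis using LIMSEQ_unique[OF _ tendsto_const] by simp
qed

section \<open>Iterated integrals over the plane and a pointwise bound by an integral\<close>

lemma lborel_complex:
  "lborel = distr (lborel \<Otimes>\<^sub>M lborel) borel (\<lambda>(x, y). Complex x y)"
proof (rule lborel_eqI)
  have [measurable]: "(\<lambda>(x, y). Complex x y) \<in> (lborel \<Otimes>\<^sub>M lborel) \<rightarrow>\<^sub>M borel"
    unfolding lborel_prod measurable_lborel2 by (intro borel_measurable_continuous_onI)
       (auto simp: case_prod_unfold Complex_eq intro!: continuous_intros)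
  fix l u :: complex
  assume lu: "\<And>b. b \<in> Basis \<Longrightarrow> l \<bullet> b \<le> u \<bullet> b"
  have le: "Re l \<le> Re u" "Im l \<le> Im u"
    using lu[of 1] lu[of \<i>] by (auto simp: Basis_complex_def inner_complex_def)
  have "(\<lambda>(x, y). Complex x y) -` box l u \<inter> space (lborel \<Otimes>\<^sub>M lborel)
      = {Re l<..<Re u} \<times> {Im l<..<Im u}"
    by (auto simp: box_def Basis_complex_def inner_complex_def space_pair_measure)
  then have "emeasure (distr (lborel \<Otimes>\<^sub>M lborel) borel (\<lambda>(x, y). Complex x y)) (box l u)
      = emeasure (lborel \<Otimes>\<^sub>M lborel) ({Re l<..<Re u} \<times> {Im l<..<Im u})"
    by (simp add: emeasure_distr)
  also have "\<dots> = ennreal (Re u - Re l) * ennreal (Im u - Im l)"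
    using le by (subst lborel.emeasure_pair_measure_Times) auto
  also have "\<dots> = ennreal (\<Prod>b\<in>Basis. (u - l) \<bullet> b)"
    using le by (simp add: Basis_complex_def inner_complex_def ennreal_mult)
  finally show "emeasure (distr (lborel \<Otimes>\<^sub>M lborel) borel (\<lambda>(x, y). Complex x y)) (box l u)
      = (\<Prod>b\<in>Basis. (u - l) \<bullet> b)" .
qed simp

lemma nn_integral_complex:
  assumes [measurable]: "g \<in> borel_measurable borel"
  shows "(\<integral>\<^sup>+z. g z \<partial>lborel) = (\<integral>\<^sup>+x. \<integral>\<^sup>+y. g (Complex x y) \<partial>lborel \<partial>lborel)"
proof -
  have [measurable]: "(\<lambda>(x, y). Complex x y) \<in> (lborel \<Otimes>\<^sub>M lborel) \<rightarrow>\<^sub>M borel"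
    unfolding lborel_prod measurable_lborel2 by (intro borel_measurable_continuous_onI)
       (auto simp: case_prod_unfold Complex_eq intro!: continuous_intros)
  have "(\<integral>\<^sup>+z. g z \<partial>lborel) = (\<integral>\<^sup>+p. g (case p of (x, y) \<Rightarrow> Complex x y) \<partial>(lborel \<Otimes>\<^sub>M lborel))"
    by (subst lborel_complex) (simp add: nn_integral_distr)
  also have "\<dots> = (\<integral>\<^sup>+x. \<integral>\<^sup>+y. g (Complex x y) \<partial>lborel \<partial>lborel)"
    by (subst lborel.nn_integral_fst[symmetric]) (auto simp: case_prod_unfold)
  finally show ?thesis .
qed

text \<open>The fundamental theorem of calculus, started at a point where \<open>f\<close> vanishes.
  With a nonnegative integral on the right, nothing has to be integrable line by line when the bound
  is integrated again in the other variable.\<close>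

lemma norm_le_nn_integral_deriv:
  fixes f :: "real \<Rightarrow> complex"
  assumes f: "\<And>x. (f has_vector_derivative f' x) (at x)" and c: "continuous_on UNIV f'"
    and z: "\<And>x. x \<le> K \<Longrightarrow> f x = 0"
  shows "ennreal (norm (f a)) \<le> (\<integral>\<^sup>+x. norm (f' x) \<partial>lborel)"
proof -
  define k where "k = min K a"
  have k: "k \<le> a" "f k = 0" using z by (auto simp: k_def)
  have "(\<integral>x. indicator {k..a} x *\<^sub>R f' x \<partial>lborel) = f a - f k"
    by (rule integral_FTC_Icc[OF k(1)])
       (auto intro: has_vector_derivative_at_within f continuous_on_subset[OF c])
  moreover have "integrable lborel (\<lambda>x. indicator {k..a} x *\<^sub>R f' x)"
    by (intro borel_integrable_compact compact_Icc continuous_on_subset[OF c]) auto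
  ultimately have "ennreal (norm (f a)) \<le> (\<integral>\<^sup>+x. norm (indicator {k..a} x *\<^sub>R f' x) \<partial>lborel)"
    using k(2) integral_norm_bound_ennreal by fastforce
  also have "\<dots> \<le> (\<integral>\<^sup>+x. norm (f' x) \<partial>lborel)"
    by (intro nn_integral_mono) (auto simp: indicator_def)
  finally show ?thesis .
qed

text \<open>An endpoint Sobolev inequality: integrate \<open>pd 1 g\<close> along the horizontal
  line through \<open>w\<close>, then \<open>pd \<i> (pd 1 g)\<close> along each vertical line.
  Applied to the squared modulus of a test function, it converts integrals into values at a
  point.\<close>

lemma norm_le_integral_mixed_pd:
  fixes g :: "complex \<Rightarrow> complex"
  assumes g: "smooth g" "bsupp g"
  shows "norm (g w) \<le> (LINT z|lborel. norm (pd \<i> (pd 1 g) z))"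
proof -
  obtain K where K: "K > 0" "\<And>z. g z \<noteq> 0 \<Longrightarrow> norm z \<le> K"
    using g(2) unfolding bounded_pos by auto
  have "bsupp (pd 1 g)" by (rule bsupp_pd[OF g(2)])
  then obtain K' where K': "K' > 0" "\<And>z. pd 1 g z \<noteq> 0 \<Longrightarrow> norm z \<le> K'"
    unfolding bounded_pos by auto
  have s: "smooth (pd 1 g)" "smooth (pd \<i> (pd 1 g))" using g by auto
  have Cplx: "Complex x y = \<i> * of_real y + of_real x * 1" "Complex x y = of_real x + of_real y * \<i>" for x y
    by (auto simp: complex_eq_iff)
  have c1: "continuous_on UNIV (\<lambda>x. Complex x y)" and c2: "continuous_on UNIV (\<lambda>y. Complex x y)" for x y
    by (auto simp: Cplx intro!: continuous_intros)
  have inner: "ennreal (norm (pd 1 g (Complex x y))) \<le> (\<integral>\<^sup>+y. norm (pd \<i> (pd 1 g) (Complex x y)) \<partial>lborel)" for x y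
  proof (rule norm_le_nn_integral_deriv[where K = "- K' - 1" and f = "\<lambda>y. pd 1 g (Complex x y)" and a = y])
    show "((\<lambda>y. pd 1 g (Complex x y)) has_vector_derivative pd \<i> (pd 1 g) (Complex x y)) (at y)" for y
      unfolding Cplx(2) by (rule pd_along[OF smooth_differentiable[OF s(1)]])
    show "continuous_on UNIV (\<lambda>y. pd \<i> (pd 1 g) (Complex x y))"
      by (rule continuous_on_compose2[OF smooth_continuous_on[OF s(2), of UNIV] c2]) auto
    show "pd 1 g (Complex x y) = 0" if "y \<le> - K' - 1" for y
      using K'(2)[of "Complex x y"] abs_Im_le_cmod[of "Complex x y"] that K'(1) by force
  qed
  have "ennreal (norm (g (Complex (Re w) (Im w)))) \<le> (\<integral>\<^sup>+x. norm (pd 1 g (Complex x (Im w))) \<partial>lborel)"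
  proof (rule norm_le_nn_integral_deriv[where K = "- K - 1" and f = "\<lambda>x. g (Complex x (Im w))" and a = "Re w"])
    show "((\<lambda>x. g (Complex x (Im w))) has_vector_derivative pd 1 g (Complex x (Im w))) (at x)" for x
      unfolding Cplx(1) by (rule pd_along[OF smooth_differentiable[OF g(1)]])
    show "continuous_on UNIV (\<lambda>x. pd 1 g (Complex x (Im w)))"
      by (rule continuous_on_compose2[OF smooth_continuous_on[OF s(1), of UNIV] c1]) auto
    show "g (Complex x (Im w)) = 0" if "x \<le> - K - 1" for x
      using K(2)[of "Complex x (Im w)"] abs_Re_le_cmod[of "Complex x (Im w)"] that K(1) by force
  qed
  also have "\<dots> \<le> (\<integral>\<^sup>+x. \<integral>\<^sup>+y. norm (pd \<i> (pd 1 g) (Complex x y)) \<partial>lborel \<partial>lborel)"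
    by (intro nn_integral_mono inner)
  also have "\<dots> = (\<integral>\<^sup>+z. norm (pd \<i> (pd 1 g) z) \<partial>lborel)"
    using smooth_borel[OF s(2)] by (subst nn_integral_complex) auto
  also have "\<dots> = ennreal (LINT z|lborel. norm (pd \<i> (pd 1 g) z))"
    using bsupp_pd[OF bsupp_pd[OF g(2)]] smooth_continuous_on[OF s(2)]
    by (intro nn_integral_eq_integral integrable_norm integrable_bsupp) auto
  finally show ?thesis by (simp add: Bochner_Integration.integral_nonneg)
qed

section \<open>The magnetic gradient\<close>

abbreviation (input) normsq :: "(complex \<Rightarrow> complex) \<Rightarrow> real" where
  "normsq f \<equiv> LINT z|lborel. (cmod (f z))\<^sup>2"

lemma test_funI: "smooth f \<Longrightarrow> bsupp f \<Longrightarrow> test_fun f"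
  by (simp add: test_fun_def)

lemma test_fun_smooth: "test_fun f \<Longrightarrow> smooth f" and test_fun_bsupp: "test_fun f \<Longrightarrow> bsupp f"
  by (simp_all add: test_fun_def)

lemma bsupp_mult: 
  fixes f :: "complex \<Rightarrow> 'a::mult_zero"
  shows "bsupp f \<Longrightarrow> bsupp (\<lambda>z. c z * f z)" "bsupp f \<Longrightarrow> bsupp (\<lambda>z. f z * c z)"
  by (rule bounded_subset, assumption, force)+

lemma bsupp_add: 
  fixes f g :: "complex \<Rightarrow> 'a::monoid_add"
  shows "bsupp f \<Longrightarrow> bsupp g \<Longrightarrow> bsupp (\<lambda>z. f z + g z)"
  by (rule bounded_subset[of "{z. f z \<noteq> 0} \<union> {z. g z \<noteq> 0}"]) auto

lemma test_fun_mult: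
  "smooth c \<Longrightarrow> test_fun f \<Longrightarrow> test_fun (\<lambda>z. c z * f z)"
  "smooth c \<Longrightarrow> test_fun f \<Longrightarrow> test_fun (\<lambda>z. f z * c z)"
  unfolding test_fun_def by (intro conjI smooth_mult bsupp_mult; simp)+

lemma test_fun_add: "test_fun f \<Longrightarrow> test_fun g \<Longrightarrow> test_fun (\<lambda>z. f z + g z)"
  unfolding test_fun_def by (intro conjI smooth_add bsupp_add; simp)

lemma test_fun_pd: "test_fun f \<Longrightarrow> e = 1 \<or> e = \<i> \<Longrightarrow> test_fun (pd e f)"
  by (auto simp: test_fun_def intro: bsupp_pd)

lemma integral_pd_test: "test_fun f \<Longrightarrow> e = 1 \<or> e = \<i> \<Longrightarrow> (LINT z|lborel. pd e f z) = 0"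
  by (rule integral_pd) (auto simp: test_fun_def)

lemma integrable_test: "test_fun f \<Longrightarrow> integrable lborel f"
  by (auto simp: test_fun_def intro: integrable_bsupp smooth_continuous_on)

lemma integrable_cmod2:
  assumes "test_fun f" "continuous_on UNIV c"
  shows "integrable lborel (\<lambda>z. c z * (cmod (f z))\<^sup>2)"
proof (rule integrable_bsupp)
  have "continuous_on UNIV f" by (rule smooth_continuous_on[OF test_fun_smooth[OF assms(1)]])
  then show "continuous_on UNIV (\<lambda>z. c z * (cmod (f z))\<^sup>2)"
    using assms(2) by (intro continuous_intros)
  show "bsupp (\<lambda>z. c z * (cmod (f z))\<^sup>2)"
    by (rule bounded_subset[OF test_fun_bsupp[OF assms(1)]]) auto
qed

lemma integrable_cmod2': "test_fun f \<Longrightarrow> integrable lborel (\<lambda>z. (cmod (f z))\<^sup>2)"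
  using integrable_cmod2[of f "\<lambda>_. 1"] by simp

lemma young: "0 < t \<Longrightarrow> 2 * (x * y) \<le> t * x\<^sup>2 + y\<^sup>2 / t" for x y t :: real
proof -
  assume t: "0 < t"
  have "0 \<le> (t * x - y)\<^sup>2 / t" using t by simp
  also have "(t * x - y)\<^sup>2 / t = t * x\<^sup>2 + y\<^sup>2 / t - 2 * (x * y)"
    using t by (simp add: power2_diff field_simps power2_eq_square)
  finally show ?thesis by simp
qed

text \<open>The integrals of \<open>pd 1 P\<close> and \<open>pd \<i> Q\<close> vanish, so an
  inequality that holds pointwise up to a divergence may be integrated. The integrations by parts
  for the magnetic gradient take this form, each with its own current built from \<open>P\<close>
  and \<open>Q\<close>.\<close>

lemma div_integral_le:
  assumes P: "test_fun P" and Q: "test_fun Q"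
    and F: "integrable lborel F" and G: "integrable lborel G"
    and le: "\<And>z. F z \<le> Re (\<alpha> * pd 1 P z + \<beta> * pd \<i> Q z) + G z"
  shows "(LINT z|lborel. F z) \<le> (LINT z|lborel. G z)"
proof -
  have i: "integrable lborel (pd 1 P)" "integrable lborel (pd \<i> Q)"
    using assms by (auto intro!: integrable_test test_fun_pd)
  have "(LINT z|lborel. F z) \<le> (LINT z|lborel. Re (\<alpha> * pd 1 P z + \<beta> * pd \<i> Q z) + G z)"
    using i F G le by (intro integral_mono) auto
  also have "\<dots> = Re (\<alpha> * (LINT z|lborel. pd 1 P z) + \<beta> * (LINT z|lborel. pd \<i> Q z)) + (LINT z|lborel. G z)"
    using i G by simp
  also have "\<dots> = (LINT z|lborel. G z)" using P Q by (simp add: integral_pd_test)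
  finally show ?thesis .
qed

text \<open>The bookkeeping of \<open>sup_le\<close>. With M = t n0 + nL / t, both n0 and g are at
  most M; t \<ge> 1 serves for n0 and for dropping the divisor t from the commutator terms. The
  contributions M, b^2 M, b M and g \<le> M add up to the constant.\<close>

lemma sup_arith:
  fixes n0 nL g p t b X :: real
  assumes t: "1 \<le> t" and b: "0 \<le> b" and nn: "0 \<le> n0" "0 \<le> nL" "0 \<le> g"
    and X: "X \<le> t * n0 + p / t + g" and p: "p \<le> nL + b\<^sup>2 * n0 + b * g"
    and g: "g \<le> (t * n0 + nL / t) / 2"
  shows "X \<le> (2 + b + b\<^sup>2) * (t * n0 + nL / t)"
proof -
  define M where "M = t * n0 + nL / t"
  have tn: "n0 \<le> t * n0" using t nn by (simp add: mult_le_cancel_right1)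
  have L0: "0 \<le> nL / t" using t nn by simp
  have le: "y / t \<le> y" if "0 \<le> y" for y using that t by (simp add: divide_le_eq mult_le_cancel_left1)
  have "p / t \<le> (nL + b\<^sup>2 * n0 + b * g) / t" using p t by (simp add: divide_right_mono)
  also have "\<dots> = nL / t + (b\<^sup>2 * n0 + b * g) / t" by (simp add: add_divide_distrib)
  also have "\<dots> \<le> nL / t + (b\<^sup>2 * n0 + b * g)" using le[of "b\<^sup>2 * n0 + b * g"] b nn by simp
  finally have pt: "p / t \<le> nL / t + b\<^sup>2 * n0 + b * g" by simp
  have M: "n0 \<le> M" "g \<le> M / 2" using g tn L0 nn unfolding M_def by linarith+
  then have "g \<le> M" using nn by linarith
  note M = M this
  have "b\<^sup>2 * n0 \<le> b\<^sup>2 * M" "b * g \<le> b * M" using M b by (auto intro!: mult_left_mono)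
  then have "X \<le> M + b\<^sup>2 * M + b * M + M" using X pt M unfolding M_def by linarith
  then show ?thesis unfolding M_def[symmetric] by (simp add: algebra_simps)
qed

text \<open>What the estimates see of the potential is a bound for its curl. In the application A1 =
  pd2 phi and A2 = - pd1 phi, so the curl is minus the Laplacian of phi and is bounded, although A1
  and A2 may grow linearly.\<close>

locale magnetic =
  fixes A1 A2 :: "complex \<Rightarrow> real" and b :: real
  assumes smooth_A: "smooth A1" "smooth A2"
    and curl_bound: "\<And>z. \<bar>pd 1 A2 z - pd \<i> A1 z\<bar> \<le> b"
begin

definition N1 :: "(complex \<Rightarrow> complex) \<Rightarrow> complex \<Rightarrow> complex" where
  "N1 f z = pd 1 f z - \<i> * of_real (A1 z) * f z"

definition N2 :: "(complex \<Rightarrow> complex) \<Rightarrow> complex \<Rightarrow> complex" where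
  "N2 f z = pd \<i> f z - \<i> * of_real (A2 z) * f z"

definition L :: "(complex \<Rightarrow> complex) \<Rightarrow> complex \<Rightarrow> complex" where
  "L f z = N1 (N1 f) z + N2 (N2 f) z"

definition curl :: "complex \<Rightarrow> real" where
  "curl z = pd 1 A2 z - pd \<i> A1 z"

lemma b_nonneg: "0 \<le> b" using curl_bound[of 0] by linarith

lemma smooth_N: 
  assumes "smooth f" shows "smooth (N1 f)" "smooth (N2 f)"
  unfolding N1_def[abs_def] N2_def[abs_def] using assms smooth_A
  by (auto intro!: smooth_diff smooth_mult smooth_of_real smooth_pd)

lemma test_fun_N: 
  assumes "test_fun f" shows "test_fun (N1 f)" "test_fun (N2 f)"
proof -
  have "bsupp (\<lambda>z. pd 1 f z + (- \<i> * of_real (A1 z)) * f z)"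
       "bsupp (\<lambda>z. pd \<i> f z + (- \<i> * of_real (A2 z)) * f z)"
    using assms by (intro bsupp_add bsupp_mult bsupp_pd; simp add: test_fun_def)+
  then show "test_fun (N1 f)" "test_fun (N2 f)"
    using assms smooth_N unfolding test_fun_def N1_def N2_def by simp_all
qed

lemma test_fun_L: "test_fun f \<Longrightarrow> test_fun (L f)"
  unfolding L_def[abs_def] by (intro test_fun_add test_fun_N)

text \<open>The gauge terms are imaginary multiples and cancel between the two factors. Hence
  Hermitian products obey the Leibniz rule with the magnetic gradient, and integration by parts does
  not produce A itself.\<close>

lemma pd_mult_cnj:
  assumes "smooth f" "smooth g"
  shows "pd 1 (\<lambda>z. f z * cnj (g z)) z = N1 f z * cnj (g z) + f z * cnj (N1 g z)"
        "pd \<i> (\<lambda>z. f z * cnj (g z)) z = N2 f z * cnj (g z) + f z * cnj (N2 g z)"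
  using assms by (auto simp: pd_mult pd_cnj smooth_cnj N1_def N2_def algebra_simps)

lemma N_mult:
  assumes "smooth c" "smooth f"
  shows "N1 (\<lambda>z. c z * f z) z = pd 1 c z * f z + c z * N1 f z"
        "N2 (\<lambda>z. c z * f z) z = pd \<i> c z * f z + c z * N2 f z"
  using assms by (auto simp: pd_mult N1_def N2_def algebra_simps)

lemma N_add:
  assumes "smooth f" "smooth g"
  shows "N1 (\<lambda>z. f z + g z) z = N1 f z + N1 g z" "N2 (\<lambda>z. f z + g z) z = N2 f z + N2 g z"
  using assms by (auto simp: pd_add' N1_def N2_def algebra_simps)

lemma N_commute:
  assumes f: "smooth f"
  shows "N1 (N2 f) z = N2 (N1 f) z - \<i> * of_real (curl z) * f z"
proof -
  have "smooth (\<lambda>z. complex_of_real (A1 z))" "smooth (\<lambda>z. complex_of_real (A2 z))"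
    using smooth_A by auto
  note s = smooth_A f this
  have "pd 1 (N2 f) z = pd 1 (pd \<i> f) z - \<i> * (of_real (pd 1 A2 z) * f z + of_real (A2 z) * pd 1 f z)"
    unfolding N2_def[abs_def] using s
    by (simp add: pd_simps smooth_mult smooth_pd) (simp add: algebra_simps)
  moreover have "pd \<i> (N1 f) z = pd \<i> (pd 1 f) z - \<i> * (of_real (pd \<i> A1 z) * f z + of_real (A1 z) * pd \<i> f z)"
    unfolding N1_def[abs_def] using s
    by (simp add: pd_simps smooth_mult smooth_pd) (simp add: algebra_simps)
  ultimately have "N1 (N2 f) z = pd 1 (pd \<i> f) z
      - \<i> * (of_real (pd 1 A2 z) * f z + of_real (A2 z) * pd 1 f z) - \<i> * of_real (A1 z) * N2 f z"
    "N2 (N1 f) z = pd \<i> (pd 1 f) z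
      - \<i> * (of_real (pd \<i> A1 z) * f z + of_real (A1 z) * pd \<i> f z) - \<i> * of_real (A2 z) * N1 f z"
    by (simp_all add: N1_def[of "N2 f"] N2_def[of "N1 f"])
  then show ?thesis by (simp add: pd_commute[OF f] N1_def N2_def curl_def algebra_simps)
qed

text \<open>The current is N w times the conjugate of w; the real part of its divergence is Re (L w
  cnj w) + |N w|^2. The weight \<open>t\<close> of Young's inequality stays free: t = E balances the
  two terms for approximate eigenfunctions.\<close>

lemma energy_identity_le:
  assumes w: "test_fun w" and t: "0 < t"
  shows "(LINT z|lborel. (cmod (N1 w z))\<^sup>2 + (cmod (N2 w z))\<^sup>2)
    \<le> (LINT z|lborel. (t * (cmod (w z))\<^sup>2 + (cmod (L w z))\<^sup>2 / t) / 2)"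
proof (rule div_integral_le[where \<alpha> = 1 and \<beta> = 1])
  note s = w[THEN test_fun_smooth] w[THEN test_fun_N(1), THEN test_fun_smooth]
    w[THEN test_fun_N(2), THEN test_fun_smooth]
  show "test_fun (\<lambda>z. N1 w z * cnj (w z))" "test_fun (\<lambda>z. N2 w z * cnj (w z))"
    by (intro test_fun_mult(2) test_fun_N smooth_cnj w s)+
  show "integrable lborel (\<lambda>z. (cmod (N1 w z))\<^sup>2 + (cmod (N2 w z))\<^sup>2)"
    using w by (intro Bochner_Integration.integrable_add integrable_cmod2' test_fun_N)
  show "integrable lborel (\<lambda>z. (t * (cmod (w z))\<^sup>2 + (cmod (L w z))\<^sup>2 / t) / 2)"
    using w by (intro Bochner_Integration.integrable_add integrable_divide_zero integrable_mult_right integrable_cmod2' test_fun_L)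
  fix z
  have arith: "p \<le> r + p + m / 2" if "- r \<le> q" "2 * q \<le> m" for p q r m :: real
    using that by linarith
  have di: "Re (1 * pd 1 (\<lambda>z. N1 w z * cnj (w z)) z + 1 * pd \<i> (\<lambda>z. N2 w z * cnj (w z)) z)
    = Re (L w z * cnj (w z)) + ((cmod (N1 w z))\<^sup>2 + (cmod (N2 w z))\<^sup>2)"
    using s by (simp add: pd_mult_cnj L_def cmod_power2) (simp add: algebra_simps power2_eq_square)
  have "- Re (L w z * cnj (w z)) \<le> cmod (w z) * cmod (L w z)"
    using abs_Re_le_cmod[of "L w z * cnj (w z)"] by (simp add: norm_mult mult.commute)
  moreover have "2 * (cmod (w z) * cmod (L w z)) \<le> t * (cmod (w z))\<^sup>2 + (cmod (L w z))\<^sup>2 / t"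
    by (rule young[OF t])
  ultimately show "(cmod (N1 w z))\<^sup>2 + (cmod (N2 w z))\<^sup>2
    \<le> Re (1 * pd 1 (\<lambda>z. N1 w z * cnj (w z)) z + 1 * pd \<i> (\<lambda>z. N2 w z * cnj (w z)) z)
      + (t * (cmod (w z))\<^sup>2 + (cmod (L w z))\<^sup>2 / t) / 2"
    unfolding di using arith by blast
qed

lemma energy_le:
  assumes w: "test_fun w" and t: "0 < t"
  shows "(LINT z|lborel. (cmod (N1 w z))\<^sup>2 + (cmod (N2 w z))\<^sup>2)
    \<le> (t * (normsq w) + (normsq (L w)) / t) / 2"
  using energy_identity_le[OF assms] w by (simp add: integrable_cmod2' test_fun_L)

text \<open>Integrating by parts twice replaces Re (N2 N2 w, N1 N1 w) by |N2 N1 w|^2 up to commutators; no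
  derivative of the curl appears.\<close>

lemma mixed_le:
  assumes w: "test_fun w"
  shows "(LINT z|lborel. (cmod (N2 (N1 w) z))\<^sup>2) \<le>
    (normsq (L w)) + b\<^sup>2 * (normsq w)
     + b * (LINT z|lborel. (cmod (N1 w z))\<^sup>2 + (cmod (N2 w z))\<^sup>2)"
proof -
  \<comment> \<open>The current is (2 P, - 2 Q). Its divergence contains the conjugates of
    \<open>N1 (N2 (N1 w))\<close> and \<open>N2 (N1 (N1 w))\<close>, which cancel up to the curl
    times \<open>N1 w\<close>.\<close>
  define P where "P z = N2 w z * cnj (N2 (N1 w) z)" for z
  define Q where "Q z = N2 w z * cnj (N1 (N1 w) z)" for z
  note tf = w test_fun_N[OF w] test_fun_N[OF test_fun_N(1)[OF w]] test_fun_N[OF test_fun_N(2)[OF w]]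
  note s = tf[THEN test_fun_smooth]
  have "(LINT z|lborel. (cmod (N2 (N1 w) z))\<^sup>2) \<le>
    (LINT z|lborel. (cmod (L w z))\<^sup>2 + b\<^sup>2 * (cmod (w z))\<^sup>2 + b * ((cmod (N1 w z))\<^sup>2 + (cmod (N2 w z))\<^sup>2))"
  proof (rule div_integral_le[where \<alpha> = 2 and \<beta> = "-2"])
    show "test_fun P" "test_fun Q" unfolding P_def[abs_def] Q_def[abs_def]
      by (intro test_fun_mult(2) smooth_cnj tf s)+
    show "integrable lborel (\<lambda>z. (cmod (N2 (N1 w) z))\<^sup>2)"
      using tf by (intro integrable_cmod2')
    show "integrable lborel (\<lambda>z. (cmod (L w z))\<^sup>2 + b\<^sup>2 * (cmod (w z))\<^sup>2 + b * ((cmod (N1 w z))\<^sup>2 + (cmod (N2 w z))\<^sup>2))"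
      using tf by (intro Bochner_Integration.integrable_add integrable_mult_right integrable_cmod2' test_fun_L)
    fix z
    define v a1 a2 a11 a21 a22 \<beta> where d: "v = w z" "a1 = N1 w z" "a2 = N2 w z" "a11 = N1 (N1 w) z"
      "a21 = N2 (N1 w) z" "a22 = N2 (N2 w) z" "\<beta> = curl z"
    have \<beta>: "\<bar>\<beta>\<bar> \<le> b" unfolding d curl_def by (rule curl_bound)
    have c: "N1 (N2 w) z = a21 - \<i> * of_real \<beta> * v"
      "N1 (N2 (N1 w)) z = N2 (N1 (N1 w)) z - \<i> * of_real \<beta> * a1"
      using s by (simp_all add: N_commute d)
    have di: "Re (2 * pd 1 P z + (-2) * pd \<i> Q z) = 2 * (cmod a21)\<^sup>2 - 2 * Re (a22 * cnj a11)
        - 2 * \<beta> * Re (\<i> * v * cnj a21) + 2 * \<beta> * Re (\<i> * a2 * cnj a1)"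
    proof -
      have "pd 1 P z = (a21 - \<i> * of_real \<beta> * v) * cnj a21
          + a2 * cnj (N2 (N1 (N1 w)) z - \<i> * of_real \<beta> * a1)"
        "pd \<i> Q z = a22 * cnj a11 + a2 * cnj (N2 (N1 (N1 w)) z)"
        unfolding P_def[abs_def] Q_def[abs_def] c[symmetric] unfolding d by (intro pd_mult_cnj s)+
      then show ?thesis by (simp add: cmod_power2) (simp add: algebra_simps power2_eq_square)
    qed
    have "(cmod (L w z))\<^sup>2 \<ge> 2 * Re (a22 * cnj a11)"
    proof -
      have "(cmod (L w z))\<^sup>2 - 2 * Re (a22 * cnj a11) = (cmod a11)\<^sup>2 + (cmod a22)\<^sup>2"
        by (simp add: L_def d[symmetric] cmod_power2) (simp add: algebra_simps power2_eq_square)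
      then show ?thesis using zero_le_power2[of "cmod a11"] zero_le_power2[of "cmod a22"] by linarith
    qed
    \<comment> \<open>The copy of |a21|^2 on the right is absorbed by one of the two copies in the
      divergence; the factor 2 in the current provides for that.\<close>
    moreover have "2 * \<beta> * Re (\<i> * v * cnj a21) \<le> b\<^sup>2 * (cmod v)\<^sup>2 + (cmod a21)\<^sup>2"
    proof -
      have "2 * \<beta> * Re (\<i> * v * cnj a21) \<le> 2 * (\<bar>\<beta>\<bar> * \<bar>Re (\<i> * v * cnj a21)\<bar>)"
        using abs_ge_self[of "\<beta> * Re (\<i> * v * cnj a21)"] by (simp add: abs_mult)
      also have "\<dots> \<le> 2 * (b * (cmod v * cmod a21))"
        using \<beta> abs_Re_le_cmod[of "\<i> * v * cnj a21"] b_nonneg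
        by (intro mult_left_mono mult_mono) (auto simp: norm_mult)
      also have "\<dots> \<le> b\<^sup>2 * (cmod v)\<^sup>2 + (cmod a21)\<^sup>2"
        using young[of 1 "b * cmod v" "cmod a21"] by (simp add: power_mult_distrib)
      finally show ?thesis .
    qed
    moreover have "- (2 * \<beta> * Re (\<i> * a2 * cnj a1)) \<le> b * ((cmod a1)\<^sup>2 + (cmod a2)\<^sup>2)"
    proof -
      have "- (2 * \<beta> * Re (\<i> * a2 * cnj a1)) \<le> 2 * (\<bar>\<beta>\<bar> * \<bar>Re (\<i> * a2 * cnj a1)\<bar>)"
        using abs_ge_minus_self[of "\<beta> * Re (\<i> * a2 * cnj a1)"] by (simp add: abs_mult)
      also have "\<dots> \<le> 2 * (b * (cmod a1 * cmod a2))"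
        using \<beta> abs_Re_le_cmod[of "\<i> * a2 * cnj a1"] b_nonneg
        by (intro mult_left_mono mult_mono) (auto simp: norm_mult mult.commute)
      also have "\<dots> \<le> b * ((cmod a1)\<^sup>2 + (cmod a2)\<^sup>2)"
        using mult_left_mono[OF young[of 1 "cmod a1" "cmod a2"] b_nonneg] by simp
      finally show ?thesis .
    qed
    ultimately show "(cmod (N2 (N1 w) z))\<^sup>2 \<le> Re (2 * pd 1 P z + (-2) * pd \<i> Q z)
      + ((cmod (L w z))\<^sup>2 + b\<^sup>2 * (cmod (w z))\<^sup>2 + b * ((cmod (N1 w z))\<^sup>2 + (cmod (N2 w z))\<^sup>2))"
      unfolding d[symmetric] di by linarith
  qed
  also have "\<dots> = (normsq (L w)) + b\<^sup>2 * (normsq w)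
     + b * (LINT z|lborel. (cmod (N1 w z))\<^sup>2 + (cmod (N2 w z))\<^sup>2)"
    using tf by (simp add: integrable_cmod2' test_fun_L)
  finally show ?thesis .
qed

text \<open>The bound by a mixed second derivative, applied to |w|^2. By the Leibniz rule for N this
  derivative involves w, N1 w, N2 w and \<open>N2 (N1 w)\<close>, and the last is controlled by
  \<open>mixed_le\<close>. With t = E both terms on the right have the same order for functions
  oscillating at frequency sqrt E.\<close>

lemma sup_le:
  assumes w: "test_fun w" and t: "1 \<le> t"
  shows "(cmod (w x))\<^sup>2 \<le> (2 + b + b\<^sup>2) *
    (t * (normsq w) + (normsq (L w)) / t)"
proof -
  define n0 nL g p where d: "n0 = (normsq w)" "nL = (normsq (L w))"
    "g = (LINT z|lborel. (cmod (N1 w z))\<^sup>2 + (cmod (N2 w z))\<^sup>2)" "p = (LINT z|lborel. (cmod (N2 (N1 w) z))\<^sup>2)"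
  note tf = w test_fun_N[OF w] test_fun_N[OF test_fun_N(1)[OF w]]
  note s = tf[THEN test_fun_smooth]
  have nn: "n0 \<ge> 0" "nL \<ge> 0" "g \<ge> 0" unfolding d by (auto intro!: Bochner_Integration.integral_nonneg)
  have tg: "test_fun (\<lambda>z. w z * cnj (w z))" by (intro test_fun_mult(2) smooth_cnj w s)
  have t2: "test_fun (pd \<i> (pd 1 (\<lambda>z. w z * cnj (w z))))" using tg by (auto intro!: test_fun_pd)
  have "(cmod (w x))\<^sup>2 = cmod (w x * cnj (w x))" by (simp add: norm_mult power2_eq_square)
  also have "\<dots> \<le> (LINT z|lborel. cmod (pd \<i> (pd 1 (\<lambda>z. w z * cnj (w z))) z))"
    by (rule norm_le_integral_mixed_pd[OF test_fun_smooth[OF tg] test_fun_bsupp[OF tg]])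
  also have "\<dots> \<le> (LINT z|lborel. t * (cmod (w z))\<^sup>2 + (cmod (N2 (N1 w) z))\<^sup>2 / t + ((cmod (N1 w z))\<^sup>2 + (cmod (N2 w z))\<^sup>2))"
  proof (rule integral_mono)
    show "integrable lborel (\<lambda>z. cmod (pd \<i> (pd 1 (\<lambda>z. w z * cnj (w z))) z))"
      by (intro integrable_norm integrable_test t2)
    show "integrable lborel (\<lambda>z. t * (cmod (w z))\<^sup>2 + (cmod (N2 (N1 w) z))\<^sup>2 / t + ((cmod (N1 w z))\<^sup>2 + (cmod (N2 w z))\<^sup>2))"
      using tf by (intro Bochner_Integration.integrable_add integrable_mult_right integrable_divide_zero integrable_cmod2')
    fix z
    have "pd 1 (\<lambda>z. w z * cnj (w z)) = (\<lambda>z. N1 w z * cnj (w z) + w z * cnj (N1 w z))"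
      by (intro ext pd_mult_cnj s)
    then have "pd \<i> (pd 1 (\<lambda>z. w z * cnj (w z))) z
       = pd \<i> (\<lambda>z. N1 w z * cnj (w z) + w z * cnj (N1 w z)) z" by (rule arg_cong)
    also have "\<dots> = pd \<i> (\<lambda>z. N1 w z * cnj (w z)) z + pd \<i> (\<lambda>z. w z * cnj (N1 w z)) z"
      by (intro pd_add' smooth_mult smooth_cnj s)
    also have "\<dots> = (N2 (N1 w) z * cnj (w z) + N1 w z * cnj (N2 w z))
       + (N2 w z * cnj (N1 w z) + w z * cnj (N2 (N1 w) z))"
      by (intro arg_cong2[where f = "(+)"] pd_mult_cnj s)
    finally have e: "pd \<i> (pd 1 (\<lambda>z. w z * cnj (w z))) z = (N2 (N1 w) z * cnj (w z) + N1 w z * cnj (N2 w z))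
       + (N2 w z * cnj (N1 w z) + w z * cnj (N2 (N1 w) z))" .
    have "cmod (pd \<i> (pd 1 (\<lambda>z. w z * cnj (w z))) z) \<le> (cmod (w z) * cmod (N2 (N1 w) z) + cmod (N1 w z) * cmod (N2 w z))
       + (cmod (N1 w z) * cmod (N2 w z) + cmod (w z) * cmod (N2 (N1 w) z))"
      unfolding e by (intro norm_triangle_mono) (simp_all add: norm_mult)
    also have "\<dots> = 2 * (cmod (w z) * cmod (N2 (N1 w) z)) + 2 * cmod (N1 w z) * cmod (N2 w z)"
      by simp
    also have "\<dots> \<le> t * (cmod (w z))\<^sup>2 + (cmod (N2 (N1 w) z))\<^sup>2 / t + ((cmod (N1 w z))\<^sup>2 + (cmod (N2 w z))\<^sup>2)"
      using t by (intro add_mono sum_squares_bound young) simp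
    finally show "cmod (pd \<i> (pd 1 (\<lambda>z. w z * cnj (w z))) z) \<le>
      t * (cmod (w z))\<^sup>2 + (cmod (N2 (N1 w) z))\<^sup>2 / t + ((cmod (N1 w z))\<^sup>2 + (cmod (N2 w z))\<^sup>2)" .
  qed
  also have "\<dots> = t * n0 + p / t + g" unfolding d using tf by (simp add: integrable_cmod2')
  finally have X: "(cmod (w x))\<^sup>2 \<le> t * n0 + p / t + g" .
  have p: "p \<le> nL + b\<^sup>2 * n0 + b * g" using mixed_le[OF w] unfolding d .
  have g: "g \<le> (t * n0 + nL / t) / 2" using energy_le[OF w, of t] t unfolding d by simp
  show ?thesis using sup_arith[OF t b_nonneg nn(1,2,3) X p g] unfolding d .
qed

end

section \<open>The commutator estimate\<close>

text \<open>The divergence of the commutator current, with every derivative already replaced by its value.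
  Here v, ai, aij stand for v, Ni v, Ni Nj v, and sigma is the reciprocal square root
  (R^2 + x1^2 + x2^2)^(-1/2), so that sigma - r2 sigma^3 = R^2 sigma^3 is the weight W.\<close>

lemma virial_algebra:
  fixes x1 x2 \<sigma> \<beta> E :: real and v a1 a2 a11 a12 a21 a22 f :: complex
  defines "X1 \<equiv> x1 * \<sigma>" and "X2 \<equiv> x2 * \<sigma>" and "r2 \<equiv> x1\<^sup>2 + x2\<^sup>2"
  assumes a12: "a12 = a21 - \<i> * of_real \<beta> * v" and a22: "a22 = f - of_real E * v - a11"
  shows "Re (a11 * cnj (of_real X1 * a1 + of_real X2 * a2)
      + a1 * cnj ((of_real (\<sigma> - x1\<^sup>2 * \<sigma> ^ 3) * a1 + of_real X1 * a11) + (of_real (- x1 * x2 * \<sigma> ^ 3) * a2 + of_real X2 * a12))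
      + (of_real (- (\<sigma> - x1\<^sup>2 * \<sigma> ^ 3) / 2) * (a1 * cnj a1 + a2 * cnj a2)
         + of_real (- X1 / 2) * ((a11 * cnj a1 + a1 * cnj a11) + (a12 * cnj a2 + a2 * cnj a12)))
      + (of_real (E / 2 * (\<sigma> - x1\<^sup>2 * \<sigma> ^ 3) + (\<sigma> ^ 3 - 3 * x1\<^sup>2 * \<sigma> ^ 5) / 4) * (v * cnj v)
         + of_real (E / 2 * X1 + x1 * \<sigma> ^ 3 / 4) * (a1 * cnj v + v * cnj a1))
      + (of_real (- x1 * \<sigma> ^ 3 / 2) * (a1 * cnj v) + of_real (\<sigma> / 2) * (a11 * cnj v + a1 * cnj a1)))
   + Re (a22 * cnj (of_real X1 * a1 + of_real X2 * a2)
      + a2 * cnj ((of_real (- x1 * x2 * \<sigma> ^ 3) * a1 + of_real X1 * a21) + (of_real (\<sigma> - x2\<^sup>2 * \<sigma> ^ 3) * a2 + of_real X2 * a22))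
      + (of_real (- (\<sigma> - x2\<^sup>2 * \<sigma> ^ 3) / 2) * (a1 * cnj a1 + a2 * cnj a2)
         + of_real (- X2 / 2) * ((a21 * cnj a1 + a1 * cnj a21) + (a22 * cnj a2 + a2 * cnj a22)))
      + (of_real (E / 2 * (\<sigma> - x2\<^sup>2 * \<sigma> ^ 3) + (\<sigma> ^ 3 - 3 * x2\<^sup>2 * \<sigma> ^ 5) / 4) * (v * cnj v)
         + of_real (E / 2 * X2 + x2 * \<sigma> ^ 3 / 4) * (a2 * cnj v + v * cnj a2))
      + (of_real (- x2 * \<sigma> ^ 3 / 2) * (a2 * cnj v) + of_real (\<sigma> / 2) * (a22 * cnj v + a2 * cnj a2)))
   = Re (f * cnj (of_real X1 * a1 + of_real X2 * a2))
     + (\<sigma> - r2 * \<sigma> ^ 3) / 2 * ((cmod a1)\<^sup>2 + (cmod a2)\<^sup>2)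
     + \<sigma> ^ 3 * (cmod (of_real x2 * a1 - of_real x1 * a2))\<^sup>2
     + (\<sigma> - r2 * \<sigma> ^ 3) / 2 * E * (cmod v)\<^sup>2
     + \<sigma> / 2 * Re (cnj v * f) - (- 2 * \<sigma> ^ 3 + 3 * r2 * \<sigma> ^ 5) / 4 * (cmod v)\<^sup>2
     + \<beta> * Re (\<i> * cnj v * (of_real X2 * a1 - of_real X1 * a2))"
  \<comment> \<open>\<open>a12\<close> carries the commutator and \<open>a22\<close> the equation.
    After their elimination the claim is a polynomial identity in real and imaginary parts, in which
    \<sigma> is a free variable.\<close>
  unfolding a12 a22 X1_def X2_def r2_def
  by (simp add: cmod_power2) (simp add: field_simps power2_eq_square power3_eq_cube)

section \<open>The weight function and its derivatives\<close>

lemma smooth_coord: "smooth (\<lambda>z. Re (z - c))" "smooth (\<lambda>z. Im (z - c))"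
  by (rule smooth_bounded_linear[OF bounded_linear_Re] smooth_bounded_linear[OF bounded_linear_Im];
      intro smooth_diff smooth_ident smooth_const)+

text \<open>The reciprocal of s = sqrt (R^2 + |z - x|^2). The multiplier field is grad s = (z - x)
  isq, of length below 1, and R^2 isq^3 is the weight W. Taking the reciprocal as the basic function
  makes all derivatives polynomial in it and in the coordinates.\<close>

definition isq :: "real \<Rightarrow> complex \<Rightarrow> complex \<Rightarrow> real" where
  "isq R x z = 1 / sqrt (R\<^sup>2 + (cmod (z - x))\<^sup>2)"

context
  fixes R :: real and x :: complex
  assumes R: "0 < R"
begin

lemma isq_base_pos: "0 < R\<^sup>2 + (cmod (z - x))\<^sup>2" using R by (simp add: add_pos_nonneg)

lemma isq_pos: "0 < isq R x z" using isq_base_pos by (simp add: isq_def)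

lemma isq_sq: "(isq R x z)\<^sup>2 * (R\<^sup>2 + ((Re (z - x))\<^sup>2 + (Im (z - x))\<^sup>2)) = 1"
  using isq_base_pos[of z] unfolding isq_def cmod_power2 by (simp add: power_divide)

lemma isq_le: "isq R x z \<le> 1 / R"
proof -
  have "R \<le> sqrt (R\<^sup>2 + (cmod (z - x))\<^sup>2)" using R by (intro real_le_rsqrt) simp
  then show ?thesis using R by (simp add: isq_def frac_le)
qed

lemma isq_has_derivative:
  "(isq R x has_derivative (\<lambda>h. - (Re (z - x) * Re h + Im (z - x) * Im h) * (isq R x z) ^ 3)) (at z)"
proof -
  define g where "g z = R\<^sup>2 + ((Re (z - x))\<^sup>2 + (Im (z - x))\<^sup>2)" for z
  have g: "(g has_derivative (\<lambda>h. 2 * (Re (z - x) * Re h + Im (z - x) * Im h))) (at z)"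
    unfolding g_def by (auto intro!: derivative_eq_intros simp: algebra_simps)
  have gz: "0 < g z" using isq_base_pos[of z] by (simp add: g_def cmod_power2)
  have "((\<lambda>t. 1 / sqrt t) has_real_derivative - (1 / 2) * (1 / sqrt (g z)) ^ 3) (at (g z))"
    using gz by (auto intro!: derivative_eq_intros simp: field_simps power3_eq_cube)
  then have "((\<lambda>z. 1 / sqrt (g z)) has_derivative
      (\<lambda>h. 2 * (Re (z - x) * Re h + Im (z - x) * Im h) * (- (1 / 2) * (1 / sqrt (g z)) ^ 3))) (at z)"
    by (rule DERIV_compose_FDERIV[OF _ g])
  moreover have "isq R x = (\<lambda>z. 1 / sqrt (g z))"
    by (simp add: isq_def g_def cmod_power2 fun_eq_iff)
  ultimately show ?thesis by (simp add: algebra_simps)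
qed

lemma pd_isq: "pd e (isq R x) z = - (Re (z - x) * Re e + Im (z - x) * Im e) * (isq R x z) ^ 3"
  by (rule pd_has_derivative[OF isq_has_derivative])

text \<open>Each first derivative is a coordinate times three factors \<open>isq\<close>, so every
  order of differentiability follows from the one before.\<close>

lemma smooth_isq: "smooth (isq R x)"
proof -
  have "Ck n (isq R x)" for n
  proof (induction n)
    case 0
    then show ?case using isq_has_derivative unfolding Ck.simps differentiable_def by blast
  next
    case (Suc n)
    have "smooth (\<lambda>z. - Re (z - x))" "smooth (\<lambda>z. - Im (z - x))"
      by (intro smooth_minus smooth_coord)+
    then have c: "Ck n (\<lambda>z. - Re (z - x))" "Ck n (\<lambda>z. - Im (z - x))" by (auto simp: smooth_iff_Ck)
    have "Ck n (\<lambda>z. - Re (z - x) * (isq R x z * isq R x z * isq R x z))"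
      "Ck n (\<lambda>z. - Im (z - x) * (isq R x z * isq R x z * isq R x z))"
      by (intro Ck_bilinear[OF bounded_bilinear_mult] Suc.IH c)+
    moreover have "pd 1 (isq R x) = (\<lambda>z. - Re (z - x) * (isq R x z * isq R x z * isq R x z))"
      "pd \<i> (isq R x) = (\<lambda>z. - Im (z - x) * (isq R x z * isq R x z * isq R x z))"
      by (auto simp: pd_isq power3_eq_cube)
    ultimately show ?case using isq_has_derivative unfolding Ck.simps differentiable_def by auto
  qed
  then show ?thesis by (simp add: smooth_iff_Ck)
qed

end

text \<open>The shape of the current in \<open>virial\<close>: one free term and three products. The
  result has the syntactic form to which \<open>virial_algebra\<close> applies.\<close>

lemma pd_sum4:
  fixes p c1 h c2 g c3 k :: "complex \<Rightarrow> complex"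
  assumes "smooth p" "smooth c1" "smooth h" "smooth c2" "smooth g" "smooth c3" "smooth k"
  shows "pd e (\<lambda>z. p z + c1 z * h z + c2 z * g z + c3 z * k z) z = pd e p z
    + (pd e c1 z * h z + c1 z * pd e h z) + (pd e c2 z * g z + c2 z * pd e g z)
    + (pd e c3 z * k z + c3 z * pd e k z)"
  using assms by (simp add: pd_add' pd_mult smooth_add smooth_mult)

lemma pd_cmult:
  fixes f :: "complex \<Rightarrow> 'a::real_normed_algebra"
  shows "smooth f \<Longrightarrow> pd e (\<lambda>z. c * f z) z = c * pd e f z"
  by (simp add: pd_mult)

lemma pd_power:
  fixes f :: "complex \<Rightarrow> real"
  assumes "smooth f" shows "pd e (\<lambda>z. f z ^ n) z = of_nat n * f z ^ (n - 1) * pd e f z"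
proof (induction n)
  case (Suc n)
  show ?case
    using assms Suc by (cases n) (simp_all add: pd_mult smooth_mult smooth_power algebra_simps)
qed simp

text \<open>Lagrange's identity: the defect in this Cauchy-Schwarz inequality is a square.\<close>

lemma cmod_real_comb_le:
  "(cmod (of_real p * a + of_real q * c))\<^sup>2 \<le> (p\<^sup>2 + q\<^sup>2) * ((cmod a)\<^sup>2 + (cmod c)\<^sup>2)"
proof -
  have "(p\<^sup>2 + q\<^sup>2) * ((cmod a)\<^sup>2 + (cmod c)\<^sup>2) - (cmod (of_real p * a + of_real q * c))\<^sup>2
      = (cmod (of_real q * a - of_real p * c))\<^sup>2"
    by (simp add: cmod_power2) (simp add: algebra_simps power2_eq_square)
  then show ?thesis using zero_le_power2[of "cmod (of_real q * a - of_real p * c)"] by linarith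
qed

lemma pd_mult_isq:
  assumes R: "0 < R" and f: "smooth f"
  shows "pd e (\<lambda>z. f z * isq R x z ^ n) z = pd e f z * isq R x z ^ n
    - f z * real n * isq R x z ^ (n - 1) * (Re (z - x) * Re e + Im (z - x) * Im e) * isq R x z ^ 3"
  by (subst pd_mult[OF f smooth_power[OF smooth_isq[OF R]]])
     (simp add: pd_power[OF smooth_isq[OF R]] pd_isq[OF R] algebra_simps del: minus_complex.sel)

lemma le_half: "r \<le> q \<Longrightarrow> 2 * q \<le> m \<Longrightarrow> r \<le> m / 2" for r q m :: real
  by linarith

text \<open>The arithmetic of \<open>virial\<close>, with \<open>A\<close>, \<open>V\<close>,
  \<open>F\<close> for |N v|^2, |v|^2, |f|^2 and \<open>dS\<close> for the Laplacian of sigma. Half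
  of the positive term with E V absorbs the \<open>dS\<close> term, which leaves the coefficient E /
  4.\<close>

lemma virial_arith:
  fixes D :: real
  assumes D: "D = fY + W / 2 * A + pos + W / 2 * E * V + vf - dS / 4 * V + bt"
    and pos: "0 \<le> pos" and dS: "dS * V \<le> E * W * V"
    and fY: "- fY \<le> (e * F + A / e) / 2" and vf: "- vf \<le> e / 4 * (V + F)"
    and bt: "- bt \<le> b / 2 * (e * V + A / e)"
  shows "W / 2 * A + E / 4 * (W * V) \<le> D + ((e * F + A / e) / 2 + b / 2 * (e * V + A / e) + e / 4 * (V + F))"
proof -
  have "dS / 4 * V \<le> E / 4 * (W * V)" using dS by simp
  moreover have "W / 2 * E * V = E / 4 * (W * V) + E / 4 * (W * V)" by simp
  ultimately show ?thesis unfolding D using pos fY vf bt by linarith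
qed

context magnetic
begin

text \<open>The Morawetz inequality with R = 1 / sqrt E. The pairing of \<open>f\<close> with the
  multiplier and the curl term are split by Young's inequality with weight e = sqrt E, because |N
  v|^2 / e and e |v|^2 have integrals of the same order for an approximate eigenfunction.\<close>

lemma virial:
  fixes x :: complex
  assumes v: "test_fun v" and E: "0 < E"
  defines "e \<equiv> sqrt E" and "f \<equiv> (\<lambda>z. L v z + of_real E * v z)"
  defines "W \<equiv> (\<lambda>z. isq (1 / sqrt E) x z ^ 3 / E)"
  defines "A \<equiv> (\<lambda>z. (cmod (N1 v z))\<^sup>2 + (cmod (N2 v z))\<^sup>2)"
  shows "(LINT z|lborel. W z / 2 * A z + E / 4 * (W z * (cmod (v z))\<^sup>2))
    \<le> (LINT z|lborel. (e * (cmod (f z))\<^sup>2 + A z / e) / 2 + b / 2 * (e * (cmod (v z))\<^sup>2 + A z / e)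
          + e / 4 * ((cmod (v z))\<^sup>2 + (cmod (f z))\<^sup>2))"
proof -
  define R where "R = 1 / sqrt E"
  have R: "0 < R" and e: "0 < e" using E by (simp_all add: R_def e_def)
  have R2: "R\<^sup>2 = 1 / E" using E by (simp add: R_def power_divide)
  define \<sigma> where "\<sigma> = isq R x"
  define X1 X2 T1 T2 where X: "X1 z = Re (z - x) * \<sigma> z" "X2 z = Im (z - x) * \<sigma> z"
    "T1 z = Re (z - x) * \<sigma> z ^ 3" "T2 z = Im (z - x) * \<sigma> z ^ 3" for z
  have sm: "smooth \<sigma>" "smooth X1" "smooth X2" "smooth T1" "smooth T2"
    unfolding \<sigma>_def X[abs_def] by (intro smooth_mult smooth_coord smooth_power smooth_isq R)+
  note tf = v test_fun_N[OF v]
  note s = tf[THEN test_fun_smooth] smooth_N(1)[OF smooth_N(1)] 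
  define Y where "Y z = of_real (X1 z) * N1 v z + of_real (X2 z) * N2 v z" for z
  have tY: "test_fun Y" unfolding Y_def[abs_def]
    by (intro test_fun_add test_fun_mult smooth_of_real sm tf)
  \<comment> \<open>The terms with \<open>Y\<close> and \<open>X\<close> are the stress tensor
    contracted with the multiplier. Alone they give |N v|^2 the coefficient - r2 sigma^3 / 2, apart
    from a nonnegative angular term, and E |v|^2 the coefficient sigma - r2 sigma^3 / 2. The terms
    with sigma / 2 and T / 4, where T is minus the gradient of sigma, add sigma / 2 to the former
    and subtract it from the latter, so that both become W / 2.\<close>
  define Q where "Q X T a z = a z * cnj (Y z) + (of_real (- X z / 2) * (N1 v z * cnj (N1 v z) + N2 v z * cnj (N2 v z)))
     + of_real (E / 2 * X z + T z / 4) * (v z * cnj (v z)) + of_real (\<sigma> z / 2) * (a z * cnj (v z))"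
    for X T :: "complex \<Rightarrow> real" and a :: "complex \<Rightarrow> complex" and z
  have half: "(\<lambda>z. - X z / 2) = (\<lambda>z. (- 1 / 2) * X z)" "(\<lambda>z. X z / 2) = (\<lambda>z. (1 / 2) * X z)"
    "(\<lambda>z. E / 2 * X z + T z / 4) = (\<lambda>z. (E / 2) * X z + (1 / 4) * T z)" for X T :: "complex \<Rightarrow> real"
    by (auto simp: fun_eq_iff)
  have sc: "smooth (\<lambda>z. - X z / 2)" "smooth (\<lambda>z. E / 2 * X z + T z / 4)" "smooth (\<lambda>z. \<sigma> z / 2)"
    if "smooth X" "smooth T" for X T :: "complex \<Rightarrow> real"
    unfolding half by (intro smooth_add smooth_mult smooth_const that sm)+
  have pdc: "pd d (\<lambda>z. - X z / 2) z = - pd d X z / 2" "pd d (\<lambda>z. \<sigma> z / 2) z = pd d \<sigma> z / 2"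
     "pd d (\<lambda>z. E / 2 * X z + T z / 4) z = E / 2 * pd d X z + pd d T z / 4"
    if "smooth X" "smooth T" for X T :: "complex \<Rightarrow> real" and d z
    unfolding half pd_cmult[OF that(1)] pd_cmult[OF sm(1)] pd_cmult[OF that(2)]
      pd_add'[OF smooth_mult[OF smooth_const that(1)] smooth_mult[OF smooth_const that(2)]]
    by simp_all
  have tQ: "test_fun (Q X T a)" if "smooth X" "smooth T" "test_fun a" for X T a
    unfolding Q_def[abs_def]
    by (intro test_fun_add test_fun_mult(2)[OF smooth_cnj] test_fun_mult(1)[OF smooth_of_real]
        sc[OF that(1,2)] that tf test_fun_smooth[OF tY] s)
  show ?thesis
  proof (rule div_integral_le[where \<alpha> = 1 and \<beta> = 1])
    show "test_fun (Q X1 T1 (N1 v))" "test_fun (Q X2 T2 (N2 v))" by (intro tQ sm tf)+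
    have cW: "continuous_on UNIV (\<lambda>z. c * W z)" for c
    proof -
      have "continuous_on UNIV \<sigma>" by (rule smooth_continuous_on[OF sm(1)])
      then show ?thesis unfolding W_def R_def[symmetric] \<sigma>_def[symmetric] using E by (intro continuous_intros) auto
    qed
    have "integrable lborel (\<lambda>z. (1/2) * W z * (cmod (N1 v z))\<^sup>2 + (1/2) * W z * (cmod (N2 v z))\<^sup>2 + E / 4 * W z * (cmod (v z))\<^sup>2)"
      by (intro Bochner_Integration.integrable_add integrable_cmod2 tf cW)
    then show "integrable lborel (\<lambda>z. W z / 2 * A z + E / 4 * (W z * (cmod (v z))\<^sup>2))"
      unfolding A_def by (simp add: algebra_simps)
    have tfm: "test_fun f" unfolding f_def by (intro test_fun_add test_fun_L v test_fun_mult smooth_const)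
    show "integrable lborel (\<lambda>z. (e * (cmod (f z))\<^sup>2 + A z / e) / 2 + b / 2 * (e * (cmod (v z))\<^sup>2 + A z / e)
          + e / 4 * ((cmod (v z))\<^sup>2 + (cmod (f z))\<^sup>2))"
      unfolding A_def by (intro Bochner_Integration.integrable_add integrable_mult_right integrable_divide_zero integrable_cmod2' tf tfm)
    fix z
    define x1 x2 where x12: "x1 = Re (z - x)" "x2 = Im (z - x)"
    define u where "u = \<sigma> z"
    define w a1 a2 a11 a12 a21 a22 where a: "w = v z" "a1 = N1 v z" "a2 = N2 v z" "a11 = N1 (N1 v) z"
       "a12 = N1 (N2 v) z" "a21 = N2 (N1 v) z" "a22 = N2 (N2 v) z"
    have usq: "u\<^sup>2 * (R\<^sup>2 + (x1\<^sup>2 + x2\<^sup>2)) = 1" unfolding u_def \<sigma>_def x12 by (rule isq_sq[OF R])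
    have u0: "0 < u" and ue: "u \<le> e" using isq_pos[OF R] isq_le[OF R, of x z] E
      by (simp_all add: u_def \<sigma>_def e_def R_def)
    have W: "W z = R\<^sup>2 * u ^ 3" by (simp add: W_def u_def \<sigma>_def R_def[symmetric] R2)
    \<comment> \<open>The defining relation of sigma turns the coefficient sigma - r2 sigma^3 of
      \<open>virial_algebra\<close> into the weight.\<close>
    have W': "W z = u - (x1\<^sup>2 + x2\<^sup>2) * u ^ 3"
    proof -
      have "u * 1 = u * (u\<^sup>2 * (R\<^sup>2 + (x1\<^sup>2 + x2\<^sup>2)))" unfolding usq ..
      then show ?thesis unfolding W by (simp add: algebra_simps eval_nat_numeral)
    qed
    have pdX: "pd 1 X1 z = u - x1\<^sup>2 * u ^ 3" "pd \<i> X1 z = - x1 * x2 * u ^ 3"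
       "pd 1 X2 z = - x1 * x2 * u ^ 3" "pd \<i> X2 z = u - x2\<^sup>2 * u ^ 3"
       "pd 1 T1 z = u ^ 3 - 3 * x1\<^sup>2 * u ^ 5" "pd \<i> T2 z = u ^ 3 - 3 * x2\<^sup>2 * u ^ 5"
       "pd 1 \<sigma> z = - x1 * u ^ 3" "pd \<i> \<sigma> z = - x2 * u ^ 3"
      using pd_mult_isq[OF R smooth_coord(1), of _ x x 1 z] pd_mult_isq[OF R smooth_coord(2), of _ x x 1 z]
        pd_mult_isq[OF R smooth_coord(1), of _ x x 3 z] pd_mult_isq[OF R smooth_coord(2), of _ x x 3 z]
      unfolding X[abs_def] \<sigma>_def u_def x12 pd_isq[OF R] pd_coord
      by (simp_all add: power2_eq_square eval_nat_numeral del: minus_complex.sel)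
    have NY: "N1 Y z = (of_real (pd 1 X1 z) * a1 + of_real (X1 z) * a11) + (of_real (pd 1 X2 z) * a2 + of_real (X2 z) * a12)"
      "N2 Y z = (of_real (pd \<i> X1 z) * a1 + of_real (X1 z) * a21) + (of_real (pd \<i> X2 z) * a2 + of_real (X2 z) * a22)"
      unfolding Y_def[abs_def] a
      by (simp_all add: N_add N_mult smooth_mult smooth_of_real pd_of_real sm s)
    have Yz: "Y z = of_real (x1 * u) * a1 + of_real (x2 * u) * a2"
      by (simp add: Y_def X x12 u_def a)
    have sf: "smooth (\<lambda>z. N1 v z * cnj (Y z))" "smooth (\<lambda>z. N2 v z * cnj (Y z))"
      "smooth (\<lambda>z. N1 v z * cnj (v z))" "smooth (\<lambda>z. N2 v z * cnj (v z))" "smooth (\<lambda>z. v z * cnj (v z))"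
      "smooth (\<lambda>z. N1 v z * cnj (N1 v z))" "smooth (\<lambda>z. N2 v z * cnj (N2 v z))"
      by (intro smooth_mult smooth_cnj s test_fun_smooth[OF tY])+
    have pdQ: "pd d (Q X T a) z = pd d (\<lambda>z. a z * cnj (Y z)) z
      + (of_real (- pd d X z / 2) * (N1 v z * cnj (N1 v z) + N2 v z * cnj (N2 v z))
         + of_real (- X z / 2) * (pd d (\<lambda>z. N1 v z * cnj (N1 v z)) z + pd d (\<lambda>z. N2 v z * cnj (N2 v z)) z))
      + (of_real (E / 2 * pd d X z + pd d T z / 4) * (v z * cnj (v z))
         + of_real (E / 2 * X z + T z / 4) * pd d (\<lambda>z. v z * cnj (v z)) z)
      + (of_real (pd d \<sigma> z / 2) * (a z * cnj (v z)) + of_real (\<sigma> z / 2) * pd d (\<lambda>z. a z * cnj (v z)) z)"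
      if "smooth X" "smooth T" "smooth (\<lambda>z. a z * cnj (Y z))" "smooth (\<lambda>z. a z * cnj (v z))" for X T a d
    proof -
      note sc = sc[OF that(1,2)]
      show ?thesis unfolding Q_def[abs_def]
          pd_sum4[OF that(3) smooth_of_real[OF sc(1)] smooth_add[OF sf(6,7)] smooth_of_real[OF sc(2)] sf(5)
            smooth_of_real[OF sc(3)] that(4)]
          pd_add'[OF sf(6,7)] pd_of_real[OF sc(1)] pd_of_real[OF sc(2)] pd_of_real[OF sc(3)] pdc[OF that(1,2)]
        by (rule refl)
    qed
    note c = pd_mult_cnj[OF s(2) test_fun_smooth[OF tY]] pd_mult_cnj[OF s(3) test_fun_smooth[OF tY]]
      pd_mult_cnj[OF s(1) s(1)] pd_mult_cnj[OF s(2) s(2)] pd_mult_cnj[OF s(3) s(3)]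
      pd_mult_cnj[OF s(2) s(1)] pd_mult_cnj[OF s(3) s(1)]
    have Aa: "A z = (cmod a1)\<^sup>2 + (cmod a2)\<^sup>2" by (simp add: A_def a)
    have a12: "a12 = a21 - \<i> * of_real (curl z) * w" unfolding a by (rule N_commute[OF s(1)])
    have a22: "a22 = f z - of_real E * w - a11" by (simp add: f_def L_def a)
    have X': "X1 z = x1 * u" "X2 z = x2 * u" "T1 z = x1 * u ^ 3" "T2 z = x2 * u ^ 3"
      by (simp_all add: X x12 u_def)
    have D: "Re (1 * pd 1 (Q X1 T1 (N1 v)) z + 1 * pd \<i> (Q X2 T2 (N2 v)) z)
      = Re (f z * cnj (Y z)) + W z / 2 * A z
     + u ^ 3 * (cmod (of_real x2 * a1 - of_real x1 * a2))\<^sup>2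
     + W z / 2 * E * (cmod w)\<^sup>2
     + u / 2 * Re (cnj w * f z) - (- 2 * u ^ 3 + 3 * (x1\<^sup>2 + x2\<^sup>2) * u ^ 5) / 4 * (cmod w)\<^sup>2
     + curl z * Re (\<i> * cnj w * (of_real (x2 * u) * a1 - of_real (x1 * u) * a2))" (is "_ = ?rhs")
    proof -
      have "Re (1 * pd 1 (Q X1 T1 (N1 v)) z + 1 * pd \<i> (Q X2 T2 (N2 v)) z)
        = Re (pd 1 (Q X1 T1 (N1 v)) z) + Re (pd \<i> (Q X2 T2 (N2 v)) z)" by simp
      also have "\<dots> = ?rhs"
        unfolding pdQ[OF sm(2,4) sf(1,3)] pdQ[OF sm(3,5) sf(2,4)] c NY pdX Yz X' u_def[symmetric]
          a[symmetric] W' Aa by (rule virial_algebra[OF a12 a22])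
      finally show ?thesis .
    qed
    have r1: "u\<^sup>2 * (x1\<^sup>2 + x2\<^sup>2) \<le> 1" 
    proof -
      have "0 \<le> u\<^sup>2 * R\<^sup>2" by simp
      then show ?thesis using usq unfolding distrib_left by linarith
    qed
    \<comment> \<open>Used for \<open>Y\<close> and for the same field turned by a right angle: both
      coefficient vectors have length \<open>u\<close> times |z - x|, which is at most 1.\<close>
    have cs: "(cmod (of_real p * a1 + of_real q * a2))\<^sup>2 \<le> A z" if "p\<^sup>2 + q\<^sup>2 = u\<^sup>2 * (x1\<^sup>2 + x2\<^sup>2)" for p q
    proof -
      have "(p\<^sup>2 + q\<^sup>2) * A z \<le> 1 * A z" using r1 unfolding that by (intro mult_right_mono) (simp_all add: A_def)
      then show ?thesis using cmod_real_comb_le[of p a1 q a2] unfolding Aa by simp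
    qed
    have yo: "2 * (g * cmod h) \<le> e * g\<^sup>2 + A z / e" if "(cmod h)\<^sup>2 \<le> A z" for g h
      using order_trans[OF young[OF e, of g "cmod h"] add_left_mono[OF divide_right_mono[OF that]]] e by simp
    have p1: "- Re (f z * cnj (Y z)) \<le> (e * (cmod (f z))\<^sup>2 + A z / e) / 2"
    proof -
      have "- Re (f z * cnj (Y z)) \<le> cmod (f z) * cmod (Y z)"
        using abs_Re_le_cmod[of "f z * cnj (Y z)"] by (simp only: norm_mult complex_mod_cnj)
      moreover have "2 * (cmod (f z) * cmod (Y z)) \<le> e * (cmod (f z))\<^sup>2 + A z / e"
        by (rule yo, unfold Yz, rule cs) (simp add: power_mult_distrib algebra_simps)
      ultimately show ?thesis by (rule le_half)
    qed
    have p2: "- (u / 2 * Re (cnj w * f z)) \<le> e / 4 * ((cmod w)\<^sup>2 + (cmod (f z))\<^sup>2)"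
    proof -
      have "- Re (cnj w * f z) \<le> cmod w * cmod (f z)"
        using abs_Re_le_cmod[of "cnj w * f z"] by (simp only: norm_mult complex_mod_cnj)
      moreover have "2 * (cmod w * cmod (f z)) \<le> (cmod w)\<^sup>2 + (cmod (f z))\<^sup>2"
        using sum_squares_bound[of "cmod w" "cmod (f z)"] by (simp only: mult.assoc)
      ultimately have "- Re (cnj w * f z) \<le> ((cmod w)\<^sup>2 + (cmod (f z))\<^sup>2) / 2" by (rule le_half)
      moreover have "- (u / 2 * r) \<le> u / 4 * S" if "- r \<le> S / 2" for r S :: real
        using mult_left_mono[OF that, of "u / 2"] u0 by simp
      ultimately have "- (u / 2 * Re (cnj w * f z)) \<le> u / 4 * ((cmod w)\<^sup>2 + (cmod (f z))\<^sup>2)" by blast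
      also have "\<dots> \<le> e / 4 * ((cmod w)\<^sup>2 + (cmod (f z))\<^sup>2)" using ue by (intro mult_right_mono) auto
      finally show ?thesis .
    qed
    have p3: "- (curl z * Re (\<i> * cnj w * (of_real (x2 * u) * a1 - of_real (x1 * u) * a2)))
        \<le> b / 2 * (e * (cmod w)\<^sup>2 + A z / e)" (is "- (_ * Re ?r) \<le> _")
    proof -
      define h where "h = of_real (x2 * u) * a1 + of_real (- (x1 * u)) * a2"
      have r: "?r = \<i> * cnj w * h" by (simp add: h_def)
      have "- (curl z * Re ?r) \<le> \<bar>curl z\<bar> * \<bar>Re ?r\<bar>" using abs_ge_minus_self[of "curl z * Re ?r"] by (simp only: abs_mult)
      also have "\<dots> \<le> b * (cmod w * cmod h)"
        using curl_bound[of z] abs_Re_le_cmod[of ?r] b_nonneg unfolding curl_def[symmetric] r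
        by (intro mult_mono) (auto simp: norm_mult)
      also have "\<dots> \<le> b * ((e * (cmod w)\<^sup>2 + A z / e) / 2)"
      proof (intro mult_left_mono b_nonneg)
        have "(cmod h)\<^sup>2 \<le> A z" unfolding h_def by (rule cs) (simp add: power_mult_distrib algebra_simps)
        from yo[OF this, of "cmod w"] show "cmod w * cmod h \<le> (e * (cmod w)\<^sup>2 + A z / e) / 2"
          by (rule le_half[OF order_refl])
      qed
      finally show ?thesis by simp
    qed
    \<comment> \<open>The Laplacian of sigma is at most sigma^3. The choice R = 1 / sqrt E makes
      sigma^3 equal to E W, so that the positive term can absorb this loss.\<close>
    have p4: "(- 2 * u ^ 3 + 3 * (x1\<^sup>2 + x2\<^sup>2) * u ^ 5) * (cmod w)\<^sup>2 \<le> E * W z * (cmod w)\<^sup>2"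
    proof (intro mult_right_mono)
      have "(x1\<^sup>2 + x2\<^sup>2) * u ^ 5 = u\<^sup>2 * (x1\<^sup>2 + x2\<^sup>2) * u ^ 3" by (simp add: eval_nat_numeral)
      also have "\<dots> \<le> 1 * u ^ 3" using r1 u0 by (intro mult_right_mono) auto
      finally have "- 2 * u ^ 3 + 3 * (x1\<^sup>2 + x2\<^sup>2) * u ^ 5 \<le> u ^ 3" by linarith
      also have "u ^ 3 = E * W z" using E by (simp add: W R2)
      finally show "- 2 * u ^ 3 + 3 * (x1\<^sup>2 + x2\<^sup>2) * u ^ 5 \<le> E * W z" .
    qed simp
    have p5: "0 \<le> u ^ 3 * (cmod (of_real x2 * a1 - of_real x1 * a2))\<^sup>2" using u0 by simp
    show "W z / 2 * A z + E / 4 * (W z * (cmod (v z))\<^sup>2)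
      \<le> Re (1 * pd 1 (Q X1 T1 (N1 v)) z + 1 * pd \<i> (Q X2 T2 (N2 v)) z)
        + ((e * (cmod (f z))\<^sup>2 + A z / e) / 2 + b / 2 * (e * (cmod (v z))\<^sup>2 + A z / e)
          + e / 4 * ((cmod (v z))\<^sup>2 + (cmod (f z))\<^sup>2))"
      using virial_arith[OF D p5 p4 p1 p2 p3] unfolding a .
  qed
qed

end

section \<open>Uniform bounds for approximate eigenfunctions\<close>

lemma cmod_add_sq_le:
  "(cmod (a + c))\<^sup>2 \<le> 2 * (cmod a)\<^sup>2 + 2 * (cmod c)\<^sup>2"
proof -
  have "(cmod (a + c))\<^sup>2 \<le> (cmod a + cmod c)\<^sup>2" by (intro power_mono norm_triangle_ineq) simp
  also have "\<dots> = (cmod a)\<^sup>2 + (cmod c)\<^sup>2 + 2 * cmod a * cmod c" by (rule power2_sum)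
  also have "\<dots> \<le> (cmod a)\<^sup>2 + (cmod c)\<^sup>2 + ((cmod a)\<^sup>2 + (cmod c)\<^sup>2)"
    by (intro add_left_mono sum_squares_bound)
  finally show ?thesis by simp
qed

lemma cmod_add4_sq_le:
  "(cmod (a + c + d + g))\<^sup>2 \<le> 4 * ((cmod a)\<^sup>2 + (cmod c)\<^sup>2 + (cmod d)\<^sup>2 + (cmod g)\<^sup>2)"
  using cmod_add_sq_le[of "a + c" "d + g"] cmod_add_sq_le[of a c] cmod_add_sq_le[of d g]
  by (simp add: add.assoc)

context magnetic
begin

lemma L_mult:
  assumes c: "smooth c" and f: "smooth f"
  shows "L (\<lambda>z. c z * f z) z = c z * L f z + 2 * (pd 1 c z * N1 f z + pd \<i> c z * N2 f z)
    + (pd 1 (pd 1 c) z + pd \<i> (pd \<i> c) z) * f z"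
proof -
  have "N1 (\<lambda>z. c z * f z) = (\<lambda>z. pd 1 c z * f z + c z * N1 f z)"
    "N2 (\<lambda>z. c z * f z) = (\<lambda>z. pd \<i> c z * f z + c z * N2 f z)"
    by (intro ext N_mult c f)+
  moreover have "N1 (\<lambda>z. pd 1 c z * f z + c z * N1 f z) z
      = (pd 1 (pd 1 c) z * f z + pd 1 c z * N1 f z) + (pd 1 c z * N1 f z + c z * N1 (N1 f) z)"
    using c f by (subst N_add) (auto simp: N_mult smooth_N smooth_pd smooth_mult)
  moreover have "N2 (\<lambda>z. pd \<i> c z * f z + c z * N2 f z) z
      = (pd \<i> (pd \<i> c) z * f z + pd \<i> c z * N2 f z) + (pd \<i> c z * N2 f z + c z * N2 (N2 f) z)"
    using c f by (subst N_add) (auto simp: N_mult smooth_N smooth_pd smooth_mult)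
  ultimately show ?thesis by (simp add: L_def algebra_simps)
qed

text \<open>Integrated, the right side of \<open>virial\<close> is at most (5 + 4 b) e G / 2: the
  energy inequality with t = E gives int |N v|^2 \<le> 3 E G, and the division by e returns the
  order e. The factor E / 4 on the left doubles 5 + 4 b to 10 + 8 b.\<close>

lemma weighted_bounds:
  fixes x :: complex
  assumes v: "test_fun v" and E: "1 \<le> E"
    and G: "(normsq v) \<le> G" "(LINT z|lborel. (cmod (L v z + of_real E * v z))\<^sup>2) \<le> G"
  defines "W \<equiv> (\<lambda>z. isq (1 / sqrt E) x z ^ 3 / E)"
  shows "(LINT z|lborel. W z * ((cmod (N1 v z))\<^sup>2 + (cmod (N2 v z))\<^sup>2)) \<le> (10 + 8 * b) * sqrt E * G"
    and "E * (LINT z|lborel. W z * (cmod (v z))\<^sup>2) \<le> (10 + 8 * b) * sqrt E * G"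
proof -
  define e f A where d: "e = sqrt E" "f = (\<lambda>z. L v z + of_real E * v z)"
    "A = (\<lambda>z. (cmod (N1 v z))\<^sup>2 + (cmod (N2 v z))\<^sup>2)"
  have e: "1 \<le> e" and E0: "0 < E" and ee: "e * e = E" using E by (simp_all add: d)
  have tf: "test_fun v" "test_fun (L v)" "test_fun (N1 v)" "test_fun (N2 v)" "test_fun f"
    unfolding d by (intro v test_fun_L test_fun_N test_fun_add test_fun_mult smooth_const)+
  have W0: "0 \<le> W z" for z using isq_pos[of "1 / sqrt E" x z] E0 by (simp add: W_def)
  have cW: "continuous_on UNIV W" unfolding W_def using E0
    by (intro continuous_intros smooth_continuous_on[OF smooth_isq]) auto
  have iA: "integrable lborel (\<lambda>z. W z * A z)" "integrable lborel A"
    unfolding d distrib_left by (intro Bochner_Integration.integrable_add integrable_cmod2 integrable_cmod2' cW tf)+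
  have iv: "integrable lborel (\<lambda>z. W z * (cmod (v z))\<^sup>2)" "integrable lborel (\<lambda>z. (cmod (v z))\<^sup>2)"
    "integrable lborel (\<lambda>z. (cmod (f z))\<^sup>2)" "integrable lborel (\<lambda>z. (cmod (L v z))\<^sup>2)"
    by (intro integrable_cmod2 integrable_cmod2' cW tf)+
  define a F g I1 I0 where i: "a = (normsq v)" "F = (normsq f)"
    "g = (LINT z|lborel. A z)" "I1 = (LINT z|lborel. W z * A z)" "I0 = (LINT z|lborel. W z * (cmod (v z))\<^sup>2)"
  have aG: "a \<le> G" "F \<le> G" using G unfolding i d .
  have nn: "0 \<le> a" "0 \<le> I1" "0 \<le> I0" "0 \<le> F"
    unfolding i d using W0 by (auto intro!: Bochner_Integration.integral_nonneg)
  have G0: "0 \<le> G" using nn aG by linarith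
  have nL: "(normsq (L v)) \<le> 2 * F + 2 * (E\<^sup>2 * a)"
  proof -
    have "(normsq (L v)) \<le> (LINT z|lborel. 2 * (cmod (f z))\<^sup>2 + 2 * (E\<^sup>2 * (cmod (v z))\<^sup>2))"
    proof (rule integral_mono)
      show "(cmod (L v z))\<^sup>2 \<le> 2 * (cmod (f z))\<^sup>2 + 2 * (E\<^sup>2 * (cmod (v z))\<^sup>2)" for z
        using cmod_add_sq_le[of "f z" "- of_real E * v z"] by (simp add: d norm_mult power_mult_distrib)
    qed (use iv in auto)
    also have "\<dots> = 2 * F + 2 * (E\<^sup>2 * a)" using iv by (simp add: i)
    finally show ?thesis .
  qed
  have g: "g \<le> 3 * E * G"
  proof -
    have "g \<le> (E * a + (normsq (L v)) / E) / 2" using energy_le[OF v E0] unfolding i d .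
    also have "\<dots> \<le> (E * G + (2 * G + 2 * (E\<^sup>2 * G)) / E) / 2"
    proof -
      have "E\<^sup>2 * a \<le> E\<^sup>2 * G" "E * a \<le> E * G" using aG E0 by (auto intro!: mult_left_mono)
      moreover from this have "(normsq (L v)) \<le> 2 * G + 2 * (E\<^sup>2 * G)"
        using nL aG(2) by linarith
      ultimately show ?thesis using E0 by (intro divide_right_mono add_mono) auto
    qed
    also have "\<dots> = E * G / 2 + G / E + E * G" using E0 by (simp add: field_simps power2_eq_square)
    also have "\<dots> \<le> 3 * E * G"
    proof -
      have "G / E \<le> G" using E G0 E0 by (simp add: divide_le_eq mult_le_cancel_left1)
      moreover have "1 * G \<le> E * G" using E G0 by (intro mult_right_mono)
      ultimately show ?thesis using G0 by simp
    qed
    finally show ?thesis .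
  qed
  have "I1 / 2 + E / 4 * I0 = (LINT z|lborel. W z / 2 * A z + E / 4 * (W z * (cmod (v z))\<^sup>2))"
    using iA iv by (simp add: i)
  also have "\<dots> \<le> (LINT z|lborel. (e * (cmod (f z))\<^sup>2 + A z / e) / 2 + b / 2 * (e * (cmod (v z))\<^sup>2 + A z / e)
          + e / 4 * ((cmod (v z))\<^sup>2 + (cmod (f z))\<^sup>2))"
    unfolding W_def d by (rule virial[OF v E0])
  also have "\<dots> = (e * F + g / e) / 2 + b / 2 * (e * a + g / e) + e / 4 * (a + F)"
    using iA iv by (simp add: i)
  also have "\<dots> \<le> (e * G + 3 * e * G) / 2 + b / 2 * (e * G + 3 * e * G) + e / 4 * (G + G)"
  proof -
    have "g / e \<le> 3 * E * G / e" using g e by (simp add: divide_right_mono)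
    also have "\<dots> = 3 * e * G" using e by (simp add: ee[symmetric])
    finally show ?thesis using aG e b_nonneg by (intro add_mono mult_left_mono divide_right_mono) auto
  qed
  also have "\<dots> = (5 + 4 * b) * e * G / 2" by (simp add: algebra_simps)
  finally have main: "I1 / 2 + E / 4 * I0 \<le> (5 + 4 * b) * e * G / 2" .
  have EI: "0 \<le> E * I0" using E0 nn by simp
  have "0 \<le> (5 + 4 * b) * e * G" using b_nonneg e G0 by simp
  moreover have "(10 + 8 * b) * e * G = 2 * ((5 + 4 * b) * e * G)" by (simp add: algebra_simps)
  ultimately have "I1 \<le> (10 + 8 * b) * e * G" "E * I0 \<le> (10 + 8 * b) * e * G"
    using main EI nn by linarith+
  then show "(LINT z|lborel. W z * ((cmod (N1 v z))\<^sup>2 + (cmod (N2 v z))\<^sup>2)) \<le> (10 + 8 * b) * sqrt E * G"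
    "E * (LINT z|lborel. W z * (cmod (v z))\<^sup>2) \<le> (10 + 8 * b) * sqrt E * G"
    unfolding i d by auto
qed

text \<open>\<open>sup_le\<close> with t = E is applied to kappa v, where kappa = R^2 sigma^2 equals
  1 at \<open>x\<close>. The algebraic decay of kappa is matched to W: the squares of kappa, of its
  gradient and of its Laplacian are at most W / e, 4 W e and 16 W e^3, so the weighted bounds
  control every term.\<close>

lemma sup_bound_high:
  assumes v: "test_fun v" and E: "1 \<le> E"
    and G: "(normsq v) \<le> G" "(LINT z|lborel. (cmod (L v z + of_real E * v z))\<^sup>2) \<le> G"
  shows "(cmod (v x))\<^sup>2 \<le> (2 + b + b\<^sup>2) * (4 + 133 * (10 + 8 * b)) * G"
proof -
  define K where "K = 10 + 8 * b"
  define e R where d: "e = sqrt E" "R = 1 / sqrt E"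
  define \<sigma> where "\<sigma> = isq R x"
  define W where "W z = \<sigma> z ^ 3 / E" for z
  have e: "1 \<le> e" and E0: "0 < E" and ee: "e * e = E" using E by (simp_all add: d)
  have R: "0 < R" "R = 1 / e" "R\<^sup>2 = 1 / E" using E0 by (simp_all add: d power_divide)
  have K: "10 \<le> K" using b_nonneg by (simp add: K_def)
  define f where "f z = L v z + of_real E * v z" for z
  define A where "A z = (cmod (N1 v z))\<^sup>2 + (cmod (N2 v z))\<^sup>2" for z
  have I1: "(LINT z|lborel. W z * A z) \<le> K * e * G" and I0: "E * (LINT z|lborel. W z * (cmod (v z))\<^sup>2) \<le> K * e * G"
    using weighted_bounds[OF v E G, of x] unfolding W_def \<sigma>_def d K_def A_def .
  define \<kappa> where "\<kappa> z = R\<^sup>2 * (\<sigma> z)\<^sup>2" for z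
  have sm: "smooth \<sigma>" unfolding \<sigma>_def by (rule smooth_isq[OF R(1)])
  have s\<kappa>: "smooth (\<lambda>z. complex_of_real (\<kappa> z))" unfolding \<kappa>_def by (intro smooth_of_real smooth_mult smooth_const smooth_power sm)
  define w where "w z = of_real (\<kappa> z) * v z" for z
  have w: "test_fun w" unfolding w_def[abs_def] by (rule test_fun_mult(1)[OF s\<kappa> v])
  have tf: "test_fun v" "test_fun (N1 v)" "test_fun (N2 v)" "test_fun f"
    unfolding f_def[abs_def] by (intro v test_fun_L test_fun_N test_fun_add test_fun_mult smooth_const)+
  have cW: "continuous_on UNIV W"
    unfolding W_def using E0 by (intro continuous_intros smooth_continuous_on[OF sm]) auto
  have iA: "integrable lborel (\<lambda>z. W z * A z)"
    unfolding A_def distrib_left by (intro Bochner_Integration.integrable_add integrable_cmod2 cW tf)+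
  have iv: "integrable lborel (\<lambda>z. W z * (cmod (v z))\<^sup>2)" "integrable lborel (\<lambda>z. (cmod (f z))\<^sup>2)"
    by (intro integrable_cmod2 integrable_cmod2' cW tf)+
  define I where I: "I = (LINT z|lborel. W z * (cmod (v z))\<^sup>2)"
  have s0: "0 < \<sigma> z" and se: "\<sigma> z \<le> e" for z
  proof -
    have "1 / R = e" by (simp add: R(2))
    then show "0 < \<sigma> z" "\<sigma> z \<le> e" using isq_pos[OF R(1)] isq_le[OF R(1), of x z] by (simp_all add: \<sigma>_def)
  qed
  define p q where pq: "p z = Re (z - x)" "q z = Im (z - x)" for z
  have ssq: "(\<sigma> z)\<^sup>2 * (R\<^sup>2 + ((p z)\<^sup>2 + (q z)\<^sup>2)) = 1" for z
    unfolding \<sigma>_def pq by (rule isq_sq[OF R(1)])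
  have r1: "(\<sigma> z)\<^sup>2 * ((p z)\<^sup>2 + (q z)\<^sup>2) \<le> 1" and r2: "R\<^sup>2 * (\<sigma> z)\<^sup>2 \<le> 1" for z
  proof -
    have "0 \<le> (\<sigma> z)\<^sup>2 * R\<^sup>2" "0 \<le> (\<sigma> z)\<^sup>2 * ((p z)\<^sup>2 + (q z)\<^sup>2)" by simp_all
    then show "(\<sigma> z)\<^sup>2 * ((p z)\<^sup>2 + (q z)\<^sup>2) \<le> 1" "R\<^sup>2 * (\<sigma> z)\<^sup>2 \<le> 1"
      using ssq[of z] unfolding distrib_left[of "(\<sigma> z)\<^sup>2"] mult.commute[of "R\<^sup>2"] by linarith+
  qed
  have W: "W z = R\<^sup>2 * \<sigma> z ^ 3" "0 \<le> W z" for z using s0[of z] E0 by (simp_all add: W_def R(3))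
  \<comment> \<open>kappa^2 is W times R^2 sigma, and sigma is at most e = 1 / R.\<close>
  have chi2: "(\<kappa> z)\<^sup>2 \<le> W z / e" for z
  proof -
    have "(\<kappa> z)\<^sup>2 = W z * (R\<^sup>2 * \<sigma> z)" unfolding \<kappa>_def W by (simp add: eval_nat_numeral)
    also have "\<dots> \<le> W z * (R\<^sup>2 * e)" using W(2)[of z] se[of z] by (intro mult_left_mono) auto
    also have "\<dots> = W z / e" using e by (simp add: R(3) ee[symmetric])
    finally show ?thesis .
  qed
  have n0: "(normsq w) \<le> I / e"
  proof -
    have "(normsq w) \<le> (LINT z|lborel. W z * (cmod (v z))\<^sup>2 / e)"
    proof (rule integral_mono)
      show "(cmod (w z))\<^sup>2 \<le> W z * (cmod (v z))\<^sup>2 / e" for z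
        using mult_right_mono[OF chi2[of z], of "(cmod (v z))\<^sup>2"] by (simp add: w_def norm_mult power_mult_distrib)
    qed (use iv integrable_cmod2'[OF w] in auto)
    then show ?thesis by (simp add: I)
  qed
  have pd\<kappa>: "pd d \<kappa> z = - 2 * R\<^sup>2 * (p z * Re d + q z * Im d) * \<sigma> z ^ 4" for d z
    unfolding \<kappa>_def pd_cmult[OF smooth_power[OF sm]] pd_power[OF sm] pq
    unfolding \<sigma>_def pd_isq[OF R(1)] by (simp add: eval_nat_numeral algebra_simps)
  have spq: "smooth p" "smooth q" unfolding pq[abs_def] by (rule smooth_coord)+
  have pdpq: "pd d p z = Re d" "pd d q z = Im d" for d z unfolding pq[abs_def] by (rule pd_coord)+
  have pd4: "pd d (\<lambda>z. \<sigma> z ^ 4) z = - 4 * (p z * Re d + q z * Im d) * \<sigma> z ^ 6" for d z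
    unfolding pd_power[OF sm] pq unfolding \<sigma>_def pd_isq[OF R(1)] by (simp add: eval_nat_numeral algebra_simps)
  have pd2: "pd 1 (pd 1 \<kappa>) z = R\<^sup>2 * (- 2 * \<sigma> z ^ 4 + 8 * (p z)\<^sup>2 * \<sigma> z ^ 6)"
    "pd \<i> (pd \<i> \<kappa>) z = R\<^sup>2 * (- 2 * \<sigma> z ^ 4 + 8 * (q z)\<^sup>2 * \<sigma> z ^ 6)" for z
  proof -
    have h: "pd 1 \<kappa> = (\<lambda>z. (- 2 * R\<^sup>2) * (p z * \<sigma> z ^ 4))" "pd \<i> \<kappa> = (\<lambda>z. (- 2 * R\<^sup>2) * (q z * \<sigma> z ^ 4))"
      by (auto simp: pd\<kappa>)
    show "pd 1 (pd 1 \<kappa>) z = R\<^sup>2 * (- 2 * \<sigma> z ^ 4 + 8 * (p z)\<^sup>2 * \<sigma> z ^ 6)"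
      "pd \<i> (pd \<i> \<kappa>) z = R\<^sup>2 * (- 2 * \<sigma> z ^ 4 + 8 * (q z)\<^sup>2 * \<sigma> z ^ 6)"
      unfolding h pd_cmult[OF smooth_mult[OF spq(1) smooth_power[OF sm]]] pd_cmult[OF smooth_mult[OF spq(2) smooth_power[OF sm]]]
        pd_mult[OF spq(1) smooth_power[OF sm]] pd_mult[OF spq(2) smooth_power[OF sm]] pdpq pd4
      by (simp_all add: power2_eq_square algebra_simps)
  qed
  have srchi: "smooth \<kappa>" unfolding \<kappa>_def[abs_def] by (intro smooth_mult smooth_const smooth_power sm)
  have cpd: "pd d (\<lambda>z. complex_of_real (\<kappa> z)) = (\<lambda>z. of_real (pd d \<kappa> z))" for d
    by (intro ext pd_of_real srchi)
  have Lw: "L w z = of_real (\<kappa> z) * f z + of_real (- E * \<kappa> z) * v z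
      + 2 * (of_real (pd 1 \<kappa> z) * N1 v z + of_real (pd \<i> \<kappa> z) * N2 v z)
      + of_real (pd 1 (pd 1 \<kappa>) z + pd \<i> (pd \<i> \<kappa>) z) * v z" for z
    unfolding w_def[abs_def] L_mult[OF s\<kappa> test_fun_smooth[OF v]] cpd
    by (simp add: pd_of_real smooth_pd srchi f_def algebra_simps)
  \<comment> \<open>The four summands of \<open>Lw\<close>, squared: the error in the equation, E
    kappa v, the gradient term and the Laplacian term. The outer factor 4 comes from squaring a sum
    of four terms.\<close>
  have Lwb: "(cmod (L w z))\<^sup>2 \<le> 4 * ((cmod (f z))\<^sup>2 + E\<^sup>2 * (W z * (cmod (v z))\<^sup>2 / e)
      + 16 * e * (W z * A z) + 16 * e ^ 3 * (W z * (cmod (v z))\<^sup>2))" for z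
  proof -
    have 1: "(cmod (of_real (\<kappa> z) * f z))\<^sup>2 \<le> (cmod (f z))\<^sup>2"
    proof -
      have "(\<kappa> z)\<^sup>2 \<le> 1" unfolding \<kappa>_def using r2[of z] by (intro power_le_one) auto
      then show ?thesis using mult_right_mono[of "(\<kappa> z)\<^sup>2" 1 "(cmod (f z))\<^sup>2"] by (simp add: norm_mult power_mult_distrib)
    qed
    have 2: "(cmod (of_real (- E * \<kappa> z) * v z))\<^sup>2 \<le> E\<^sup>2 * (W z * (cmod (v z))\<^sup>2 / e)"
    proof -
      have "(cmod (of_real (- E * \<kappa> z) * v z))\<^sup>2 = E\<^sup>2 * ((\<kappa> z)\<^sup>2 * (cmod (v z))\<^sup>2)"
        by (simp add: norm_mult power_mult_distrib)
      also have "\<dots> \<le> E\<^sup>2 * (W z / e * (cmod (v z))\<^sup>2)"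
        by (intro mult_left_mono mult_right_mono chi2) auto
      finally show ?thesis by simp
    qed
    have 3: "(cmod (2 * (of_real (pd 1 \<kappa> z) * N1 v z + of_real (pd \<i> \<kappa> z) * N2 v z)))\<^sup>2 \<le> 16 * e * (W z * A z)"
    proof -
      have "(pd 1 \<kappa> z)\<^sup>2 + (pd \<i> \<kappa> z)\<^sup>2 = 4 * (R\<^sup>2)\<^sup>2 * \<sigma> z ^ 6 * ((\<sigma> z)\<^sup>2 * ((p z)\<^sup>2 + (q z)\<^sup>2))"
        unfolding pd\<kappa> by (simp add: algebra_simps eval_nat_numeral)
      also have "\<dots> \<le> 4 * (R\<^sup>2)\<^sup>2 * \<sigma> z ^ 6 * 1" using s0[of z] by (intro mult_left_mono r1) auto
      also have "\<dots> = 4 * W z * (R\<^sup>2 * (\<sigma> z)\<^sup>2 * \<sigma> z)" unfolding W by (simp add: eval_nat_numeral)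
      also have "\<dots> \<le> 4 * W z * (1 * e)"
        using W(2)[of z] s0[of z] e by (intro mult_left_mono mult_mono r2 se) auto
      finally have g: "(pd 1 \<kappa> z)\<^sup>2 + (pd \<i> \<kappa> z)\<^sup>2 \<le> 4 * W z * e" by simp
      have "(cmod (2 * (of_real (pd 1 \<kappa> z) * N1 v z + of_real (pd \<i> \<kappa> z) * N2 v z)))\<^sup>2
        = 4 * (cmod (of_real (pd 1 \<kappa> z) * N1 v z + of_real (pd \<i> \<kappa> z) * N2 v z))\<^sup>2"
        unfolding norm_mult power_mult_distrib by simp
      also have "\<dots> \<le> 4 * (((pd 1 \<kappa> z)\<^sup>2 + (pd \<i> \<kappa> z)\<^sup>2) * A z)"
        unfolding A_def by (intro mult_left_mono cmod_real_comb_le) simp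
      also have "\<dots> \<le> 4 * ((4 * W z * e) * A z)"
        by (intro mult_left_mono mult_right_mono g) (simp_all add: A_def)
      also have "\<dots> = 16 * e * (W z * A z)" by simp
      finally show ?thesis .
    qed
    have 4: "(cmod (of_real (pd 1 (pd 1 \<kappa>) z + pd \<i> (pd \<i> \<kappa>) z) * v z))\<^sup>2 \<le> 16 * e ^ 3 * (W z * (cmod (v z))\<^sup>2)"
    proof -
      define y where "y = (\<sigma> z)\<^sup>2 * ((p z)\<^sup>2 + (q z)\<^sup>2)"
      have y: "0 \<le> y" "y \<le> 1" using r1[of z] by (auto simp: y_def)
      have "pd 1 (pd 1 \<kappa>) z + pd \<i> (pd \<i> \<kappa>) z = R\<^sup>2 * \<sigma> z ^ 4 * (8 * y - 4)"
        unfolding pd2 y_def by (simp add: algebra_simps eval_nat_numeral)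
      then have "(pd 1 (pd 1 \<kappa>) z + pd \<i> (pd \<i> \<kappa>) z)\<^sup>2 = (R\<^sup>2 * \<sigma> z ^ 4)\<^sup>2 * (8 * y - 4)\<^sup>2"
        by (simp add: power_mult_distrib)
      also have "\<dots> \<le> (R\<^sup>2 * \<sigma> z ^ 4)\<^sup>2 * 4\<^sup>2"
        using y by (intro mult_left_mono power2_le_iff_abs_le[THEN iffD2]) auto
      also have "\<dots> = 16 * W z * ((R\<^sup>2 * (\<sigma> z)\<^sup>2) * \<sigma> z ^ 3)" unfolding W by (simp add: eval_nat_numeral)
      also have "\<dots> \<le> 16 * W z * (1 * e ^ 3)"
        using W(2)[of z] s0[of z] e by (intro mult_left_mono mult_mono r2 power_mono se) auto
      finally have g: "(pd 1 (pd 1 \<kappa>) z + pd \<i> (pd \<i> \<kappa>) z)\<^sup>2 \<le> 16 * W z * e ^ 3" by simp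
      from mult_right_mono[OF g, of "(cmod (v z))\<^sup>2"] show ?thesis
        by (simp add: norm_mult power_mult_distrib mult_ac del: of_real_add)
    qed
    show ?thesis unfolding Lw
      by (rule order_trans[OF cmod_add4_sq_le]) (intro mult_left_mono add_mono 1 2 3 4, simp)
  qed
  have nL: "(normsq (L w)) \<le> 4 * (G + E\<^sup>2 * (I / e) + 16 * e * (K * e * G) + 16 * e ^ 3 * I)"
  proof -
    have "(normsq (L w)) \<le> (LINT z|lborel. 4 * ((cmod (f z))\<^sup>2 + E\<^sup>2 * (W z * (cmod (v z))\<^sup>2 / e)
      + 16 * e * (W z * A z) + 16 * e ^ 3 * (W z * (cmod (v z))\<^sup>2)))"
      using iA iv by (intro integral_mono Lwb integrable_cmod2'[OF test_fun_L[OF w]]) auto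
    also have "\<dots> = 4 * ((normsq f) + E\<^sup>2 * (I / e) + 16 * e * (LINT z|lborel. W z * A z) + 16 * e ^ 3 * I)"
      using iA iv by (simp add: I)
    also have "\<dots> \<le> 4 * (G + E\<^sup>2 * (I / e) + 16 * e * (K * e * G) + 16 * e ^ 3 * I)"
      using G(2) I1 e unfolding f_def[symmetric] by (intro mult_left_mono add_mono) auto
    finally show ?thesis .
  qed
  have eI: "e * I \<le> K * G"
  proof -
    have "e * (e * I) \<le> e * (K * G)" using I0 unfolding I[symmetric] ee[symmetric] by (simp add: mult_ac)
    then show ?thesis using e by simp
  qed
  have G0: "0 \<le> G" using G(1) order_trans[OF Bochner_Integration.integral_nonneg[of lborel "\<lambda>z. (cmod (v z))\<^sup>2"]] by fastforce
  have "E * (normsq w) \<le> E * (I / e)" using n0 E0 by (intro mult_left_mono) auto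
  also have "\<dots> = e * I" using e by (simp add: ee[symmetric])
  finally have t1: "E * (normsq w) \<le> K * G" using eI by linarith
  have "(normsq (L w)) / E \<le> 4 * (G + E\<^sup>2 * (I / e) + 16 * e * (K * e * G) + 16 * e ^ 3 * I) / E"
    using nL E0 by (intro divide_right_mono) auto
  also have "\<dots> = 4 * (G / E + e * I + 16 * (K * G) + 16 * (e * I))"
    using e unfolding ee[symmetric] by (simp add: field_simps eval_nat_numeral)
  also have "\<dots> \<le> 4 * (G + K * G + 16 * (K * G) + 16 * (K * G))"
  proof -
    have "G / E \<le> G" using E G0 E0 by (simp add: divide_le_eq mult_le_cancel_left1)
    then show ?thesis using K by (intro mult_left_mono add_mono eI) simp_all
  qed
  finally have t2: "(normsq (L w)) / E \<le> 4 * (G + K * G + 16 * (K * G) + 16 * (K * G))" .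
  have "\<kappa> x = 1" using ssq[of x] by (simp add: \<kappa>_def pq mult.commute)
  then have "(cmod (v x))\<^sup>2 = (cmod (w x))\<^sup>2" by (simp add: w_def)
  also have "\<dots> \<le> (2 + b + b\<^sup>2) * (E * (normsq w) + (normsq (L w)) / E)"
    by (rule sup_le[OF w E])
  \<comment> \<open>K G from the first term and 4 (1 + 33 K) G from the second, hence 4 + 133
    K.\<close>
  also have "\<dots> \<le> (2 + b + b\<^sup>2) * (K * G + 4 * (G + K * G + 16 * (K * G) + 16 * (K * G)))"
    using t1 t2 b_nonneg by (intro mult_left_mono add_mono) auto
  also have "\<dots> = (2 + b + b\<^sup>2) * (4 + 133 * K) * G" by (simp add: algebra_simps)
  finally show ?thesis unfolding K_def .
qed

text \<open>For E < 1 the term E v is itself an error of size ||v||. Then ||L v||^2 \<le> 4 G, and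
  \<open>sup_le\<close> at t = 1 gives 5 G, which the constant of the other case dominates.\<close>

theorem sup_bound:
  assumes v: "test_fun v" and E: "0 \<le> E"
    and G: "(normsq v) \<le> G" "(LINT z|lborel. (cmod (L v z + of_real E * v z))\<^sup>2) \<le> G"
  shows "(cmod (v x))\<^sup>2 \<le> (2 + b + b\<^sup>2) * (4 + 133 * (10 + 8 * b)) * G"
proof (cases "1 \<le> E")
  case True
  then show ?thesis by (rule sup_bound_high[OF v _ G])
next
  case False
  define f where "f z = L v z + of_real E * v z" for z
  have tf: "test_fun f" unfolding f_def[abs_def] by (intro v test_fun_L test_fun_add test_fun_mult smooth_const)
  have G0: "0 \<le> G" using G(1) order_trans[OF Bochner_Integration.integral_nonneg[of lborel "\<lambda>z. (cmod (v z))\<^sup>2"]] by fastforce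
  have "(normsq (L v)) \<le> (LINT z|lborel. 2 * (cmod (f z))\<^sup>2 + 2 * (cmod (v z))\<^sup>2)"
  proof (rule integral_mono)
    show "(cmod (L v z))\<^sup>2 \<le> 2 * (cmod (f z))\<^sup>2 + 2 * (cmod (v z))\<^sup>2" for z
    proof -
      have "(cmod (L v z))\<^sup>2 \<le> 2 * (cmod (f z))\<^sup>2 + 2 * (E\<^sup>2 * (cmod (v z))\<^sup>2)"
        using cmod_add_sq_le[of "f z" "- of_real E * v z"] by (simp add: f_def norm_mult power_mult_distrib)
      moreover have "E\<^sup>2 * (cmod (v z))\<^sup>2 \<le> 1 * (cmod (v z))\<^sup>2"
        using False E by (intro mult_right_mono power_le_one) auto
      ultimately show ?thesis by simp
    qed
  qed (use v tf in \<open>auto intro!: Bochner_Integration.integrable_add integrable_mult_right integrable_cmod2' test_fun_L\<close>)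
  also have "\<dots> = 2 * (normsq f) + 2 * (normsq v)" using v tf by (simp add: integrable_cmod2')
  also have "\<dots> \<le> 4 * G" using G unfolding f_def[symmetric] by linarith
  finally have L: "(normsq (L v)) \<le> 4 * G" .
  have "(cmod (v x))\<^sup>2 \<le> (2 + b + b\<^sup>2) * (1 * (normsq v) + (normsq (L v)) / 1)"
    by (rule sup_le[OF v]) simp
  also have "\<dots> \<le> (2 + b + b\<^sup>2) * ((4 + 133 * (10 + 8 * b)) * G)"
  proof (intro mult_left_mono)
    have "0 \<le> b * G" using b_nonneg G0 by simp
    then show "1 * (normsq v) + (normsq (L v)) / 1 \<le> (4 + 133 * (10 + 8 * b)) * G"
      using L G(1) G0 by (simp add: algebra_simps)
  qed (use b_nonneg in simp)
  finally show ?thesis by (simp add: mult.assoc)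
qed

end

section \<open>Bump functions\<close>

text \<open>The usual exp (- 1 / t), with powers of 1 / t included: the derivative of
  \<open>flat k\<close> is a combination of \<open>flat (k + 1)\<close> and
  \<open>flat (k + 2)\<close>, so the family spans a space closed under differentiation.\<close>

definition flat :: "nat \<Rightarrow> real \<Rightarrow> real" where
  "flat k t = (if 0 < t then inverse t ^ k * exp (- inverse t) else 0)"

text \<open>This quadratic bound makes the derivative of flat k vanish at 0.\<close>

lemma flat_bound: "\<bar>flat k t\<bar> \<le> real (k + 2) ^ (k + 2) * t\<^sup>2"
proof (cases "0 < t")
  case True
  define n where "n = k + 2"
  have n: "0 < real n" by (simp add: n_def)
  \<comment> \<open>The inequality exp s \<ge> (1 + s / n)^n \<ge> (s / n)^n at s = 1 / t. The two
    extra powers in n = k + 2 supply the factor t^2.\<close>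
  have "(inverse t / real n) ^ n \<le> (1 + inverse t / real n) ^ n"
    using True n by (intro power_mono) auto
  also have "\<dots> \<le> exp (inverse t)"
    using True n by (intro exp_ge_one_plus_x_over_n_power_n) (auto simp: n_def intro: order_trans[of _ 0])
  finally have "inverse t ^ n \<le> exp (inverse t) * real n ^ n"
    using n by (simp add: power_divide pos_divide_le_eq)
  then have "inverse t ^ n * exp (- inverse t) \<le> (exp (inverse t) * real n ^ n) * exp (- inverse t)"
    by (intro mult_right_mono) auto
  also have "\<dots> = real n ^ n" by (simp add: exp_minus mult_ac)
  finally have "inverse t ^ n * exp (- inverse t) * t\<^sup>2 \<le> real n ^ n * t\<^sup>2"
    by (intro mult_right_mono) auto
  moreover have "inverse t ^ n * exp (- inverse t) * t\<^sup>2 = flat k t"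
  proof -
    have "inverse t ^ n * exp (- inverse t) * t\<^sup>2 = (inverse t ^ k * exp (- inverse t)) * ((inverse t)\<^sup>2 * t\<^sup>2)"
      by (simp only: n_def power_add mult_ac)
    also have "(inverse t)\<^sup>2 * t\<^sup>2 = (inverse t * t)\<^sup>2" by (simp only: power_mult_distrib)
    also have "inverse t * t = 1" using True by simp
    finally show ?thesis using True by (simp only: flat_def if_True power_one mult_1_right)
  qed
  moreover have "0 \<le> flat k t" using True by (simp add: flat_def)
  ultimately show ?thesis by (simp add: n_def)
qed (simp add: flat_def)

text \<open>Raising the index costs a power of t. This brings all terms of a derivative to the
  common index k + 2.\<close>

lemma flat_square: "flat k t = t\<^sup>2 * flat (k + 2) t" "flat (k + 1) t = t * flat (k + 2) t"
  by (auto simp: flat_def power2_eq_square field_simps)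

lemma flat_deriv:
  "(flat k has_real_derivative flat (k + 2) t - real k * flat (k + 1) t) (at t)"
proof -
  consider "0 < t" | "t < 0" | "t = 0" by linarith
  then show ?thesis
  proof cases
    case 1
    have "((\<lambda>t. inverse t ^ k * exp (- inverse t)) has_real_derivative
        (inverse t ^ k * inverse t ^ 2 - real k * (inverse t ^ k * inverse t)) * exp (- inverse t)) (at t)"
    proof -
      have d: "((\<lambda>t. inverse t ^ k) has_real_derivative real k * inverse t ^ (k - 1) * (- (inverse t)\<^sup>2)) (at t)"
        "((\<lambda>t. exp (- inverse t)) has_real_derivative exp (- inverse t) * (inverse t)\<^sup>2) (at t)"
        using 1 by (auto intro!: derivative_eq_intros simp: power2_eq_square)
      show ?thesis
        by (rule DERIV_cong[OF DERIV_mult[OF d]]) (cases k; simp add: algebra_simps power2_eq_square)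
    qed
    then have "(flat k has_real_derivative
        (inverse t ^ k * inverse t ^ 2 - real k * (inverse t ^ k * inverse t)) * exp (- inverse t)) (at t)"
      by (rule has_field_derivative_transform_within_open[of _ _ _ "{0<..}"]) (use 1 in \<open>auto simp: flat_def\<close>)
    moreover have "(inverse t ^ k * inverse t ^ 2 - real k * (inverse t ^ k * inverse t)) * exp (- inverse t)
        = flat (k + 2) t - real k * flat (k + 1) t"
      using 1 by (simp add: flat_def algebra_simps power2_eq_square)
    ultimately show ?thesis by simp
  next
    case 2
    have "((\<lambda>t. 0) has_real_derivative 0) (at t)" by simp
    then have "(flat k has_real_derivative 0) (at t)"
      by (rule has_field_derivative_transform_within_open[of _ _ _ "{..<0}"]) (use 2 in \<open>auto simp: flat_def\<close>)
    then show ?thesis using 2 by (simp add: flat_def)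
  next
    case 3
    define C where "C = real (k + 2) ^ (k + 2)"
    have "((\<lambda>h. (flat k h - flat k 0) / (h - 0)) \<longlongrightarrow> 0) (at 0)"
    proof (rule Lim_null_comparison)
      show "\<forall>\<^sub>F h in at 0. norm ((flat k h - flat k 0) / (h - 0)) \<le> C * \<bar>h\<bar>"
      proof (rule always_eventually, rule allI)
        fix h :: real
        have "\<bar>flat k h\<bar> \<le> (C * \<bar>h\<bar>) * \<bar>h\<bar>"
          using flat_bound[of k h] by (simp add: C_def power2_eq_square abs_mult_self_eq mult.assoc)
        then show "norm ((flat k h - flat k 0) / (h - 0)) \<le> C * \<bar>h\<bar>"
          by (cases "h = 0") (simp_all add: flat_def[of k 0] pos_divide_le_eq C_def)
      qed
      show "((\<lambda>h. C * \<bar>h\<bar>) \<longlongrightarrow> 0) (at 0)"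
        by (auto intro!: tendsto_eq_intros)
    qed
    then show ?thesis using 3 by (simp add: has_field_derivative_iff flat_def)
  qed
qed

text \<open>Left without normalisation: the same function serves as mollifier and as cut-off, and
  the resulting factor is divided out at the end as \<open>bump_mass\<close>.\<close>

definition bump :: "complex \<Rightarrow> real" where
  "bump z = flat 0 (1 - (cmod z)\<^sup>2)"

lemma smooth_Re_Im: "smooth Re" "smooth Im" using smooth_coord[of 0] by simp_all

lemma smooth_bump: "smooth bump"
proof -
  define t where "t z = 1 - ((Re z)\<^sup>2 + (Im z)\<^sup>2)" for z
  have t: "(t has_derivative (\<lambda>h. - 2 * (Re z * Re h + Im z * Im h))) (at z)" for z
    unfolding t_def by (auto intro!: derivative_eq_intros simp: algebra_simps)
  have st: "smooth t" unfolding t_def[abs_def]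
    by (intro smooth_diff smooth_add smooth_power smooth_const smooth_Re_Im)
  have ft: "((\<lambda>z. flat k (t z)) has_derivative (\<lambda>h. - 2 * (Re z * Re h + Im z * Im h) * (flat (k + 2) (t z) - real k * flat (k + 1) (t z)))) (at z)" for k z
    by (rule DERIV_compose_FDERIV[OF flat_deriv t])
  have dft: "(\<lambda>z. flat k (t z)) differentiable at z" for k z
    using ft unfolding differentiable_def by blast
  have "smooth (\<lambda>z. 1 * flat 0 (t z))"
  \<comment> \<open>Products of a smooth function with some \<open>flat k (t z)\<close> are closed
    under differentiation: the index rises by 2, and everything else is collected in the new smooth
    factor \<open>p'\<close>.\<close>
  proof (rule smooth_coinduct[where S = "\<lambda>h. \<exists>p k. smooth p \<and> h = (\<lambda>z. p z * flat k (t z))"])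
    show "\<exists>p k. smooth p \<and> (\<lambda>z. 1 * flat 0 (t z)) = (\<lambda>z. p z * flat k (t z))"
      by (intro exI[of _ "\<lambda>z. 1"] exI[of _ 0]) auto
  next
    fix h z assume "\<exists>p k. smooth p \<and> h = (\<lambda>z. p z * flat k (t z))"
    then show "h differentiable at z" using dft smooth_differentiable by (auto intro!: differentiable_mult)
  next
    fix h and e :: complex assume "\<exists>p k. smooth p \<and> h = (\<lambda>z. p z * flat k (t z))" and e: "e = 1 \<or> e = \<i>"
    then obtain p k where p: "smooth p" "h = (\<lambda>z. p z * flat k (t z))" by blast
    define p' where "p' z = pd e p z * (t z)\<^sup>2 + p z * (- 2 * (Re z * Re e + Im z * Im e)) * (1 - real k * t z)" for z
    have "pd e h z = p' z * flat (k + 2) (t z)" for z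
    proof -
      have "pd e h z = pd e p z * flat k (t z) + p z * pd e (\<lambda>z. flat k (t z)) z"
        unfolding p(2) by (rule pd_bilinear[OF bounded_bilinear_mult smooth_differentiable[OF p(1)] dft])
      also have "\<dots> = pd e p z * flat k (t z) + p z * (- 2 * (Re z * Re e + Im z * Im e) * (flat (k + 2) (t z) - real k * flat (k + 1) (t z)))"
        by (simp only: pd_has_derivative[OF ft])
      also have "\<dots> = p' z * flat (k + 2) (t z)"
        unfolding p'_def flat_square[of k] by (simp add: algebra_simps)
      finally show ?thesis .
    qed
    moreover have "smooth p'" unfolding p'_def[abs_def]
      by (intro smooth_diff smooth_add smooth_mult smooth_power smooth_const smooth_Re_Im st p smooth_pd[OF p(1) e])
    ultimately show "\<exists>p k. smooth p \<and> pd e h = (\<lambda>z. p z * flat k (t z))" by blast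
  qed
  moreover have "(\<lambda>z. 1 * flat 0 (t z)) = bump" by (auto simp: bump_def t_def cmod_power2)
  ultimately show ?thesis by simp
qed

lemma bump_nonneg: "0 \<le> bump z" by (simp add: bump_def flat_def)

lemma bump_pos_iff: "bump z \<noteq> 0 \<longleftrightarrow> cmod z < 1"
  by (auto simp: bump_def flat_def abs_square_less_1)

lemma bsupp_bump: "bsupp bump"
  by (rule bounded_subset[OF bounded_ball[of 0 1]]) (auto simp: bump_pos_iff)

section \<open>Lipschitz and second-order Taylor bounds\<close>

lemma has_derivative_pd:
  assumes "f differentiable at z"
  shows "(f has_derivative (\<lambda>h. Re h *\<^sub>R pd 1 f z + Im h *\<^sub>R pd \<i> f z)) (at z)"
proof -
  have D: "(f has_derivative frechet_derivative f (at z)) (at z)"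
    using assms by (simp add: frechet_derivative_works)
  have "frechet_derivative f (at z) h = Re h *\<^sub>R pd 1 f z + Im h *\<^sub>R pd \<i> f z" for h
  proof -
    have "frechet_derivative f (at z) (Re h *\<^sub>R 1 + Im h *\<^sub>R \<i>) = Re h *\<^sub>R pd 1 f z + Im h *\<^sub>R pd \<i> f z"
      unfolding pd_frechet[OF assms] using has_derivative_linear[OF D]
      by (simp only: linear_add linear_cmul)
    moreover have "Re h *\<^sub>R 1 + Im h *\<^sub>R \<i> = h" by (simp add: complex_eq_iff)
    ultimately show ?thesis by simp
  qed
  then have "frechet_derivative f (at z) = (\<lambda>h. Re h *\<^sub>R pd 1 f z + Im h *\<^sub>R pd \<i> f z)" by blast
  then show ?thesis using D by simp
qed

lemma onorm_pd_le:
  assumes "norm a \<le> M" "norm c \<le> M"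
  shows "onorm (\<lambda>h::complex. Re h *\<^sub>R a + Im h *\<^sub>R c) \<le> 2 * M"
proof (rule onorm_bound)
  show "0 \<le> 2 * M" using assms norm_ge_zero[of a] by linarith
  fix h :: complex
  have "norm (Re h *\<^sub>R a + Im h *\<^sub>R c) \<le> \<bar>Re h\<bar> * norm a + \<bar>Im h\<bar> * norm c"
    by (metis norm_scaleR norm_triangle_ineq)
  also have "\<dots> \<le> cmod h * M + cmod h * M"
    using assms by (intro add_mono mult_mono abs_Re_le_cmod abs_Im_le_cmod) auto
  finally show "norm (Re h *\<^sub>R a + Im h *\<^sub>R c) \<le> 2 * M * cmod h" by (simp add: algebra_simps)
qed

lemma lipschitz_pd:
  fixes f :: "complex \<Rightarrow> 'b::real_normed_vector"
  assumes f: "smooth f" and M: "\<And>z. norm (pd 1 f z) \<le> M" "\<And>z. norm (pd \<i> f z) \<le> M"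
  shows "norm (f x - f y) \<le> 2 * M * cmod (x - y)"
  by (rule differentiable_bound[OF convex_UNIV _ onorm_pd_le[OF M]])
     (use has_derivative_pd[OF smooth_differentiable[OF f]] in auto)

text \<open>As a function of the increment, the remainder has a gradient bounded by a multiple of
  |h| on the ball of radius |h|. The constant is uniform in \<open>w\<close>, as differentiation
  under a convolution integral requires.\<close>

lemma taylor2:
  fixes k :: "complex \<Rightarrow> real"
  assumes k: "smooth k" "bsupp k"
  obtains C where "0 \<le> C" "\<And>w h. \<bar>k (w + h) - k w - (Re h * pd 1 k w + Im h * pd \<i> k w)\<bar> \<le> C * (cmod h)\<^sup>2"
proof -
  have "\<exists>M. \<forall>z. norm (pd e (pd d k) z) \<le> M" if "e = 1 \<or> e = \<i>" "d = 1 \<or> d = \<i>" for e d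
    using bsupp_bound[OF smooth_continuous_on[OF smooth_pd[OF smooth_pd[OF k(1) that(2)] that(1)]] bsupp_pd[OF bsupp_pd[OF k(2)]]]
    by metis
  then obtain M1 M2 M3 M4 where M: "\<And>z. norm (pd 1 (pd 1 k) z) \<le> M1" "\<And>z. norm (pd \<i> (pd 1 k) z) \<le> M2"
    "\<And>z. norm (pd 1 (pd \<i> k) z) \<le> M3" "\<And>z. norm (pd \<i> (pd \<i> k) z) \<le> M4"
    by metis
  define M where "M = max (max M1 M2) (max M3 M4)"
  have M: "norm (pd 1 (pd 1 k) z) \<le> M" "norm (pd \<i> (pd 1 k) z) \<le> M"
    "norm (pd 1 (pd \<i> k) z) \<le> M" "norm (pd \<i> (pd \<i> k) z) \<le> M" for z
    using M[of z] by (auto simp: M_def)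
  have M0: "0 \<le> M" using M(1)[of 0] norm_ge_zero order_trans by blast
  have L: "norm (pd e k x - pd e k y) \<le> 2 * M * cmod (x - y)" if "e = 1 \<or> e = \<i>" for e x y
    using that lipschitz_pd[OF smooth_pd[OF k(1), of 1] M(1,2)] lipschitz_pd[OF smooth_pd[OF k(1), of \<i>] M(3,4)] by auto
  show thesis
  proof (rule that[of "4 * M"])
    fix w h :: complex
    define p where "p s = k (w + s) - (Re s * pd 1 k w + Im s * pd \<i> k w)" for s
    have "norm (p h - p 0) \<le> (2 * (2 * M * cmod h)) * cmod (h - 0)"
    proof (rule differentiable_bound[where S = "cball 0 (cmod h)"])
      fix s :: complex assume s: "s \<in> cball 0 (cmod h)"
      have "((\<lambda>s. k (w + s)) has_derivative (\<lambda>h. Re h *\<^sub>R pd 1 k (w + s) + Im h *\<^sub>R pd \<i> k (w + s))) (at s)"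
        using diff_chain_at[OF _ has_derivative_pd[OF smooth_differentiable[OF k(1)]], of "\<lambda>s. w + s" "\<lambda>s. s" s]
        by (simp add: o_def has_derivative_add_const add.commute[of w])
      then have "(p has_derivative (\<lambda>h. (Re h *\<^sub>R pd 1 k (w + s) + Im h *\<^sub>R pd \<i> k (w + s)) - (Re h * pd 1 k w + Im h * pd \<i> k w))) (at s)"
        unfolding p_def by (intro has_derivative_diff) (auto intro!: derivative_eq_intros)
      then have "(p has_derivative (\<lambda>h. Re h *\<^sub>R (pd 1 k (w + s) - pd 1 k w) + Im h *\<^sub>R (pd \<i> k (w + s) - pd \<i> k w))) (at s)"
        by (rule has_derivative_eq_rhs) (auto simp: algebra_simps)
      then show "(p has_derivative (\<lambda>h. Re h *\<^sub>R (pd 1 k (w + s) - pd 1 k w) + Im h *\<^sub>R (pd \<i> k (w + s) - pd \<i> k w))) (at s within cball 0 (cmod h))"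
        by (rule has_derivative_at_withinI)
      have "2 * M * cmod s \<le> 2 * M * cmod h" using s M0 by (intro mult_left_mono) auto
      then show "onorm (\<lambda>h. Re h *\<^sub>R (pd 1 k (w + s) - pd 1 k w) + Im h *\<^sub>R (pd \<i> k (w + s) - pd \<i> k w)) \<le> 2 * (2 * M * cmod h)"
        using L[of 1 "w + s" w] L[of \<i> "w + s" w] by (intro onorm_pd_le) (auto intro: order_trans)
    qed auto
    then show "\<bar>k (w + h) - k w - (Re h * pd 1 k w + Im h * pd \<i> k w)\<bar> \<le> 4 * M * (cmod h)\<^sup>2"
      by (simp add: p_def power2_eq_square algebra_simps)
  qed (use M0 in simp)
qed

section \<open>Mollification of square integrable functions\<close>

lemma pd_affine:
  assumes f: "smooth f"
  shows "pd e (\<lambda>z. f (c + of_real r * z)) z = r *\<^sub>R pd e f (c + of_real r * z)"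
proof -
  define w where "w = c + of_real r * z"
  have "((\<lambda>z. c + of_real r * z) has_derivative (\<lambda>h. of_real r * h)) (at z)"
    by (auto intro!: derivative_eq_intros)
  from diff_chain_at[OF this has_derivative_pd[OF smooth_differentiable[OF f]]]
  have "((\<lambda>z. f (c + of_real r * z)) has_derivative
      (\<lambda>h. Re (of_real r * h) *\<^sub>R pd 1 f w + Im (of_real r * h) *\<^sub>R pd \<i> f w)) (at z)"
    by (simp add: o_def w_def)
  from pd_has_derivative[OF this, of e]
  have "pd e (\<lambda>z. f (c + of_real r * z)) z = r *\<^sub>R (Re e *\<^sub>R pd 1 f w + Im e *\<^sub>R pd \<i> f w)"
    by (simp add: scaleR_add_right)
  also have "Re e *\<^sub>R pd 1 f w + Im e *\<^sub>R pd \<i> f w = pd e f w"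
    using pd_has_derivative[OF has_derivative_pd[OF smooth_differentiable[OF f, of w]]] by metis
  finally show ?thesis by (simp add: w_def)
qed

lemma smooth_affine:
  fixes f :: "complex \<Rightarrow> 'b::real_normed_vector"
  assumes "smooth f"
  shows "smooth (\<lambda>z. f (c + of_real r * z))"
proof (rule smooth_coinduct[where S = "\<lambda>h. \<exists>f. smooth f \<and> h = (\<lambda>z. f (c + of_real r * z))"])
  show "\<exists>g. smooth g \<and> (\<lambda>z. f (c + of_real r * z)) = (\<lambda>z. g (c + of_real r * z))" using assms by blast
next
  fix h :: "complex \<Rightarrow> 'b" and z assume "\<exists>f. smooth f \<and> h = (\<lambda>z. f (c + of_real r * z))"
  then obtain f where f: "smooth f" "h = (\<lambda>z. f (c + of_real r * z))" by blast
  have "((\<lambda>z. c + of_real r * z) has_derivative (\<lambda>h. of_real r * h)) (at z)"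
    by (auto intro!: derivative_eq_intros)
  from diff_chain_at[OF this has_derivative_pd[OF smooth_differentiable[OF f(1)]]]
  show "h differentiable at z" unfolding f(2) differentiable_def o_def by blast
next
  fix h :: "complex \<Rightarrow> 'b" and e assume "\<exists>f. smooth f \<and> h = (\<lambda>z. f (c + of_real r * z))" and e: "e = 1 \<or> e = \<i>"
  then obtain f where f: "smooth f" "h = (\<lambda>z. f (c + of_real r * z))" by blast
  have "smooth (\<lambda>z. r *\<^sub>R pd e f z)"
    by (rule smooth_bounded_linear[OF bounded_linear_scaleR_right smooth_pd[OF f(1) e]])
  moreover have "pd e h = (\<lambda>z. r *\<^sub>R pd e f (c + of_real r * z))"
    unfolding f(2) by (intro ext pd_affine f(1))
  ultimately show "\<exists>f. smooth f \<and> pd e h = (\<lambda>z. f (c + of_real r * z))" by blast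
qed

lemma bsupp_affine:
  assumes f: "bsupp f" and r: "r \<noteq> 0"
  shows "bsupp (\<lambda>z. f (c + of_real r * z))"
proof -
  obtain K where K: "\<And>z. f z \<noteq> 0 \<Longrightarrow> cmod z \<le> K" using f unfolding bounded_iff by auto
  show ?thesis
  proof (rule boundedI, clarify)
    fix z assume "f (c + of_real r * z) \<noteq> 0"
    then have "cmod (c + of_real r * z) \<le> K" by (rule K)
    moreover have "\<bar>r\<bar> * cmod z \<le> cmod (c + of_real r * z) + cmod c"
      using norm_triangle_ineq4[of "c + of_real r * z" c] by (simp add: norm_mult)
    ultimately have "\<bar>r\<bar> * cmod z \<le> K + cmod c" by linarith
    then show "cmod z \<le> (K + cmod c) / \<bar>r\<bar>" using r by (simp add: pos_le_divide_eq mult.commute)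
  qed
qed

lemma reflect_eq: "(\<lambda>y. f (x - y)) = (\<lambda>y. f (x + of_real (-1) * y))" by simp

lemma smooth_reflect: "smooth f \<Longrightarrow> smooth (\<lambda>y. f (x - y))"
  unfolding reflect_eq by (rule smooth_affine)

lemma bsupp_reflect: "bsupp f \<Longrightarrow> bsupp (\<lambda>y. f (x - y))"
  using bsupp_affine[of f "- 1" x] by simp

lemma pd_reflect: "smooth f \<Longrightarrow> pd e (\<lambda>y. f (x - y)) y = - pd e f (x - y)"
  unfolding reflect_eq by (simp only: pd_affine) simp

definition conv :: "(complex \<Rightarrow> complex) \<Rightarrow> (complex \<Rightarrow> real) \<Rightarrow> complex \<Rightarrow> complex" where
  "conv u k x = (LINT y|lborel. u y * of_real (k (x - y)))"

lemma integrable_mult_L2: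
  fixes u :: "complex \<Rightarrow> complex" and g :: "complex \<Rightarrow> complex"
  assumes u [measurable]: "u \<in> borel_measurable lborel" and u2: "integrable lborel (\<lambda>z. (cmod (u z))\<^sup>2)"
    and g [measurable]: "g \<in> borel_measurable borel" and g2: "integrable lborel (\<lambda>z. (cmod (g z))\<^sup>2)"
  shows "integrable lborel (\<lambda>y. u y * g y)"
proof (rule Bochner_Integration.integrable_bound[OF Bochner_Integration.integrable_add[OF u2 g2]])
  show "AE y in lborel. norm (u y * g y) \<le> norm ((cmod (u y))\<^sup>2 + (cmod (g y))\<^sup>2)"
  proof (rule AE_I2)
    fix y
    have "2 * cmod (u y) * cmod (g y) \<le> (cmod (u y))\<^sup>2 + (cmod (g y))\<^sup>2" by (rule sum_squares_bound)
    moreover have "0 \<le> cmod (u y) * cmod (g y)" by simp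
    ultimately have "cmod (u y) * cmod (g y) \<le> (cmod (u y))\<^sup>2 + (cmod (g y))\<^sup>2" by linarith
    then show "norm (u y * g y) \<le> norm ((cmod (u y))\<^sup>2 + (cmod (g y))\<^sup>2)" by (simp add: norm_mult)
  qed
qed measurable

lemma integrable_mult_bsupp:
  fixes u g :: "complex \<Rightarrow> complex"
  assumes "u \<in> borel_measurable lborel" "integrable lborel (\<lambda>z. (cmod (u z))\<^sup>2)"
    and g: "continuous_on UNIV g" "bsupp g"
  shows "integrable lborel (\<lambda>y. u y * g y)"
proof (rule integrable_mult_L2[OF assms(1,2)])
  show "g \<in> borel_measurable borel" by (rule borel_measurable_continuous_onI[OF g(1)])
  show "integrable lborel (\<lambda>z. (cmod (g z))\<^sup>2)"
    by (rule integrable_bsupp) (use g in \<open>auto intro!: continuous_intros\<close>)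
qed

text \<open>Local integrability of \<open>u\<close>; it supplies the dominating functions for limits
  under the integral sign.\<close>

lemma integrable_indicator_ball:
  fixes u :: "complex \<Rightarrow> complex"
  assumes u [measurable]: "u \<in> borel_measurable lborel" and u2: "integrable lborel (\<lambda>z. (cmod (u z))\<^sup>2)"
  shows "integrable lborel (\<lambda>y. u y * indicator (cball x r) y)"
proof (rule integrable_mult_L2[OF u u2])
  have "integrable lborel (\<lambda>y::complex. indicator (cball x r) y *\<^sub>R (1::real))"
    by (intro borel_integrable_compact continuous_intros compact_cball)
  moreover have "(\<lambda>z. (cmod (indicator (cball x r) z))\<^sup>2) = (\<lambda>y::complex. indicator (cball x r) y *\<^sub>R (1::real))"
    by (auto simp: indicator_def)
  ultimately show "integrable lborel (\<lambda>z. (cmod (indicator (cball x r) z))\<^sup>2)" by simp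
qed (intro borel_measurable_indicator, simp)

context
  fixes u :: "complex \<Rightarrow> complex"
  assumes u [measurable]: "u \<in> borel_measurable lborel" and u2: "integrable lborel (\<lambda>z. (cmod (u z))\<^sup>2)"
begin

lemma integrable_conv:
  assumes k: "smooth k" "bsupp k"
  shows "integrable lborel (\<lambda>y. u y * of_real (k (x - y)))"
proof (rule integrable_mult_bsupp[OF u u2])
  show "continuous_on UNIV (\<lambda>y. complex_of_real (k (x - y)))"
    by (intro smooth_continuous_on smooth_of_real smooth_reflect k)
  show "bsupp (\<lambda>y. complex_of_real (k (x - y)))" using bsupp_reflect[OF k(2)] by simp
qed

text \<open>Integrate the Taylor expansion of the kernel: its remainder is O(|h|^2) uniformly, and
  for |h| \<le> 1 it is supported in a fixed ball, on which \<open>u\<close> is integrable.\<close>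

lemma conv_has_derivative:
  assumes k: "smooth k" "bsupp k"
  shows "(conv u k has_derivative (\<lambda>h. Re h *\<^sub>R conv u (pd 1 k) x + Im h *\<^sub>R conv u (pd \<i> k) x)) (at x)"
proof -
  obtain C where C: "0 \<le> C" "\<And>w h. \<bar>k (w + h) - k w - (Re h * pd 1 k w + Im h * pd \<i> k w)\<bar> \<le> C * (cmod h)\<^sup>2"
    using taylor2[OF k] by blast
  have "bounded ({w. k w \<noteq> 0} \<union> {w. pd 1 k w \<noteq> 0} \<union> {w. pd \<i> k w \<noteq> 0})"
    using k by (simp add: bsupp_pd)
  then obtain K where K: "\<And>w. k w \<noteq> 0 \<or> pd 1 k w \<noteq> 0 \<or> pd \<i> k w \<noteq> 0 \<Longrightarrow> cmod w \<le> K"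
    unfolding bounded_iff by blast
  define c where "c = C * (LINT y|lborel. cmod (u y * indicator (cball x (K + 1)) y))"
  note ik = integrable_conv[OF k] integrable_conv[OF smooth_pd[OF k(1)] bsupp_pd[OF k(2)]]
  have est: "norm (conv u k (x + h) - conv u k x - (Re h *\<^sub>R conv u (pd 1 k) x + Im h *\<^sub>R conv u (pd \<i> k) x))
      \<le> c * (cmod h)\<^sup>2" if h: "cmod h \<le> 1" for h
  proof -
    define r where "r y = k (x + h - y) - k (x - y) - (Re h * pd 1 k (x - y) + Im h * pd \<i> k (x - y))" for y
    have "conv u k (x + h) - conv u k x - (Re h *\<^sub>R conv u (pd 1 k) x + Im h *\<^sub>R conv u (pd \<i> k) x)
      = (LINT y|lborel. u y * of_real (k (x + h - y)) - u y * of_real (k (x - y))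
          - (Re h *\<^sub>R (u y * of_real (pd 1 k (x - y))) + Im h *\<^sub>R (u y * of_real (pd \<i> k (x - y)))))"
      unfolding conv_def using ik by simp
    also have "\<dots> = (LINT y|lborel. u y * of_real (r y))"
      by (rule Bochner_Integration.integral_cong) (auto simp: r_def scaleR_conv_of_real algebra_simps)
    also have "norm \<dots> \<le> (LINT y|lborel. C * (cmod h)\<^sup>2 * cmod (u y * indicator (cball x (K + 1)) y))"
    proof (rule order_trans[OF integral_norm_bound integral_mono])
      have "integrable lborel (\<lambda>y. u y * of_real (k (x + h - y)) - u y * of_real (k (x - y))
          - (Re h *\<^sub>R (u y * of_real (pd 1 k (x - y))) + Im h *\<^sub>R (u y * of_real (pd \<i> k (x - y)))))"
        using ik by simp
      then have "integrable lborel (\<lambda>y. u y * of_real (r y))"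
        by (rule Bochner_Integration.integrable_cong[THEN iffD1, rotated 2])
           (auto simp: r_def scaleR_conv_of_real algebra_simps)
      then show "integrable lborel (\<lambda>y. norm (u y * of_real (r y)))" by (rule integrable_norm)
      show "integrable lborel (\<lambda>y. C * (cmod h)\<^sup>2 * cmod (u y * indicator (cball x (K + 1)) y))"
        by (intro integrable_mult_right integrable_norm integrable_indicator_ball[OF u u2])
      fix y
      show "norm (u y * of_real (r y)) \<le> C * (cmod h)\<^sup>2 * cmod (u y * indicator (cball x (K + 1)) y)"
      proof (cases "y \<in> cball x (K + 1)")
        case True
        have "\<bar>r y\<bar> \<le> C * (cmod h)\<^sup>2"
          using C(2)[of "x - y" h] unfolding r_def by (simp add: algebra_simps)
        then have "cmod (u y) * \<bar>r y\<bar> \<le> cmod (u y) * (C * (cmod h)\<^sup>2)" by (intro mult_left_mono) auto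
        then show ?thesis using True by (simp add: norm_mult mult_ac)
      next
        case False
        then have far: "K + 1 < cmod (x - y)" by (simp add: dist_norm)
        moreover have "cmod (x - y) \<le> cmod (x + h - y) + cmod h"
          using norm_triangle_ineq4[of "x + h - y" h] by (simp add: algebra_simps)
        ultimately have "K < cmod (x + h - y)" using h by linarith
        then have "k (x + h - y) = 0" "k (x - y) = 0" "pd 1 k (x - y) = 0" "pd \<i> k (x - y) = 0"
          using K[of "x + h - y"] K[of "x - y"] far by force+
        then show ?thesis using False by (simp add: r_def)
      qed
    qed
    also have "\<dots> = c * (cmod h)\<^sup>2" by (simp add: c_def)
    finally show ?thesis .
  qed
  show ?thesis unfolding has_derivative_at
  proof (intro conjI)
    show "bounded_linear (\<lambda>h. Re h *\<^sub>R conv u (pd 1 k) x + Im h *\<^sub>R conv u (pd \<i> k) x)"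
      by (intro bounded_linear_add bounded_linear_scaleR_const bounded_linear_Re bounded_linear_Im)
    show "((\<lambda>h. norm (conv u k (x + h) - conv u k x - (Re h *\<^sub>R conv u (pd 1 k) x + Im h *\<^sub>R conv u (pd \<i> k) x)) / norm h) \<longlongrightarrow> 0) (at 0)"
    proof (rule Lim_null_comparison)
      show "((\<lambda>h. c * cmod h) \<longlongrightarrow> 0) (at 0)" by (auto intro!: tendsto_eq_intros)
      have "\<forall>\<^sub>F h in at 0. cmod h \<le> 1"
        unfolding eventually_at by (rule exI[of _ 1]) (auto simp: dist_norm)
      then show "\<forall>\<^sub>F h in at 0. norm (norm (conv u k (x + h) - conv u k x - (Re h *\<^sub>R conv u (pd 1 k) x + Im h *\<^sub>R conv u (pd \<i> k) x)) / norm h) \<le> c * cmod h"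
      proof eventually_elim
        case (elim h)
        then show ?case
          using est[OF elim] by (cases "h = 0") (auto simp: pos_divide_le_eq power2_eq_square mult_ac)
      qed
    qed
  qed
qed

lemma pd_conv:
  assumes "smooth k" "bsupp k" "e = 1 \<or> e = \<i>"
  shows "pd e (conv u k) = conv u (pd e k)"
  using pd_has_derivative[OF conv_has_derivative[OF assms(1,2)]] assms(3) by (auto simp: fun_eq_iff)

lemma smooth_conv:
  assumes "smooth k" "bsupp k"
  shows "smooth (conv u k)"
proof (rule smooth_coinduct[where S = "\<lambda>h. \<exists>k. smooth k \<and> bsupp k \<and> h = conv u k"])
  fix h z assume "\<exists>k. smooth k \<and> bsupp k \<and> h = conv u k"
  then show "h differentiable at z" using conv_has_derivative unfolding differentiable_def by blast
next
  fix h and e :: complex assume "\<exists>k. smooth k \<and> bsupp k \<and> h = conv u k" "e = 1 \<or> e = \<i>"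
  then show "\<exists>k. smooth k \<and> bsupp k \<and> pd e h = conv u k"
    using pd_conv smooth_pd bsupp_pd by metis
qed (use assms in auto)

text \<open>Schur's test for a local average: Cauchy-Schwarz on the square of side 2 eps about
  \<open>x\<close>, then Tonelli. Each of the two costs the area 4 eps^2; against the squared
  prefactor C^2 / eps^4 the powers of eps cancel and 16 C^2 remains.\<close>

lemma schur:
  fixes g :: "complex \<Rightarrow> complex"
  assumes g: "test_fun g" and eps: "0 < eps" and C: "0 \<le> C"
    and le: "\<And>x. cmod (g x) \<le> C / eps\<^sup>2 * (LINT y|lborel. cmod (u y * indicator (cball x eps) y))"
  shows "(normsq g) \<le> 16 * C\<^sup>2 * (normsq u)"
proof -
  define q where "q = Complex eps eps"
  \<comment> \<open>A square in place of the disc: it contains the disc, its measure is explicit,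
    and membership is symmetric in x and y. Being an indicator, \<open>k\<close> may be squared
    freely.\<close>
  define k where "k x y = (indicator (cbox (x - q) (x + q)) y :: ennreal)" for x y :: complex
  have k_sym: "k x y = k y x" for x y
    by (auto simp: k_def q_def indicator_def cbox_def Basis_complex_def inner_complex_def)
  have mk [measurable]: "(\<lambda>(x, y). k x y) \<in> borel_measurable (lborel \<Otimes>\<^sub>M lborel)"
  proof -
    have "(\<lambda>(x, y). k x y) = indicator {p. \<bar>Re (fst p) - Re (snd p)\<bar> \<le> eps \<and> \<bar>Im (fst p) - Im (snd p)\<bar> \<le> eps}"
      by (auto simp: k_def q_def indicator_def cbox_def Basis_complex_def inner_complex_def fun_eq_iff)
    moreover have "closed {p :: complex \<times> complex. \<bar>Re (fst p) - Re (snd p)\<bar> \<le> eps \<and> \<bar>Im (fst p) - Im (snd p)\<bar> \<le> eps}"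
      by (intro closed_Collect_conj closed_Collect_le continuous_intros)
    ultimately show ?thesis by (simp add: lborel_prod borel_measurable_indicator)
  qed
  have k_int: "(\<integral>\<^sup>+y. k x y \<partial>lborel) = ennreal (4 * eps\<^sup>2)" for x
  proof -
    have "(\<integral>\<^sup>+y. k x y \<partial>lborel) = emeasure lborel (cbox (x - q) (x + q))"
      by (simp add: k_def)
    also have "\<dots> = ennreal (4 * eps\<^sup>2)" using eps by (subst emeasure_lborel_cbox)
        (auto simp: Basis_complex_def inner_complex_def q_def power2_eq_square)
    finally show ?thesis .
  qed
  have [measurable]: "k x \<in> borel_measurable borel" for x unfolding k_def by measurable
  define D where "D = ennreal (C / eps\<^sup>2)"
  define U where "U y = ennreal (cmod (u y))" for y
  have [measurable]: "U \<in> borel_measurable borel" unfolding U_def using u by simp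
  have pt: "(ennreal (cmod (g x)))\<^sup>2 \<le> D\<^sup>2 * (ennreal (4 * eps\<^sup>2) * (\<integral>\<^sup>+y. (U y)\<^sup>2 * k x y \<partial>lborel))" for x
  proof -
    have "ennreal (cmod (g x)) \<le> D * ennreal (LINT y|lborel. cmod (u y * indicator (cball x eps) y))"
      unfolding D_def using le[of x] C by (subst ennreal_mult[symmetric]) (auto intro!: ennreal_leI)
    also have "ennreal (LINT y|lborel. cmod (u y * indicator (cball x eps) y)) = (\<integral>\<^sup>+y. cmod (u y * indicator (cball x eps) y) \<partial>lborel)"
      by (rule nn_integral_eq_integral[symmetric]) (auto intro!: integrable_norm integrable_indicator_ball[OF u u2])
    also have "\<dots> \<le> (\<integral>\<^sup>+y. (U y * k x y) * k x y \<partial>lborel)"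
    proof (rule nn_integral_mono)
      fix y
      show "ennreal (cmod (u y * indicator (cball x eps) y)) \<le> (U y * k x y) * k x y"
      proof (cases "y \<in> cball x eps")
        case True
        then have "k x y = 1" using abs_Re_le_cmod[of "x - y"] abs_Im_le_cmod[of "x - y"]
          by (auto simp: k_def q_def indicator_def cbox_def Basis_complex_def inner_complex_def dist_norm)
        then show ?thesis by (auto simp: U_def norm_mult indicator_def)
      qed simp
    qed
    finally have "ennreal (cmod (g x)) \<le> D * (\<integral>\<^sup>+y. (U y * k x y) * k x y \<partial>lborel)"
      by (simp add: mult_left_mono)
    then have "(ennreal (cmod (g x)))\<^sup>2 \<le> (D * (\<integral>\<^sup>+y. (U y * k x y) * k x y \<partial>lborel))\<^sup>2"
      by (intro power_mono) auto
    also have "\<dots> = D\<^sup>2 * (\<integral>\<^sup>+y. (U y * k x y) * k x y \<partial>lborel)\<^sup>2" by (rule power_mult_distrib)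
    also have "\<dots> \<le> D\<^sup>2 * ((\<integral>\<^sup>+y. (U y * k x y)\<^sup>2 \<partial>lborel) * (\<integral>\<^sup>+y. (k x y)\<^sup>2 \<partial>lborel))"
      by (intro mult_left_mono Cauchy_Schwarz_nn_integral) auto
    also have "(\<lambda>y. (k x y)\<^sup>2) = k x" by (auto simp: k_def indicator_def fun_eq_iff)
    also have "(\<lambda>y. (U y * k x y)\<^sup>2) = (\<lambda>y. (U y)\<^sup>2 * k x y)" by (auto simp: k_def indicator_def fun_eq_iff)
    also have "integral\<^sup>N lborel (k x) = ennreal (4 * eps\<^sup>2)" by (rule k_int)
    finally show ?thesis by (simp add: mult_ac)
  qed
  have "ennreal (normsq g) = (\<integral>\<^sup>+x. ennreal ((cmod (g x))\<^sup>2) \<partial>lborel)"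
    by (rule nn_integral_eq_integral[symmetric]) (auto intro!: integrable_cmod2' g)
  also have "\<dots> = (\<integral>\<^sup>+x. (ennreal (cmod (g x)))\<^sup>2 \<partial>lborel)" by (simp add: ennreal_power)
  also have "\<dots> \<le> (\<integral>\<^sup>+x. D\<^sup>2 * (ennreal (4 * eps\<^sup>2) * (\<integral>\<^sup>+y. (U y)\<^sup>2 * k x y \<partial>lborel)) \<partial>lborel)"
    by (intro nn_integral_mono pt)
  also have "\<dots> = D\<^sup>2 * (ennreal (4 * eps\<^sup>2) * (\<integral>\<^sup>+x. (\<integral>\<^sup>+y. (U y)\<^sup>2 * k x y \<partial>lborel) \<partial>lborel))"
    by (simp add: nn_integral_cmult)
  also have "(\<integral>\<^sup>+x. (\<integral>\<^sup>+y. (U y)\<^sup>2 * k x y \<partial>lborel) \<partial>lborel) = (\<integral>\<^sup>+y. (\<integral>\<^sup>+x. (U y)\<^sup>2 * k x y \<partial>lborel) \<partial>lborel)"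
    by (rule lborel_pair.Fubini') measurable
  also have "\<dots> = (\<integral>\<^sup>+y. (U y)\<^sup>2 * ennreal (4 * eps\<^sup>2) \<partial>lborel)"
    by (subst k_sym) (simp add: nn_integral_cmult k_int)
  also have "\<dots> = (\<integral>\<^sup>+y. ennreal ((cmod (u y))\<^sup>2) \<partial>lborel) * ennreal (4 * eps\<^sup>2)"
    by (simp add: nn_integral_multc U_def ennreal_power)
  also have "(\<integral>\<^sup>+y. ennreal ((cmod (u y))\<^sup>2) \<partial>lborel) = ennreal (normsq u)"
    by (rule nn_integral_eq_integral) (auto intro: u2)
  also have "D\<^sup>2 * (ennreal (4 * eps\<^sup>2) * (ennreal (normsq u) * ennreal (4 * eps\<^sup>2)))
      = ennreal ((C / eps\<^sup>2)\<^sup>2 * (4 * eps\<^sup>2 * ((normsq u) * (4 * eps\<^sup>2))))"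
  proof -
    have "(ennreal a)\<^sup>2 * (ennreal m * (ennreal i * ennreal m)) = ennreal (a\<^sup>2 * (m * (i * m)))"
      if "0 \<le> a" "0 \<le> m" "0 \<le> i" for a m i
      using that by (simp add: ennreal_power ennreal_mult)
    then show ?thesis unfolding D_def using C by (simp add: Bochner_Integration.integral_nonneg)
  qed
  also have "(C / eps\<^sup>2)\<^sup>2 * (4 * eps\<^sup>2 * ((normsq u) * (4 * eps\<^sup>2))) = 16 * C\<^sup>2 * (normsq u)"
    using eps by (simp add: power_divide field_simps power2_eq_square)
  finally show ?thesis by (simp add: ennreal_le_iff)
qed

end

lemma integral_scale:
  fixes f :: "complex \<Rightarrow> complex"
  assumes [measurable]: "f \<in> borel_measurable borel" and e: "0 < eps"
  shows "(LINT x|lborel. f x) = eps\<^sup>2 *\<^sub>R (LINT w|lborel. f (y + eps *\<^sub>R w))"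
proof -
  have "(LINT x|lborel. f x) = (LINT x|density (distr lborel borel (\<lambda>x. y + eps *\<^sub>R x)) (\<lambda>_. \<bar>eps\<bar> ^ DIM(complex)). f x)"
    using lborel_affine[of eps y] e by simp
  also have "\<dots> = (LINT w|lborel. eps\<^sup>2 *\<^sub>R f (y + eps *\<^sub>R w))"
    using e by (simp add: integral_density integral_distr)
  finally show ?thesis by simp
qed

section \<open>Cut-off mollifications of eigenfunctions\<close>

text \<open>The coefficients are displayed one by one because the mollified equation has them at y
  where \<open>L\<close> has them at x. The last term, with the divergence of A, vanishes for A =
  (pd2 phi, - pd1 phi) by symmetry of the mixed derivatives.\<close>

lemma (in magnetic) L_expand:
  assumes f: "smooth f"
  shows "L f z = pd 1 (pd 1 f) z + pd \<i> (pd \<i> f) z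
    - 2 * \<i> * (of_real (A1 z) * pd 1 f z + of_real (A2 z) * pd \<i> f z)
    - of_real ((A1 z)\<^sup>2 + (A2 z)\<^sup>2) * f z - \<i> * of_real (pd 1 A1 z + pd \<i> A2 z) * f z"
proof -
  have sA: "smooth (\<lambda>z. complex_of_real (A1 z))" "smooth (\<lambda>z. complex_of_real (A2 z))"
    using smooth_A by auto
  note s = f sA smooth_A
  have p: "pd 1 (N1 f) z = pd 1 (pd 1 f) z - \<i> * (of_real (pd 1 A1 z) * f z + of_real (A1 z) * pd 1 f z)"
    unfolding N1_def[abs_def] using s
    by (simp add: pd_simps smooth_mult smooth_pd) (simp add: algebra_simps)
  have q: "pd \<i> (N2 f) z = pd \<i> (pd \<i> f) z - \<i> * (of_real (pd \<i> A2 z) * f z + of_real (A2 z) * pd \<i> f z)"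
    unfolding N2_def[abs_def] using s
    by (simp add: pd_simps smooth_mult smooth_pd) (simp add: algebra_simps)
  have "L f z = (pd 1 (N1 f) z - \<i> * of_real (A1 z) * N1 f z) + (pd \<i> (N2 f) z - \<i> * of_real (A2 z) * N2 f z)"
    by (simp only: L_def N1_def[of "N1 f"] N2_def[of "N2 f"])
  then show ?thesis unfolding p q by (simp add: N1_def N2_def algebra_simps power2_eq_square)
qed

section \<open>Rescaled bump functions as mollifier and cut-off\<close>

lemma pd_bump_eq_0:
  assumes "1 < cmod z"
  shows "pd e bump z = 0" "pd d (pd e bump) z = 0"
proof -
  have *: "pd e f z = 0" if z: "1 < cmod z" and f: "\<And>w. 1 < cmod w \<Longrightarrow> f w = 0" for e z and f :: "complex \<Rightarrow> real"
  proof -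
    have "open {w::complex. 1 < cmod w}" by (intro open_Collect_less continuous_intros)
    moreover have "((\<lambda>w. 0::real) has_derivative (\<lambda>_. 0)) (at z)" by simp
    ultimately have "(f has_derivative (\<lambda>_. 0)) (at z)"
      using has_derivative_transform_within_open[of "\<lambda>w. 0::real" "\<lambda>_. 0" z UNIV "{w. 1 < cmod w}" f] z f by auto
    then show ?thesis by (rule pd_has_derivative)
  qed
  have b: "bump w = 0" if "1 < cmod w" for w using bump_pos_iff[of w] that by auto
  have d: "pd e bump w = 0" if "1 < cmod w" for w e by (rule *[OF that b])
  show "pd e bump z = 0" "pd d (pd e bump) z = 0" by (rule d[OF assms], rule *[OF assms d])
qed

lemma bump_eq_0: "1 < cmod z \<Longrightarrow> bump z = 0" using bump_pos_iff[of z] by auto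

lemma bump_bounds:
  obtains P where "0 \<le> P" "\<And>z. \<bar>bump z\<bar> \<le> P" "\<And>z. \<bar>pd 1 bump z\<bar> \<le> P" "\<And>z. \<bar>pd \<i> bump z\<bar> \<le> P"
    "\<And>z. \<bar>pd 1 (pd 1 bump) z\<bar> \<le> P" "\<And>z. \<bar>pd \<i> (pd \<i> bump) z\<bar> \<le> P"
proof -
  have *: "\<exists>P. \<forall>z. \<bar>f z\<bar> \<le> P" if "smooth f" "bsupp f" for f :: "complex \<Rightarrow> real"
    using bsupp_bound[OF smooth_continuous_on[OF that(1)] that(2)] by (metis real_norm_def)
  have "\<exists>P. \<forall>z. \<bar>bump z\<bar> \<le> P" "\<exists>P. \<forall>z. \<bar>pd 1 bump z\<bar> \<le> P" "\<exists>P. \<forall>z. \<bar>pd \<i> bump z\<bar> \<le> P"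
    "\<exists>P. \<forall>z. \<bar>pd 1 (pd 1 bump) z\<bar> \<le> P" "\<exists>P. \<forall>z. \<bar>pd \<i> (pd \<i> bump) z\<bar> \<le> P"
    by (intro * smooth_bump bsupp_bump smooth_pd bsupp_pd; simp)+
  then obtain P1 P2 P3 P4 P5 where P: "\<And>z. \<bar>bump z\<bar> \<le> P1" "\<And>z. \<bar>pd 1 bump z\<bar> \<le> P2" "\<And>z. \<bar>pd \<i> bump z\<bar> \<le> P3"
    "\<And>z. \<bar>pd 1 (pd 1 bump) z\<bar> \<le> P4" "\<And>z. \<bar>pd \<i> (pd \<i> bump) z\<bar> \<le> P5"
    by metis
  have nn: "0 \<le> P1" "0 \<le> P2" "0 \<le> P3" "0 \<le> P4" "0 \<le> P5"
    using P[of 0] by linarith+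
  show thesis
  proof (rule that[of "P1 + P2 + P3 + P4 + P5"])
    fix z
    show "\<bar>bump z\<bar> \<le> P1 + P2 + P3 + P4 + P5" "\<bar>pd 1 bump z\<bar> \<le> P1 + P2 + P3 + P4 + P5"
      "\<bar>pd \<i> bump z\<bar> \<le> P1 + P2 + P3 + P4 + P5" "\<bar>pd 1 (pd 1 bump) z\<bar> \<le> P1 + P2 + P3 + P4 + P5"
      "\<bar>pd \<i> (pd \<i> bump) z\<bar> \<le> P1 + P2 + P3 + P4 + P5"
      using P[of z] nn by linarith+
  qed (use nn in simp)
qed

text \<open>The customary factor 1 / eps^2 of a mollifier is carried by \<open>cut\<close> instead.
  The summand 0 fits the shape c + r z of the affine rules.\<close>

definition moll :: "real \<Rightarrow> complex \<Rightarrow> real" where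
  "moll eps w = bump (0 + of_real (1 / eps) * w)"

text \<open>The cut-off radius 1 / eps is tied to the mollification scale eps: the vector potential is then
  O(1 / eps) on the support, which compensates its variation O(eps) over the mollification range.\<close>

definition cut :: "real \<Rightarrow> complex \<Rightarrow> real" where
  "cut eps x = (1 / eps\<^sup>2) * bump (0 + of_real eps * x)"

definition approx :: "(complex \<Rightarrow> complex) \<Rightarrow> real \<Rightarrow> complex \<Rightarrow> complex" where
  "approx u eps x = of_real (cut eps x) * conv u (moll eps) x"

lemma smooth_moll: "smooth (moll eps)"
  unfolding moll_def[abs_def] by (rule smooth_affine[OF smooth_bump])

lemma bsupp_moll: "0 < eps \<Longrightarrow> bsupp (moll eps)"
  unfolding moll_def[abs_def] by (rule bsupp_affine[OF bsupp_bump]) simp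

lemma smooth_cut: "smooth (cut eps)"
  unfolding cut_def[abs_def] by (intro smooth_mult smooth_const smooth_affine smooth_bump)

lemma bsupp_cut: "0 < eps \<Longrightarrow> bsupp (cut eps)"
  unfolding cut_def[abs_def] by (rule bsupp_mult(1), rule bsupp_affine[OF bsupp_bump]) simp

lemma pd_moll: "pd e (moll eps) w = (1 / eps) * pd e bump (0 + of_real (1 / eps) * w)"
  unfolding moll_def[abs_def] by (simp only: pd_affine[OF smooth_bump] real_scaleR_def)

lemma pd_cut: "pd e (cut eps) x = (1 / eps\<^sup>2) * (eps * pd e bump (0 + of_real eps * x))"
  unfolding cut_def[abs_def]
  by (simp only: pd_cmult[OF smooth_affine[OF smooth_bump]] pd_affine[OF smooth_bump] real_scaleR_def)

lemma pd_pd_cut: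
  assumes "e = 1 \<or> e = \<i>"
  shows "pd e (pd e (cut eps)) x = (1 / eps\<^sup>2) * (eps * (eps * pd e (pd e bump) (0 + of_real eps * x)))"
proof -
  have s: "smooth (pd e bump)" by (rule smooth_pd[OF smooth_bump assms])
  have "pd e (cut eps) = (\<lambda>x. (1 / eps\<^sup>2) * (eps * pd e bump (0 + of_real eps * x)))"
    by (intro ext pd_cut)
  then show ?thesis
    by (simp only: pd_cmult[OF smooth_mult[OF smooth_const smooth_affine[OF s]]] pd_cmult[OF smooth_affine[OF s]]
       pd_affine[OF s] real_scaleR_def)
qed

lemma test_fun_approx:
  assumes "u \<in> borel_measurable lborel" "integrable lborel (\<lambda>z. (cmod (u z))\<^sup>2)" and e: "0 < eps"
  shows "test_fun (approx u eps)"
proof (rule test_funI)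
  show "smooth (approx u eps)" unfolding approx_def[abs_def]
    by (intro smooth_mult smooth_of_real smooth_cut smooth_conv[OF assms(1,2)] smooth_moll bsupp_moll e)
  show "bsupp (approx u eps)"
    unfolding approx_def[abs_def] using bsupp_cut[OF e] by (intro bsupp_mult(2)) simp
qed

lemma moll_supp:
  assumes "0 < eps" "eps < cmod w"
  shows "moll eps w = 0" "pd e (moll eps) w = 0"
proof -
  have "1 < cmod (0 + of_real (1 / eps) * w)" using assms by (simp add: norm_mult norm_divide)
  then show "moll eps w = 0" "pd e (moll eps) w = 0"
    by (simp_all only: moll_def pd_moll pd_bump_eq_0 bump_eq_0 mult_zero_right)
qed

lemma cut_supp:
  assumes "0 < eps" "1 / eps < cmod x" and e: "e = 1 \<or> e = \<i>"
  shows "cut eps x = 0" "pd e (cut eps) x = 0" "pd e (pd e (cut eps)) x = 0"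
proof -
  have "1 < cmod (0 + of_real eps * x)" using assms by (simp add: norm_mult pos_divide_less_eq mult.commute)
  then show "cut eps x = 0" "pd e (cut eps) x = 0" "pd e (pd e (cut eps)) x = 0"
    by (simp_all only: cut_def pd_cut pd_pd_cut[OF e] pd_bump_eq_0 bump_eq_0 mult_zero_right)
qed

text \<open>Brings an integral operator with kernel supported near the diagonal into the form that
  \<open>schur\<close> expects.\<close>

lemma integral_bound_cball:
  fixes u m :: "complex \<Rightarrow> complex"
  assumes u: "u \<in> borel_measurable lborel" "integrable lborel (\<lambda>z. (cmod (u z))\<^sup>2)"
    and m: "integrable lborel (\<lambda>y. u y * m y)"
    and le: "\<And>y. cmod (m y) \<le> C * indicator (cball x eps) y"
  shows "cmod (LINT y|lborel. u y * m y) \<le> C * (LINT y|lborel. cmod (u y * indicator (cball x eps) y))"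
proof -
  have "cmod (LINT y|lborel. u y * m y) \<le> (LINT y|lborel. C * cmod (u y * indicator (cball x eps) y))"
  proof (rule order_trans[OF integral_norm_bound integral_mono])
    show "integrable lborel (\<lambda>y. C * cmod (u y * indicator (cball x eps) y))"
      by (intro integrable_mult_right integrable_norm integrable_indicator_ball u)
    show "cmod (u y * m y) \<le> C * cmod (u y * indicator (cball x eps) y)" for y
    proof -
      have "cmod (u y) * cmod (m y) \<le> cmod (u y) * (C * indicator (cball x eps) y)"
        by (intro mult_left_mono le) simp
      then show ?thesis by (cases "y \<in> cball x eps") (simp_all add: norm_mult mult_ac)
    qed
  qed (intro integrable_norm m)
  then show ?thesis by simp
qed

lemma approx_le:
  assumes u: "u \<in> borel_measurable lborel" "integrable lborel (\<lambda>z. (cmod (u z))\<^sup>2)"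
    and e: "0 < eps" and P: "\<And>z. \<bar>bump z\<bar> \<le> P"
  shows "cmod (approx u eps x) \<le> P\<^sup>2 / eps\<^sup>2 * (LINT y|lborel. cmod (u y * indicator (cball x eps) y))"
proof -
  have P0: "0 \<le> P" using P[of 0] by linarith
  have "cmod (conv u (moll eps) x) \<le> P * (LINT y|lborel. cmod (u y * indicator (cball x eps) y))"
    unfolding conv_def
  proof (rule integral_bound_cball[OF u integrable_conv[OF u smooth_moll bsupp_moll[OF e]]])
    fix y
    show "cmod (of_real (moll eps (x - y))) \<le> P * indicator (cball x eps) y"
      using P[of "0 + of_real (1 / eps) * (x - y)"] moll_supp(1)[OF e, of "x - y"] P0
      by (cases "y \<in> cball x eps") (auto simp: moll_def[of eps "x - y"] dist_norm)
  qed
  moreover have "\<bar>cut eps x\<bar> \<le> P / eps\<^sup>2" using P by (simp add: cut_def abs_mult divide_right_mono)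
  ultimately have "\<bar>cut eps x\<bar> * cmod (conv u (moll eps) x)
      \<le> (P / eps\<^sup>2) * (P * (LINT y|lborel. cmod (u y * indicator (cball x eps) y)))"
    using P0 by (intro mult_mono) auto
  then show ?thesis by (simp add: approx_def norm_mult power2_eq_square)
qed

text \<open>\<open>opA\<close> and \<open>opB\<close> are \<open>N1\<close> and \<open>N2\<close>
  times - \<i> / 2; this is the origin of the factor - 1 / 4 and of E = 4 mu.\<close>

lemma magH_eq:
  fixes \<phi> :: "complex \<Rightarrow> real"
  assumes \<phi>: "smooth \<phi>" and f: "smooth f" and m: "magnetic (pd \<i> \<phi>) (\<lambda>z. - pd 1 \<phi> z) b"
  shows "magH \<phi> f z = - (magnetic.L (pd \<i> \<phi>) (\<lambda>z. - pd 1 \<phi> z) f z) / 4 - of_real (laplacian \<phi> z / 4) * f z"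
proof -
  interpret magnetic "pd \<i> \<phi>" "\<lambda>z. - pd 1 \<phi> z" b by (rule m)
  have A: "opA \<phi> f = (\<lambda>z. (- \<i> / 2) * N1 f z)" for f
    by (rule ext) (simp add: opA_def D1_def N1_def pd1_eq_pd pd2_eq_pd algebra_simps)
  have B: "opB \<phi> f = (\<lambda>z. (- \<i> / 2) * N2 f z)" for f
    by (rule ext) (simp add: opB_def D2_def N2_def pd1_eq_pd pd2_eq_pd algebra_simps)
  have "opA \<phi> (opA \<phi> f) z = (- \<i> / 2) * ((- \<i> / 2) * N1 (N1 f) z)"
    "opB \<phi> (opB \<phi> f) z = (- \<i> / 2) * ((- \<i> / 2) * N2 (N2 f) z)"
    unfolding A B N_mult[OF smooth_const smooth_N(1)[OF f]] N_mult[OF smooth_const smooth_N(2)[OF f]] by simp_all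
  then show ?thesis by (simp add: magH_def L_def algebra_simps)
qed

text \<open>The size of the kernel in the equation for the approximant. The letters x and y in names
  such as \<open>a1x\<close>, \<open>a1y\<close> mark the point of evaluation, and the leading part
  \<open>K\<close> cancels against \<open>S\<close>. The cut-off \<open>X\<close> is O(1 / eps^2)
  and meets bounded differences, of the form (l eps) (P / eps) or (l eps) ((2 a + l) / eps) times P;
  its derivatives \<open>d1\<close>, \<open>d2\<close> are O(1 / eps) and meet factors O(1 /
  eps).\<close>

lemma kernel_arith:
  fixes eps P l a M :: real and X d1 d2 dd a1x a2x a1y a2y B k0 k1 k2 :: real and K S :: complex
  assumes e: "0 < eps" "eps \<le> 1" and nn: "0 \<le> P" "0 \<le> l" "0 \<le> a" "0 \<le> M"
    and X: "\<bar>X\<bar> \<le> P / eps\<^sup>2" and d: "\<bar>d1\<bar> \<le> P / eps" "\<bar>d2\<bar> \<le> P / eps" and dd: "\<bar>dd\<bar> \<le> 2 * P"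
    and k: "\<bar>k0\<bar> \<le> P" "\<bar>k1\<bar> \<le> P / eps" "\<bar>k2\<bar> \<le> P / eps"
    and A: "\<bar>a1x\<bar> \<le> a / eps" "\<bar>a2x\<bar> \<le> a / eps" and dA: "\<bar>a1x - a1y\<bar> \<le> l * eps" "\<bar>a2x - a2y\<bar> \<le> l * eps"
    and B: "\<bar>B\<bar> \<le> M"
    and S: "S = K - 2 * \<i> * (of_real a1y * of_real k1 + of_real a2y * of_real k2)
      - of_real (a1y\<^sup>2 + a2y\<^sup>2) * of_real k0 + of_real B * of_real k0"
  shows "cmod (of_real X * (K - 2 * \<i> * (of_real a1x * of_real k1 + of_real a2x * of_real k2)
        - of_real (a1x\<^sup>2 + a2x\<^sup>2) * of_real k0 - S)
      + 2 * (of_real d1 * (of_real k1 - \<i> * of_real a1x * of_real k0) + of_real d2 * (of_real k2 - \<i> * of_real a2x * of_real k0))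
      + of_real dd * of_real k0)
    \<le> P\<^sup>2 * (4 * l + 2 * l * (2 * a + l) + M + 4 * (1 + a) + 2) / eps\<^sup>2"
    (is "cmod ?K \<le> _")
proof -
  \<comment> \<open>The value at y differs from that at x by at most l eps, and l eps \<le> l / eps
    as eps \<le> 1.\<close>
  have sum: "\<bar>a1x + a1y\<bar> \<le> (2 * a + l) / eps" "\<bar>a2x + a2y\<bar> \<le> (2 * a + l) / eps"
  proof -
    have "l * eps \<le> l" using e nn by (simp add: mult_left_le)
    also have "l \<le> l / eps" using e nn by (simp add: pos_le_divide_eq mult_left_le)
    finally have "l * eps \<le> l / eps" .
    moreover have "(2 * a + l) / eps = 2 * (a / eps) + l / eps" by (simp add: add_divide_distrib)
    ultimately show "\<bar>a1x + a1y\<bar> \<le> (2 * a + l) / eps" "\<bar>a2x + a2y\<bar> \<le> (2 * a + l) / eps"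
      using A dA by linarith+
  qed
  have e0: "eps \<noteq> 0" using e by simp
  have q: "\<bar>a1x - a1y\<bar> * \<bar>k1\<bar> \<le> (l * eps) * (P / eps)" "\<bar>a2x - a2y\<bar> * \<bar>k2\<bar> \<le> (l * eps) * (P / eps)"
    by (intro mult_mono dA k; use nn e in simp)+
  have r: "\<bar>a1x - a1y\<bar> * \<bar>a1x + a1y\<bar> \<le> (l * eps) * ((2 * a + l) / eps)" "\<bar>a2x - a2y\<bar> * \<bar>a2x + a2y\<bar> \<le> (l * eps) * ((2 * a + l) / eps)"
    by (intro mult_mono dA sum; use nn e in simp)+
  have "\<bar>a1x\<^sup>2 + a2x\<^sup>2 - (a1y\<^sup>2 + a2y\<^sup>2)\<bar> = \<bar>(a1x - a1y) * (a1x + a1y) + (a2x - a2y) * (a2x + a2y)\<bar>"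
    by (simp add: algebra_simps power2_eq_square)
  also have "\<dots> \<le> \<bar>a1x - a1y\<bar> * \<bar>a1x + a1y\<bar> + \<bar>a2x - a2y\<bar> * \<bar>a2x + a2y\<bar>"
    using abs_triangle_ineq by (simp add: abs_mult[symmetric])
  also have "\<dots> \<le> 2 * (l * (2 * a + l))" using r e0 by simp
  finally have sq: "\<bar>a1x\<^sup>2 + a2x\<^sup>2 - (a1y\<^sup>2 + a2y\<^sup>2)\<bar> \<le> 2 * (l * (2 * a + l))" .
  define inner :: complex where "inner = - 2 * \<i> * (of_real ((a1x - a1y) * k1) + of_real ((a2x - a2y) * k2))
     + - of_real ((a1x\<^sup>2 + a2x\<^sup>2 - (a1y\<^sup>2 + a2y\<^sup>2)) * k0) + - of_real (B * k0)"
  have "cmod inner \<le> 2 * (l * P + l * P) + 2 * (l * (2 * a + l)) * P + M * P"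
    unfolding inner_def
  proof (intro norm_triangle_mono)
    have "cmod (of_real ((a1x - a1y) * k1) + of_real ((a2x - a2y) * k2)) \<le> l * P + l * P"
      by (intro norm_triangle_mono; unfold norm_of_real abs_mult; use q e0 in simp)
    then show "cmod (- 2 * \<i> * (of_real ((a1x - a1y) * k1) + of_real ((a2x - a2y) * k2))) \<le> 2 * (l * P + l * P)"
      unfolding norm_mult by simp
    show "cmod (- of_real ((a1x\<^sup>2 + a2x\<^sup>2 - (a1y\<^sup>2 + a2y\<^sup>2)) * k0)) \<le> 2 * (l * (2 * a + l)) * P"
      unfolding norm_minus_cancel norm_of_real abs_mult using sq k nn by (intro mult_mono) auto
    show "cmod (- of_real (B * k0)) \<le> M * P"
      unfolding norm_minus_cancel norm_of_real abs_mult using B k nn by (intro mult_mono) auto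
  qed
  then have i: "cmod (of_real X * inner) \<le> P / eps\<^sup>2 * (2 * (l * P + l * P) + 2 * (l * (2 * a + l)) * P + M * P)"
    unfolding norm_mult norm_of_real using X nn by (intro mult_mono) auto
  have g: "cmod (of_real d * (of_real k - \<i> * of_real c * of_real k0)) \<le> P / eps * (P / eps + a / eps * P)"
    if "\<bar>d\<bar> \<le> P / eps" "\<bar>k\<bar> \<le> P / eps" "\<bar>c\<bar> \<le> a / eps" for d k c
  proof -
    have "cmod (of_real k - \<i> * of_real c * of_real k0) \<le> \<bar>k\<bar> + \<bar>c\<bar> * \<bar>k0\<bar>"
      using norm_triangle_ineq4[of "of_real k" "\<i> * of_real c * of_real k0"] by (simp add: norm_mult)
    also have "\<dots> \<le> P / eps + a / eps * P" using that \<open>\<bar>k0\<bar> \<le> P\<close> nn e by (intro add_mono mult_mono) auto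
    finally show ?thesis unfolding norm_mult norm_of_real using that nn e by (intro mult_mono) auto
  qed
  have "cmod (of_real dd * of_real k0) \<le> 2 * P * P"
    unfolding norm_mult norm_of_real using dd k nn by (intro mult_mono) auto
  also have "\<dots> \<le> 2 * P * P / eps\<^sup>2"
    using e nn by (simp add: pos_le_divide_eq mult_left_le power_le_one)
  finally have h: "cmod (of_real dd * of_real k0) \<le> 2 * P * P / eps\<^sup>2" .
  have "of_real X * (K - 2 * \<i> * (of_real a1x * of_real k1 + of_real a2x * of_real k2)
        - of_real (a1x\<^sup>2 + a2x\<^sup>2) * of_real k0 - S) = of_real X * inner"
    unfolding S inner_def by (simp add: algebra_simps)
  then have "cmod ?K
     \<le> P / eps\<^sup>2 * (2 * (l * P + l * P) + 2 * (l * (2 * a + l)) * P + M * P)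
      + 2 * (P / eps * (P / eps + a / eps * P) + P / eps * (P / eps + a / eps * P)) + 2 * P * P / eps\<^sup>2"
    using i norm_triangle_mono[OF g[OF d(1) k(2) A(1)] g[OF d(2) k(3) A(2)]]
    by (simp only:) (intro norm_triangle_mono h, simp_all only: norm_mult norm_numeral mult_left_mono zero_le_numeral)
  also have "\<dots> = P\<^sup>2 * (4 * l + 2 * l * (2 * a + l) + M + 4 * (1 + a) + 2) / eps\<^sup>2"
    using e0 by (simp add: field_simps power2_eq_square)
  finally show ?thesis .
qed

text \<open>The weak equation is tested, for each x, with the function y -> k (x - y);
  \<open>S x y\<close> is - 4 times the conjugate of \<open>magH\<close> of this function.\<close>

lemma approx_equation:
  fixes \<phi> :: "complex \<Rightarrow> real"
  assumes \<phi>: "smooth \<phi>" and m: "magnetic (pd \<i> \<phi>) (\<lambda>z. - pd 1 \<phi> z) b"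
    and u: "u \<in> borel_measurable lborel" "integrable lborel (\<lambda>z. (cmod (u z))\<^sup>2)"
    and w: "weak_eigen \<phi> \<mu> u" and e: "0 < eps"
  defines "A1 \<equiv> pd \<i> \<phi>" and "A2 \<equiv> (\<lambda>z. - pd 1 \<phi> z)" and "k \<equiv> moll eps"
  defines "S \<equiv> (\<lambda>x y. of_real (pd 1 (pd 1 k) (x - y) + pd \<i> (pd \<i> k) (x - y))
     - 2 * \<i> * (of_real (A1 y) * of_real (pd 1 k (x - y)) + of_real (A2 y) * of_real (pd \<i> k (x - y)))
     - of_real ((A1 y)\<^sup>2 + (A2 y)\<^sup>2) * of_real (k (x - y)) + of_real (laplacian \<phi> y) * of_real (k (x - y)) :: complex)"
  shows "(\<And>x. integrable lborel (\<lambda>y. u y * S x y))"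
    and "(\<And>x. (LINT y|lborel. u y * S x y) = - 4 * of_real \<mu> * conv u k x)"
proof -
  interpret magnetic A1 A2 b unfolding A1_def A2_def by (rule m)
  have k: "smooth k" "bsupp k" unfolding k_def using e by (auto intro: smooth_moll bsupp_moll)
  have sA: "smooth A1" "smooth A2" by (rule smooth_A)+
  have sl: "smooth (laplacian \<phi>)"
  proof -
    have "laplacian \<phi> = (\<lambda>z. pd 1 (pd 1 \<phi>) z + pd \<i> (pd \<i> \<phi>) z)"
      by (rule ext) (simp add: laplacian_def pd1_eq_pd pd2_eq_pd)
    then show ?thesis using \<phi> by (auto intro!: smooth_add)
  qed
  have div0: "pd 1 A1 z + pd \<i> A2 z = 0" for z
    unfolding A1_def A2_def using pd_commute_real[OF \<phi>, of \<i> 1 z] by (simp add: pd_minus smooth_pd_1 \<phi>)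
  fix x
  have sk: "smooth (\<lambda>y. f (x - y))" if "smooth f" for f :: "complex \<Rightarrow> real" by (rule smooth_reflect[OF that])
  have sd: "smooth (pd 1 k)" "smooth (pd \<i> k)" "smooth (pd 1 (pd 1 k))" "smooth (pd \<i> (pd \<i> k))"
    using k by auto
  have sS: "smooth (S x)" unfolding S_def
    by (intro smooth_add smooth_diff smooth_mult smooth_const smooth_of_real smooth_power sA sl sk k sd)
  have bS: "bsupp (S x)"
  proof -
    have "bounded ({y. k (x - y) \<noteq> 0} \<union> {y. pd 1 k (x - y) \<noteq> 0} \<union> {y. pd \<i> k (x - y) \<noteq> 0}
        \<union> {y. pd 1 (pd 1 k) (x - y) \<noteq> 0} \<union> {y. pd \<i> (pd \<i> k) (x - y) \<noteq> 0})"
      using k by (simp add: bsupp_reflect bsupp_pd)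
    then show ?thesis by (rule bounded_subset) (auto simp: S_def)
  qed
  show int: "integrable lborel (\<lambda>y. u y * S x y)"
    by (rule integrable_mult_bsupp[OF u smooth_continuous_on[OF sS] bS])
  define \<psi> where "\<psi> y = complex_of_real (k (x - y))" for y
  have s\<psi>: "smooth \<psi>" unfolding \<psi>_def[abs_def] by (intro smooth_of_real sk k)
  have b\<psi>: "bsupp \<psi>" unfolding \<psi>_def using bsupp_reflect[OF k(2), of x] by simp
  have t\<psi>: "test_fun \<psi>" by (rule test_funI[OF s\<psi> b\<psi>])
  have p1: "pd d \<psi> = (\<lambda>y. of_real (- pd d k (x - y)))" for d
    unfolding \<psi>_def[abs_def] by (rule ext) (simp only: pd_of_real[OF sk[OF k(1)]] pd_reflect[OF k(1)])
  have p2: "pd d (pd d \<psi>) y = of_real (pd d (pd d k) (x - y))" if "smooth (pd d k)" for d y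
    unfolding p1 by (simp only: pd_of_real[OF smooth_minus[OF sk[OF that]]] pd_minus[OF sk[OF that]] pd_reflect[OF that] minus_minus)
  \<comment> \<open>Two signs cancel in the first-order terms: one from differentiating k (x - y) in
    y, one from conjugating \<i>. So \<open>S\<close> is L plus the Laplacian of phi, acting on the
    kernel in x but with coefficients evaluated at y.\<close>
  have cm: "cnj (magH \<phi> \<psi> y) = - (1 / 4) * S x y" for y
  proof -
    have mH: "magH \<phi> \<psi> y = - (L \<psi> y) / 4 - of_real (laplacian \<phi> y / 4) * \<psi> y"
      unfolding A1_def A2_def by (rule magH_eq[OF \<phi> s\<psi> m])
    have Lp: "L \<psi> y = of_real (pd 1 (pd 1 k) (x - y)) + of_real (pd \<i> (pd \<i> k) (x - y))
      - 2 * \<i> * (of_real (A1 y) * of_real (- pd 1 k (x - y)) + of_real (A2 y) * of_real (- pd \<i> k (x - y)))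
      - of_real ((A1 y)\<^sup>2 + (A2 y)\<^sup>2) * of_real (k (x - y))"
      unfolding L_expand[OF s\<psi>] div0 p2[OF sd(1)] p2[OF sd(2)] fun_cong[OF p1]
      by (simp add: \<psi>_def)
    show ?thesis unfolding mH Lp by (simp add: S_def \<psi>_def field_simps)
  qed
  have "(LINT y|lborel. u y * cnj (magH \<phi> \<psi> y)) = of_real \<mu> * (LINT y|lborel. u y * cnj (\<psi> y))"
    using w t\<psi> unfolding weak_eigen_def by blast
  then have "(LINT y|lborel. u y * (- (1 / 4) * S x y)) = of_real \<mu> * (LINT y|lborel. u y * cnj (\<psi> y))"
    by (simp only: cm)
  moreover have "(LINT y|lborel. u y * cnj (\<psi> y)) = conv u k x" by (simp add: \<psi>_def conv_def)
  moreover have "(LINT y|lborel. u y * (- (1 / 4) * S x y)) = - (1 / 4) * (LINT y|lborel. u y * S x y)"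
  proof -
    have "(\<lambda>y. u y * (- (1 / 4) * S x y)) = (\<lambda>y. - (1 / 4) * (u y * S x y))" by auto
    then show ?thesis by (simp only: integral_mult_right_zero)
  qed
  ultimately have "- (1 / 4) * (LINT y|lborel. u y * S x y) = of_real \<mu> * conv u k x" by simp
  then have "- 4 * (- (1 / 4) * (LINT y|lborel. u y * S x y)) = - 4 * (of_real \<mu> * conv u k x)"
    by (rule arg_cong)
  then show "(LINT y|lborel. u y * S x y) = - 4 * of_real \<mu> * conv u k x" by simp
qed

text \<open>Both functions are integrals of \<open>u\<close> against kernels of size C / eps^2
  supported in |x - y| \<le> eps. The constant is uniform in the eigenvalue because the eigenvalue
  term is replaced exactly by the integral against \<open>S\<close>; what remains are differences of
  coefficients, the Laplacian of phi and derivatives of the cut-off.\<close>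

lemma approx_equation_bound:
  fixes \<phi> :: "complex \<Rightarrow> real"
  assumes \<phi>: "smooth \<phi>"
    and M: "\<And>d e z. d = 1 \<or> d = \<i> \<Longrightarrow> e = 1 \<or> e = \<i> \<Longrightarrow> \<bar>pd d (pd e \<phi>) z\<bar> \<le> M"
  obtains C where "0 \<le> C"
    "\<And>u \<mu> eps x. u \<in> borel_measurable lborel \<Longrightarrow> integrable lborel (\<lambda>z. (cmod (u z))\<^sup>2) \<Longrightarrow>
      weak_eigen \<phi> \<mu> u \<Longrightarrow> 0 < eps \<Longrightarrow> eps \<le> 1 \<Longrightarrow>
      cmod (approx u eps x) \<le> C / eps\<^sup>2 * (LINT y|lborel. cmod (u y * indicator (cball x eps) y)) \<and>
      cmod (magnetic.L (pd \<i> \<phi>) (\<lambda>z. - pd 1 \<phi> z) (approx u eps) x + of_real (4 * \<mu>) * approx u eps x)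
        \<le> C / eps\<^sup>2 * (LINT y|lborel. cmod (u y * indicator (cball x eps) y))"
proof -
  define A1 A2 where A: "A1 = pd \<i> \<phi>" "A2 = (\<lambda>z. - pd 1 \<phi> z)"
  have M0: "0 \<le> M" using M[of 1 1 0] by simp
  have lapM: "\<bar>laplacian \<phi> z\<bar> \<le> 2 * M" for z
    using M[of 1 1 z] M[of \<i> \<i> z] by (simp add: laplacian_def pd1_eq_pd pd2_eq_pd)
  have mag: "magnetic (pd \<i> \<phi>) (\<lambda>z. - pd 1 \<phi> z) (2 * M)"
  proof
    show "smooth (pd \<i> \<phi>)" "smooth (\<lambda>z. - pd 1 \<phi> z)" using \<phi> by auto
    show "\<bar>pd 1 (\<lambda>z. - pd 1 \<phi> z) z - pd \<i> (pd \<i> \<phi>) z\<bar> \<le> 2 * M" for z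
      using M[of 1 1 z] M[of \<i> \<i> z] by (simp add: pd_minus smooth_pd_1 \<phi>)
  qed
  interpret magnetic A1 A2 "2 * M" unfolding A by (rule mag)
  have div0: "pd 1 A1 z + pd \<i> A2 z = 0" for z
    unfolding A using pd_commute_real[OF \<phi>, of \<i> 1 z] by (simp add: pd_minus smooth_pd_1 \<phi>)
  obtain P where P: "0 \<le> P" "\<And>z. \<bar>bump z\<bar> \<le> P" "\<And>z. \<bar>pd 1 bump z\<bar> \<le> P" "\<And>z. \<bar>pd \<i> bump z\<bar> \<le> P"
    "\<And>z. \<bar>pd 1 (pd 1 bump) z\<bar> \<le> P" "\<And>z. \<bar>pd \<i> (pd \<i> bump) z\<bar> \<le> P"
    using bump_bounds by blast
  define l where "l = 2 * M"
  have lip: "\<bar>A1 x - A1 y\<bar> \<le> l * cmod (x - y)" "\<bar>A2 x - A2 y\<bar> \<le> l * cmod (x - y)" for x y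
  proof -
    have "norm (pd e \<phi> x - pd e \<phi> y) \<le> 2 * M * cmod (x - y)" if "e = 1 \<or> e = \<i>" for e
      using M[OF _ that] by (intro lipschitz_pd smooth_pd[OF \<phi> that]) simp_all
    from this[of \<i>] this[of 1] show "\<bar>A1 x - A1 y\<bar> \<le> l * cmod (x - y)" "\<bar>A2 x - A2 y\<bar> \<le> l * cmod (x - y)"
      by (simp_all add: A l_def abs_minus_commute)
  qed
  \<comment> \<open>Chosen so that |A1| and |A2| are at most a / eps on the disc of radius 1 / eps,
    by the Lipschitz bound and eps \<le> 1.\<close>
  define a where "a = \<bar>A1 0\<bar> + \<bar>A2 0\<bar> + l"
  have l0: "0 \<le> l" and a0: "0 \<le> a" using M0 by (simp_all add: l_def a_def)
  define C where "C = P\<^sup>2 * (4 * l + 2 * l * (2 * a + l) + 2 * M + 4 * (1 + a) + 2)"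
  have C1: "P\<^sup>2 \<le> C"
  proof -
    have "1 \<le> 4 * l + 2 * l * (2 * a + l) + 2 * M + 4 * (1 + a) + 2" using l0 a0 M0 by simp
    then show ?thesis unfolding C_def by (simp add: mult_le_cancel_left1)
  qed
  have C0: "0 \<le> C" using C1 by (rule order_trans[rotated]) simp
  show thesis
  proof (rule that[OF C0])
    fix u :: "complex \<Rightarrow> complex" and \<mu> eps :: real and x :: complex
    assume u: "u \<in> borel_measurable lborel" "integrable lborel (\<lambda>z. (cmod (u z))\<^sup>2)"
      and w: "weak_eigen \<phi> \<mu> u" and e: "0 < eps" "eps \<le> 1"
    define J where "J = (LINT y|lborel. cmod (u y * indicator (cball x eps) y))"
    have J0: "0 \<le> J" unfolding J_def by (intro Bochner_Integration.integral_nonneg) simp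
    have "cmod (approx u eps x) \<le> P\<^sup>2 / eps\<^sup>2 * J" unfolding J_def by (rule approx_le[OF u e(1) P(2)])
    also have "\<dots> \<le> C / eps\<^sup>2 * J" using C1 J0 by (intro mult_right_mono divide_right_mono) auto
    finally have first: "cmod (approx u eps x) \<le> C / eps\<^sup>2 * J" .
    define k where "k = moll eps"
    define X where "X = cut eps"
    have k: "smooth k" "bsupp k" unfolding k_def using e by (auto intro: smooth_moll bsupp_moll)
    have sX: "smooth X" "smooth (\<lambda>z. complex_of_real (X z))" unfolding X_def by (auto intro: smooth_cut)
    define S where "S y = of_real (pd 1 (pd 1 k) (x - y) + pd \<i> (pd \<i> k) (x - y))
     - 2 * \<i> * (of_real (A1 y) * of_real (pd 1 k (x - y)) + of_real (A2 y) * of_real (pd \<i> k (x - y)))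
     - of_real ((A1 y)\<^sup>2 + (A2 y)\<^sup>2) * of_real (k (x - y)) + of_real (laplacian \<phi> y) * of_real (k (x - y))" for y :: complex
    have S: "integrable lborel (\<lambda>y. u y * S y)" "(LINT y|lborel. u y * S y) = - 4 * of_real \<mu> * conv u k x"
      unfolding S_def k_def A using approx_equation[OF \<phi> mag u w e(1), of x] by auto
    define a0 a1 a2 aD where ad: "a0 y = complex_of_real (k (x - y))" "a1 y = complex_of_real (pd 1 k (x - y))"
      "a2 y = complex_of_real (pd \<i> k (x - y))"
      "aD y = complex_of_real (pd 1 (pd 1 k) (x - y) + pd \<i> (pd \<i> k) (x - y))" for y
    define x1 x2 xs d1 d2 dd where xd: "x1 = complex_of_real (A1 x)" "x2 = complex_of_real (A2 x)"
      "xs = complex_of_real ((A1 x)\<^sup>2 + (A2 x)\<^sup>2)" "d1 = complex_of_real (pd 1 X x)" "d2 = complex_of_real (pd \<i> X x)"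
      "dd = complex_of_real (pd 1 (pd 1 X) x + pd \<i> (pd \<i> X) x)"
    \<comment> \<open>The Leibniz rule for \<open>L\<close> on cut-off times mollification, written
      under the integral sign; the eigenvalue term appears as - \<open>X x\<close> times
      \<open>S y\<close>.\<close>
    define mm where "mm y = of_real (X x) * (aD y - 2 * \<i> * (x1 * a1 y + x2 * a2 y) - xs * a0 y - S y)
      + 2 * (d1 * (a1 y - \<i> * x1 * a0 y) + d2 * (a2 y - \<i> * x2 * a0 y)) + dd * a0 y" for y
    define U where "U = conv u k"
    have pU: "pd 1 U = conv u (pd 1 k)" "pd \<i> U = conv u (pd \<i> k)"
      "pd 1 (pd 1 U) = conv u (pd 1 (pd 1 k))" "pd \<i> (pd \<i> U) = conv u (pd \<i> (pd \<i> k))"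
      unfolding U_def using k by (simp_all add: pd_conv[OF u] smooth_pd bsupp_pd)
    have sU: "smooth U" unfolding U_def by (rule smooth_conv[OF u k])
    have ii: "integrable lborel (\<lambda>y. u y * a0 y)" "integrable lborel (\<lambda>y. u y * a1 y)"
       "integrable lborel (\<lambda>y. u y * a2 y)" "integrable lborel (\<lambda>y. u y * of_real (pd 1 (pd 1 k) (x - y)))"
       "integrable lborel (\<lambda>y. u y * of_real (pd \<i> (pd \<i> k) (x - y)))"
      unfolding ad by (intro integrable_conv[OF u] k smooth_pd_1 smooth_pd_ii bsupp_pd)+
    have iD: "integrable lborel (\<lambda>y. u y * aD y)"
      using Bochner_Integration.integrable_add[OF ii(4,5)] by (simp add: ad algebra_simps)
    have vals: "(LINT y|lborel. u y * a0 y) = U x" "(LINT y|lborel. u y * a1 y) = pd 1 U x"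
      "(LINT y|lborel. u y * a2 y) = pd \<i> U x" "(LINT y|lborel. u y * aD y) = pd 1 (pd 1 U) x + pd \<i> (pd \<i> U) x"
    proof -
      show "(LINT y|lborel. u y * a0 y) = U x" "(LINT y|lborel. u y * a1 y) = pd 1 U x"
        "(LINT y|lborel. u y * a2 y) = pd \<i> U x" unfolding pU unfolding U_def conv_def ad by simp_all
      have "(LINT y|lborel. u y * aD y) = (LINT y|lborel. u y * of_real (pd 1 (pd 1 k) (x - y)) + u y * of_real (pd \<i> (pd \<i> k) (x - y)))"
        by (simp add: ad algebra_simps)
      also have "\<dots> = conv u (pd 1 (pd 1 k)) x + conv u (pd \<i> (pd \<i> k)) x"
        unfolding conv_def by (rule Bochner_Integration.integral_add[OF ii(4,5)])
      finally show "(LINT y|lborel. u y * aD y) = pd 1 (pd 1 U) x + pd \<i> (pd \<i> U) x"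
        unfolding pU(3,4) .
    qed
    have umm: "(\<lambda>y. u y * mm y) = (\<lambda>y. of_real (X x) * (u y * aD y) - of_real (X x) * (2 * \<i> * x1) * (u y * a1 y)
        - of_real (X x) * (2 * \<i> * x2) * (u y * a2 y) - of_real (X x) * xs * (u y * a0 y) - of_real (X x) * (u y * S y)
        + 2 * d1 * (u y * a1 y) - 2 * d1 * \<i> * x1 * (u y * a0 y) + 2 * d2 * (u y * a2 y) - 2 * d2 * \<i> * x2 * (u y * a0 y)
        + dd * (u y * a0 y))" by (rule ext) (simp add: mm_def algebra_simps)
    have imm: "integrable lborel (\<lambda>y. u y * mm y)" unfolding umm using ii iD S(1)
      by (intro Bochner_Integration.integrable_add Bochner_Integration.integrable_diff integrable_mult_right)
    have val: "(LINT y|lborel. u y * mm y) = L (approx u eps) x + of_real (4 * \<mu>) * approx u eps x"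
    proof -
      have e1: "(LINT y|lborel. u y * mm y) = of_real (X x) * (LINT y|lborel. u y * aD y) - of_real (X x) * (2 * \<i> * x1) * (LINT y|lborel. u y * a1 y)
        - of_real (X x) * (2 * \<i> * x2) * (LINT y|lborel. u y * a2 y) - of_real (X x) * xs * (LINT y|lborel. u y * a0 y)
        - of_real (X x) * (LINT y|lborel. u y * S y)
        + 2 * d1 * (LINT y|lborel. u y * a1 y) - 2 * d1 * \<i> * x1 * (LINT y|lborel. u y * a0 y)
        + 2 * d2 * (LINT y|lborel. u y * a2 y) - 2 * d2 * \<i> * x2 * (LINT y|lborel. u y * a0 y)
        + dd * (LINT y|lborel. u y * a0 y)" unfolding umm using ii(1-3) iD S(1) by simp
      have e2: "L (approx u eps) x = of_real (X x) * L U x + 2 * (d1 * N1 U x + d2 * N2 U x) + dd * U x"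
      proof -
        have "approx u eps = (\<lambda>x. of_real (X x) * U x)" by (rule ext) (simp add: approx_def X_def U_def k_def)
        moreover have c: "pd e (\<lambda>z. complex_of_real (X z)) = (\<lambda>z. of_real (pd e X z))" for e
          by (intro ext pd_of_real sX)
        ultimately show ?thesis
          using L_mult[OF sX(2) sU, of x] by (simp add: c xd pd_of_real smooth_pd sX)
      qed
      have e3: "approx u eps x = of_real (X x) * U x" by (simp add: approx_def X_def U_def k_def)
      show ?thesis
        unfolding e1 e2 e3 vals S(2) L_expand[OF sU] div0 N1_def[of U] N2_def[of U] U_def[symmetric] xd
        by (simp add: algebra_simps)
    qed
    have bound: "cmod (mm y) \<le> C / eps\<^sup>2 * indicator (cball x eps) y" for y
    proof (cases "cmod (x - y) \<le> eps \<and> cmod x \<le> 1 / eps")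
      case False
      then consider "eps < cmod (x - y)" | "1 / eps < cmod x" by linarith
      then have "mm y = 0"
      proof cases
        case 1
        have sdk: "pd d (pd d k) (x - y) = 0" if "d = 1 \<or> d = \<i>" for d
        proof -
          have "1 < cmod (0 + of_real (1 / eps) * (x - y))" using 1 e by (simp add: norm_mult norm_divide)
          moreover have "pd d k = (\<lambda>w. (1 / eps) * pd d bump (0 + of_real (1 / eps) * w))"
            unfolding k_def by (rule ext) (rule pd_moll)
          ultimately show ?thesis
            by (simp only: pd_cmult[OF smooth_affine[OF smooth_pd[OF smooth_bump that]]] pd_affine[OF smooth_pd[OF smooth_bump that]]
                pd_bump_eq_0 scaleR_zero_right mult_zero_right)
        qed
        have "k (x - y) = 0" "pd 1 k (x - y) = 0" "pd \<i> k (x - y) = 0"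
          unfolding k_def using moll_supp[OF e(1) 1] by blast+
        then show ?thesis using sdk by (simp add: mm_def S_def ad)
      next
        case 2
        have "X x = 0" "pd 1 X x = 0" "pd \<i> X x = 0" "pd 1 (pd 1 X) x = 0" "pd \<i> (pd \<i> X) x = 0"
          unfolding X_def using cut_supp[OF e(1) 2] by blast+
        then show ?thesis by (simp add: mm_def xd)
      qed
      then show ?thesis using C0 by simp
    next
      case True
      have kb: "\<bar>k (x - y)\<bar> \<le> P" "\<bar>pd 1 k (x - y)\<bar> \<le> P / eps" "\<bar>pd \<i> k (x - y)\<bar> \<le> P / eps"
        unfolding k_def using P(2,3,4)[of "0 + of_real (1 / eps) * (x - y)"] e
        by (simp_all only: moll_def pd_moll abs_mult, simp_all add: divide_right_mono)
      have Xb: "\<bar>X x\<bar> \<le> P / eps\<^sup>2" "\<bar>pd 1 X x\<bar> \<le> P / eps" "\<bar>pd \<i> X x\<bar> \<le> P / eps"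
        "\<bar>pd 1 (pd 1 X) x + pd \<i> (pd \<i> X) x\<bar> \<le> 2 * P"
      proof -
        define z where "z = 0 + of_real eps * x"
        have "X x = bump z / eps\<^sup>2" "pd 1 X x = pd 1 bump z / eps" "pd \<i> X x = pd \<i> bump z / eps"
          "pd 1 (pd 1 X) x = pd 1 (pd 1 bump) z" "pd \<i> (pd \<i> X) x = pd \<i> (pd \<i> bump) z"
          using e by (simp_all only: X_def pd_cut pd_pd_cut cut_def z_def simp_thms, simp_all add: power2_eq_square)
        then show "\<bar>X x\<bar> \<le> P / eps\<^sup>2" "\<bar>pd 1 X x\<bar> \<le> P / eps" "\<bar>pd \<i> X x\<bar> \<le> P / eps"
          "\<bar>pd 1 (pd 1 X) x + pd \<i> (pd \<i> X) x\<bar> \<le> 2 * P"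
          using P(2-6)[of z] e by (simp_all add: divide_right_mono)
      qed
      have "\<bar>A1 x\<bar> \<le> a / eps \<and> \<bar>A2 x\<bar> \<le> a / eps"
      proof -
        have "l * cmod x \<le> l * (1 / eps)" using True l0 by (intro mult_left_mono) auto
        moreover have "\<bar>A1 0\<bar> + \<bar>A2 0\<bar> \<le> (\<bar>A1 0\<bar> + \<bar>A2 0\<bar>) / eps"
          using e by (simp add: pos_le_divide_eq mult_left_le)
        moreover have "a / eps = (\<bar>A1 0\<bar> + \<bar>A2 0\<bar>) / eps + l * (1 / eps)" by (simp add: a_def add_divide_distrib)
        ultimately show ?thesis using lip[of x 0] by (simp only: diff_zero) linarith
      qed
      then have Ab: "\<bar>A1 x\<bar> \<le> a / eps" "\<bar>A2 x\<bar> \<le> a / eps" by auto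
      have "l * cmod (x - y) \<le> l * eps" using True l0 by (intro mult_left_mono) auto
      then have Lb: "\<bar>A1 x - A1 y\<bar> \<le> l * eps" "\<bar>A2 x - A2 y\<bar> \<le> l * eps" using lip[of x y] by linarith+
      have "cmod (mm y) \<le> C / eps\<^sup>2" unfolding mm_def xd ad(1-3) C_def
        by (rule kernel_arith[OF e P(1) l0 a0 _ Xb kb Ab Lb lapM[of y]]) (simp_all add: M0 S_def ad(4))
      then show ?thesis using True by (simp add: dist_norm)
    qed
    have "cmod (L (approx u eps) x + of_real (4 * \<mu>) * approx u eps x) \<le> C / eps\<^sup>2 * J"
      unfolding val[symmetric] J_def by (rule integral_bound_cball[OF u imm bound])
    then show "cmod (approx u eps x) \<le> C / eps\<^sup>2 * (LINT y|lborel. cmod (u y * indicator (cball x eps) y)) \<and>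
      cmod (magnetic.L (pd \<i> \<phi>) (\<lambda>z. - pd 1 \<phi> z) (approx u eps) x + of_real (4 * \<mu>) * approx u eps x)
        \<le> C / eps\<^sup>2 * (LINT y|lborel. cmod (u y * indicator (cball x eps) y))"
      using first unfolding J_def A by blast
  qed
qed

section \<open>Passage to the limit\<close>

text \<open>The factor in the weak limit of the approximants: the cut-off contributes its value
  \<open>bump 0\<close> at the centre, the mollifier its total integral.\<close>

definition bump_mass :: real where
  "bump_mass = bump 0 * (LINT w|lborel. bump w)"

lemma bump_mass_pos: "0 < bump_mass"
proof -
  have b0: "0 < bump 0" using bump_pos_iff[of 0] bump_nonneg[of 0] by simp
  have "0 < (LINT w|lborel. bump w)"
  proof -
    have ib: "integrable lborel bump" by (rule integrable_bsupp[OF smooth_continuous_on[OF smooth_bump] bsupp_bump])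
    have "(LINT w|lborel. bump w) \<noteq> 0"
    proof
      assume "(LINT w|lborel. bump w) = 0"
      then have "AE w in lborel. bump w = 0"
        using integral_nonneg_eq_0_iff_AE[OF ib] bump_nonneg by simp
      then have "AE w in lborel. w \<notin> ball (0::complex) 1"
        by eventually_elim (use bump_pos_iff in auto)
      then have "emeasure lborel (ball (0::complex) 1) = 0"
        by (subst (asm) AE_iff_measurable[of "ball 0 1"]) auto
      then have "measure lborel (ball (0::complex) 1) = 0" by (simp add: measure_def)
      then show False using content_ball_pos[of 1 "0::complex"] by simp
    qed
    moreover have "0 \<le> (LINT w|lborel. bump w)" using bump_nonneg by (intro Bochner_Integration.integral_nonneg)
    ultimately show ?thesis by linarith
  qed
  then show ?thesis using b0 by (simp add: bump_mass_def)
qed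

text \<open>Fubini transfers mollification and cut-off from \<open>u\<close> to the continuous
  function \<open>g\<close>. There they converge pointwise, with uniform bounds and supports in a
  fixed ball; dominated convergence against the locally integrable \<open>u\<close>
  concludes.\<close>

lemma approx_weak_limit:
  fixes u g :: "complex \<Rightarrow> complex"
  assumes u: "u \<in> borel_measurable lborel" "integrable lborel (\<lambda>z. (cmod (u z))\<^sup>2)"
    and g: "continuous_on UNIV g" "bsupp g"
    and e: "\<And>n. 0 < eps n" "\<And>n. eps n \<le> 1" "eps \<longlonglongrightarrow> 0"
  shows "(\<lambda>n. LINT x|lborel. approx u (eps n) x * g x) \<longlonglongrightarrow>
    of_real bump_mass * (LINT y|lborel. u y * g y)"
proof -
  have [measurable]: "u \<in> borel_measurable borel" using u(1) by simp
  have [measurable]: "g \<in> borel_measurable borel" by (rule borel_measurable_continuous_onI[OF g(1)])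
  have [measurable]: "bump \<in> borel_measurable borel" by (rule smooth_borel[OF smooth_bump])
  have cb: "continuous_on S bump" for S by (rule smooth_continuous_on[OF smooth_bump])
  obtain P where P: "0 \<le> P" "\<And>z. \<bar>bump z\<bar> \<le> P" using bump_bounds by metis
  obtain Q where Q: "0 \<le> Q" "\<And>z. cmod (g z) \<le> Q" using bsupp_bound[OF g] by metis
  obtain K where K: "\<And>z. g z \<noteq> 0 \<Longrightarrow> cmod z \<le> K" using g(2) unfolding bounded_iff by auto
  have ib: "integrable lborel bump" by (rule integrable_bsupp[OF cb bsupp_bump])
  \<comment> \<open>The kernel after the substitution x = y + eps w, whose Jacobian eps^2 cancels
    the factor 1 / eps^2 in \<open>cut\<close>.\<close>
  define kern where "kern n y w = of_real (bump (of_real (eps n) * (y + eps n *\<^sub>R w)) * bump w) * g (y + eps n *\<^sub>R w)" for n y w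
  define h where "h n y = (LINT w|lborel. kern n y w)" for n y
  have kb: "cmod (kern n y w) \<le> P * bump w * Q" for n y w
    unfolding kern_def norm_mult norm_of_real abs_mult using P Q bump_nonneg[of w]
    by (intro mult_mono) auto
  have [measurable]: "(\<lambda>w. kern n y w) \<in> borel_measurable borel" "(\<lambda>y. h n y) \<in> borel_measurable borel" for n y
    unfolding h_def kern_def by measurable
  have swap: "(LINT x|lborel. approx u (eps n) x * g x) = (LINT y|lborel. u y * h n y)" for n
  proof -
    define d where "d = eps n"
    have d: "0 < d" using e(1) by (simp add: d_def)
    define F where "F x y = of_real (cut d x) * g x * (u y * of_real (moll d (x - y)))" for x y
    have [measurable]: "cut d \<in> borel_measurable borel" "moll d \<in> borel_measurable borel"
      by (intro smooth_borel smooth_cut smooth_moll)+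
    have mF: "case_prod F \<in> borel_measurable (lborel \<Otimes>\<^sub>M lborel)"
      unfolding F_def by measurable
    have ux: "integrable lborel (\<lambda>y. u y * of_real (moll d (x - y)))" for x
      by (rule integrable_conv[OF u smooth_moll bsupp_moll[OF d]])
    have "integrable (lborel \<Otimes>\<^sub>M lborel) (case_prod F)"
    proof (rule lborel_pair.Fubini_integrable[OF mF])
      \<comment> \<open>For absolute integrability, |u| is fed to \<open>conv\<close>: the inner
        integral of |F| is then a smooth function times the modulus of \<open>cut\<close> and
        \<open>g\<close>, hence continuous with bounded support.\<close>
      define U where "U = (\<lambda>y. complex_of_real (cmod (u y)))"
      have U: "U \<in> borel_measurable lborel" "integrable lborel (\<lambda>z. (cmod (U z))\<^sup>2)"
        using u unfolding U_def by auto
      have "(LINT y|lborel. norm (case (x, y) of (x, y) \<Rightarrow> F x y)) = cmod (of_real (cut d x) * g x * conv U (moll d) x)" for x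
      proof -
        have "(LINT y|lborel. norm (F x y)) = cmod (of_real (cut d x) * g x) * (LINT y|lborel. cmod (u y) * moll d (x - y))"
          using bump_nonneg unfolding F_def by (simp add: norm_mult moll_def)
        moreover have "conv U (moll d) x = of_real (LINT y|lborel. cmod (u y) * moll d (x - y))"
          unfolding conv_def U_def by (simp flip: of_real_mult)
        moreover have "0 \<le> (LINT y|lborel. cmod (u y) * moll d (x - y))"
          using bump_nonneg by (intro Bochner_Integration.integral_nonneg) (simp add: moll_def)
        ultimately show ?thesis by (simp add: norm_mult)
      qed
      moreover have "integrable lborel (\<lambda>x. of_real (cut d x) * g x * conv U (moll d) x)"
      proof (rule integrable_bsupp)
        have "continuous_on UNIV (conv U (moll d))" "continuous_on UNIV (cut d)"
          by (intro smooth_continuous_on smooth_conv[OF U] smooth_moll bsupp_moll d smooth_cut)+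
        then show "continuous_on UNIV (\<lambda>x. of_real (cut d x) * g x * conv U (moll d) x)"
          using g(1) by (intro continuous_intros)
        show "bsupp (\<lambda>x. of_real (cut d x) * g x * conv U (moll d) x)"
          by (rule bounded_subset[OF g(2)]) auto
      qed
      ultimately show "integrable lborel (\<lambda>x. LINT y|lborel. norm (case (x, y) of (x, y) \<Rightarrow> F x y))"
        by (simp only: integrable_norm)
      show "AE x in lborel. integrable lborel (\<lambda>y. case (x, y) of (x, y) \<Rightarrow> F x y)"
        unfolding F_def using ux by (intro AE_I2) simp
    qed
    then have fub: "(LINT y|lborel. LINT x|lborel. F x y) = (LINT x|lborel. LINT y|lborel. F x y)"
      by (rule lborel_pair.Fubini_integral)
    have inner: "(LINT x|lborel. F x y) = u y * h n y" for y
    proof -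
      have "(LINT x|lborel. F x y) = u y * (LINT x|lborel. of_real (cut d x) * g x * of_real (moll d (x - y)))"
        unfolding F_def by (simp flip: integral_mult_right_zero add: mult_ac)
      also have "(LINT x|lborel. of_real (cut d x) * g x * of_real (moll d (x - y)))
          = d\<^sup>2 *\<^sub>R (LINT w|lborel. of_real (cut d (y + d *\<^sub>R w)) * g (y + d *\<^sub>R w) * of_real (moll d (y + d *\<^sub>R w - y)))"
        by (rule integral_scale[OF _ d]) measurable
      also have "\<dots> = h n y"
        unfolding h_def kern_def d_def[symmetric] integral_scaleR_right[symmetric]
        using d by (intro Bochner_Integration.integral_cong refl)
          (simp add: cut_def moll_def scaleR_conv_of_real mult_ac)
      finally show ?thesis .
    qed
    have "(LINT x|lborel. approx u d x * g x) = (LINT x|lborel. LINT y|lborel. F x y)"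
      by (intro Bochner_Integration.integral_cong refl) (simp add: F_def approx_def conv_def)
    also have "\<dots> = (LINT y|lborel. LINT x|lborel. F x y)" by (rule fub[symmetric])
    also have "\<dots> = (LINT y|lborel. u y * h n y)" by (simp only: inner)
    finally show ?thesis by (simp add: d_def)
  qed
  have ae: "of_real (eps n) * (y + eps n *\<^sub>R w) = eps n *\<^sub>R (y + eps n *\<^sub>R w)" for n y w
    by (simp add: scaleR_conv_of_real)
  have hlim: "(\<lambda>n. h n y) \<longlonglongrightarrow> of_real bump_mass * g y" for y
  proof -
    have "(\<lambda>n. h n y) \<longlonglongrightarrow> (LINT w|lborel. of_real (bump 0 * bump w) * g y)"
      unfolding h_def
    proof (rule integral_dominated_convergence[where w = "\<lambda>w. P * bump w * Q"])
      show "integrable lborel (\<lambda>w. P * bump w * Q)" using ib by simp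
      show "AE w in lborel. (\<lambda>n. kern n y w)
          \<longlonglongrightarrow> of_real (bump 0 * bump w) * g y"
      proof (rule AE_I2)
        fix w
        have a: "(\<lambda>n. y + eps n *\<^sub>R w) \<longlonglongrightarrow> y + 0 *\<^sub>R w" by (intro tendsto_intros e(3))
        have b: "(\<lambda>n. of_real (eps n) * (y + eps n *\<^sub>R w)) \<longlonglongrightarrow> of_real 0 * (y + 0 *\<^sub>R w)" by (intro tendsto_intros e(3))
        have "isCont g y" using g(1) by (simp add: continuous_on_eq_continuous_at)
        from isCont_tendsto_compose[OF this, of "\<lambda>n. y + eps n *\<^sub>R w"] a
        have a': "(\<lambda>n. g (y + eps n *\<^sub>R w)) \<longlonglongrightarrow> g y" by simp
        from isCont_tendsto_compose[OF smooth_isCont[OF smooth_bump, of 0], of "\<lambda>n. of_real (eps n) * (y + eps n *\<^sub>R w)"] b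
        have b': "(\<lambda>n. bump (of_real (eps n) * (y + eps n *\<^sub>R w))) \<longlonglongrightarrow> bump 0" by simp
        show "(\<lambda>n. kern n y w)
          \<longlonglongrightarrow> of_real (bump 0 * bump w) * g y"
          unfolding kern_def by (intro tendsto_mult tendsto_of_real a' b' tendsto_const)
      qed
      show "AE w in lborel. norm (kern n y w) \<le> P * bump w * Q" for n by (intro AE_I2 kb)
      show "(\<lambda>w. kern n y w) \<in> borel_measurable lborel" for n by measurable
      show "(\<lambda>w. of_real (bump 0 * bump w) * g y) \<in> borel_measurable lborel" by measurable
    qed
    moreover have "(LINT w|lborel. of_real (bump 0 * bump w) * g y) = of_real bump_mass * g y"
      by (simp add: bump_mass_def)
    ultimately show ?thesis by (simp only:)
  qed
  define c where "c = P * Q * (LINT w|lborel. bump w)"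
  have hb: "cmod (h n y) \<le> c * indicator (cball 0 (K + 1)) y" for n y
  proof -
    have "cmod (h n y) \<le> (LINT w|lborel. P * Q * bump w * indicator (cball 0 (K + 1)) y)"
    proof (cases "integrable lborel (\<lambda>w. kern n y w)")
      case True
      show ?thesis unfolding h_def
      proof (rule order_trans[OF integral_norm_bound integral_mono])
        fix w
        show "norm (kern n y w)
          \<le> P * Q * bump w * indicator (cball 0 (K + 1)) y"
        proof (cases "bump w = 0 \<or> g (y + eps n *\<^sub>R w) = 0")
          case False
          then have w: "cmod w < 1" "cmod (y + eps n *\<^sub>R w) \<le> K" using bump_pos_iff K by auto
          have "cmod y \<le> cmod (y + eps n *\<^sub>R w) + cmod (eps n *\<^sub>R w)"
            using norm_triangle_ineq4[of "y + eps n *\<^sub>R w" "eps n *\<^sub>R w"] by simp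
          also have "cmod (eps n *\<^sub>R w) \<le> 1 * 1"
            unfolding norm_scaleR using e(1,2)[of n] w by (intro mult_mono) auto
          finally have "y \<in> cball 0 (K + 1)" using w by simp
          then show ?thesis using kb[of n y w] by (simp add: mult_ac)
        qed (use P Q bump_nonneg[of w] in \<open>auto simp: kern_def\<close>)
      qed (use True ib in \<open>auto simp: integrable_norm\<close>)
    next
      case False
      \<comment> \<open>Without integrability the Bochner integral takes its default value
        0.\<close>
      then have "h n y = 0" unfolding h_def by (rule not_integrable_integral_eq)
      then show ?thesis using P Q bump_nonneg by (auto intro!: Bochner_Integration.integral_nonneg)
    qed
    also have "\<dots> = c * indicator (cball 0 (K + 1)) y" by (simp add: c_def)
    finally show ?thesis .
  qed
  have "(\<lambda>n. LINT y|lborel. u y * h n y) \<longlonglongrightarrow> (LINT y|lborel. u y * (of_real bump_mass * g y))"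
  proof (rule integral_dominated_convergence[where w = "\<lambda>y. c * cmod (u y * indicator (cball 0 (K + 1)) y)"])
    show "integrable lborel (\<lambda>y. c * cmod (u y * indicator (cball 0 (K + 1)) y))"
      by (intro integrable_mult_right integrable_norm integrable_indicator_ball u)
    show "AE y in lborel. (\<lambda>n. u y * h n y) \<longlonglongrightarrow> u y * (of_real bump_mass * g y)"
      by (intro AE_I2 tendsto_mult tendsto_const hlim)
    show "AE y in lborel. norm (u y * h n y) \<le> c * cmod (u y * indicator (cball 0 (K + 1)) y)" for n
    proof (rule AE_I2)
      fix y
      have "cmod (u y) * cmod (h n y) \<le> cmod (u y) * (c * indicator (cball 0 (K + 1)) y)"
        by (intro mult_left_mono hb) simp
      then show "norm (u y * h n y) \<le> c * cmod (u y * indicator (cball 0 (K + 1)) y)"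
        by (cases "y \<in> cball 0 (K + 1)") (simp_all add: norm_mult mult_ac)
    qed
    show "(\<lambda>y. u y * h n y) \<in> borel_measurable lborel" for n by measurable
  qed measurable
  moreover have "(LINT y|lborel. u y * (of_real bump_mass * g y))
     = of_real bump_mass * (LINT y|lborel. u y * g y)"
  proof -
    have "(\<lambda>y. u y * (of_real bump_mass * g y)) = (\<lambda>y. of_real bump_mass * (u y * g y))"
      by (auto simp: mult_ac)
    then show ?thesis by (simp only: integral_mult_right_zero)
  qed
  ultimately show ?thesis by (simp only: swap)
qed

text \<open>The test function is a continuous approximation of the conjugate sign of u on a set where
  |u| exceeds M.\<close>

lemma AE_bound_by_duality:
  fixes u :: "complex \<Rightarrow> complex"
  assumes u: "u \<in> borel_measurable lborel" "integrable lborel (\<lambda>z. (cmod (u z))\<^sup>2)"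
    and dual: "\<And>g. continuous_on UNIV g \<Longrightarrow> bsupp g \<Longrightarrow>
      cmod (LINT y|lborel. u y * g y) \<le> M * (LINT y|lborel. cmod (g y))"
    and M: "0 \<le> M"
  shows "AE y in lborel. cmod (u y) \<le> M"
proof -
  have [measurable]: "u \<in> borel_measurable borel" using u(1) by simp
  \<comment> \<open>Sets of finite measure that exhaust the set where |u| > M, each with a margin 1
    / (k + 1) above M.\<close>
  define S where "S k = {y. M + 1 / real (Suc k) < cmod (u y) \<and> cmod y \<le> real k}" for k
  have S_meas [measurable]: "S k \<in> sets borel" for k unfolding S_def by measurable
  have null: "emeasure lborel (S k) = 0" for k
  proof -
    define r where "r = real k"
    define f where "f y = (if y \<in> S k then cnj (sgn (u y)) else 0)" for y
    have f1: "cmod (f y) \<le> indicator (cball 0 r) y" for y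
      by (auto simp: f_def S_def r_def norm_sgn indicator_def)
    have [measurable]: "cnj \<in> borel_measurable borel"
      by (intro borel_measurable_continuous_onI continuous_intros)
    have "(\<lambda>y. u y /\<^sub>R cmod (u y)) \<in> borel_measurable borel" by measurable
    then have [measurable]: "(\<lambda>y. cnj (u y /\<^sub>R cmod (u y))) \<in> borel_measurable borel"
      by (rule measurable_compose) measurable
    have [measurable]: "f \<in> borel_measurable borel"
      unfolding f_def sgn_div_norm by (intro measurable_If) measurable
    have "f \<in> borel_measurable lborel" by simp
    \<comment> \<open>Lebesgue measurability provides continuous functions that converge to
      \<open>f\<close> off a negligible set.\<close>
    then have "f \<in> borel_measurable (lebesgue_on UNIV)"
      unfolding lebesgue_on_UNIV_eq by (rule measurable_completion)
    then have "f measurable_on UNIV" by (simp add: measurable_on_iff_borel_measurable)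
    then obtain N G where N: "negligible N" and G: "\<And>n. continuous_on UNIV (G n)"
      "\<And>y. y \<notin> N \<Longrightarrow> (\<lambda>n. G n y) \<longlonglongrightarrow> f y"
      unfolding measurable_on_def by auto
    \<comment> \<open>\<open>\<theta>\<close> makes the supports bounded. The division by the
      maximum in \<open>g\<close> truncates the approximants to modulus at most 1 and leaves the
      limit unchanged, because |f| \<le> 1.\<close>
    define \<theta> where "\<theta> y = max 0 (min 1 (r + 1 - cmod y))" for y :: complex
    define g where "g n y = (\<theta> y / max 1 (cmod (G n y))) *\<^sub>R G n y" for n y
    have c\<theta>: "continuous_on UNIV \<theta>" unfolding \<theta>_def by (intro continuous_intros)
    have gc: "continuous_on UNIV (g n)" for n
      unfolding g_def by (intro continuous_intros c\<theta> G(1)) (auto simp: max_def)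
    have gb: "cmod (g n y) \<le> indicator (cball 0 (r + 1)) y" for n y
    proof (cases "y \<in> cball 0 (r + 1)")
      case True
      have "cmod (G n y) / max 1 (cmod (G n y)) \<le> 1" by (simp add: divide_le_eq)
      moreover have "\<bar>\<theta> y\<bar> \<le> 1" by (simp add: \<theta>_def)
      ultimately have "\<bar>\<theta> y\<bar> * (cmod (G n y) / max 1 (cmod (G n y))) \<le> 1 * 1" by (intro mult_mono) auto
      then show ?thesis using True by (simp add: g_def)
    next
      case False
      then have "\<theta> y = 0" by (simp add: \<theta>_def)
      then show ?thesis by (simp add: g_def)
    qed
    have gs: "bsupp (g n)" for n
    proof (rule bounded_subset[OF bounded_cball[of 0 "r + 1"]], clarify)
      fix y assume "g n y \<noteq> 0"
      then show "y \<in> cball 0 (r + 1)" using gb[of n y] by (cases "y \<in> cball 0 (r + 1)") auto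
    qed
    have [measurable]: "g n \<in> borel_measurable borel" for n by (rule borel_measurable_continuous_onI[OF gc])
    have "N \<in> null_sets lebesgue" using N by (simp add: negligible_iff_null_sets)
    then have "AE y in lebesgue. y \<notin> N" by (rule AE_not_in)
    then have AEN: "AE y in lborel. y \<notin> N" by (simp only: AE_completion_iff)
    have glim: "AE y in lborel. (\<lambda>n. g n y) \<longlonglongrightarrow> f y" using AEN
    proof eventually_elim
      case (elim y)
      have "(\<lambda>n. g n y) \<longlonglongrightarrow> (\<theta> y / max 1 (cmod (f y))) *\<^sub>R f y"
        unfolding g_def by (intro tendsto_intros G(2)[OF elim]) (auto simp: max_def)
      moreover have "(\<theta> y / max 1 (cmod (f y))) *\<^sub>R f y = f y"
      proof (cases "y \<in> cball 0 r")
        case True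
        then have "\<theta> y = 1" "max 1 (cmod (f y)) = 1" using f1[of y] by (auto simp: \<theta>_def)
        then show ?thesis by simp
      next
        case False
        then have "f y = 0" using f1[of y] by simp
        then show ?thesis by simp
      qed
      ultimately show ?case by simp
    qed
    have iball: "integrable lborel (\<lambda>y::complex. indicator (cball 0 (r + 1)) y :: real)"
      using borel_integrable_compact[of "cball (0::complex) (r + 1)" "\<lambda>_. 1::real"] by simp
    have lim1: "(\<lambda>n. LINT y|lborel. u y * g n y) \<longlonglongrightarrow> (LINT y|lborel. u y * f y)"
    proof (rule integral_dominated_convergence[where w = "\<lambda>y. cmod (u y * indicator (cball 0 (r + 1)) y)"])
      show "integrable lborel (\<lambda>y. cmod (u y * indicator (cball 0 (r + 1)) y))"
        by (intro integrable_norm integrable_indicator_ball u)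
      show "AE y in lborel. (\<lambda>n. u y * g n y) \<longlonglongrightarrow> u y * f y"
        using glim by eventually_elim (intro tendsto_mult tendsto_const)
      show "AE y in lborel. norm (u y * g n y) \<le> cmod (u y * indicator (cball 0 (r + 1)) y)" for n
      proof (rule AE_I2)
        fix y
        have "cmod (u y) * cmod (g n y) \<le> cmod (u y) * indicator (cball 0 (r + 1)) y"
          by (intro mult_left_mono gb) simp
        then show "norm (u y * g n y) \<le> cmod (u y * indicator (cball 0 (r + 1)) y)"
          by (cases "y \<in> cball 0 (r + 1)") (simp_all add: norm_mult)
      qed
    qed measurable
    have lim2: "(\<lambda>n. LINT y|lborel. cmod (g n y)) \<longlonglongrightarrow> (LINT y|lborel. cmod (f y))"
    proof (rule integral_dominated_convergence[where w = "\<lambda>y. indicator (cball 0 (r + 1)) y"])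
      show "AE y in lborel. (\<lambda>n. cmod (g n y)) \<longlonglongrightarrow> cmod (f y)"
        using glim by eventually_elim (rule tendsto_norm)
      show "AE y in lborel. norm (cmod (g n y)) \<le> indicator (cball 0 (r + 1)) y" for n
        using gb[of n] by (intro AE_I2) simp
      show "(\<lambda>y. cmod (g n y)) \<in> borel_measurable lborel" for n by measurable
      show "integrable lborel (indicator (cball 0 (r + 1)) :: complex \<Rightarrow> real)" by (rule iball)
    qed measurable
    have "cmod (LINT y|lborel. u y * f y) \<le> M * (LINT y|lborel. cmod (f y))"
      by (rule LIMSEQ_le[OF tendsto_norm[OF lim1] tendsto_mult[OF tendsto_const lim2]])
        (use dual[OF gc gs] in blast)
    note le0 = this
    have uf: "u y * f y = of_real (cmod (u y) * indicator (S k) y)" for y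
    proof (cases "u y = 0")
      case False
      have "u y * cnj (u y) = of_real (cmod (u y)) * of_real (cmod (u y))"
        by (simp add: complex_norm_square[symmetric] power2_eq_square[symmetric])
      then have "u y * cnj (sgn (u y)) = of_real (cmod (u y))"
        using False by (simp add: sgn_div_norm scaleR_conv_of_real field_simps)
      then show ?thesis by (simp add: f_def)
    qed (simp add: f_def)
    have ff: "cmod (f y) = indicator (S k) y" for y
    proof (cases "y \<in> S k")
      case True
      have "0 < M + 1 / real (Suc k)" using M by (intro add_nonneg_pos) auto
      then have "u y \<noteq> 0" using True by (auto simp: S_def)
      then show ?thesis using True by (simp add: f_def norm_sgn)
    qed (simp add: f_def)
    have "(LINT y|lborel. u y * f y) = of_real (LINT y|lborel. cmod (u y) * indicator (S k) y)"
      by (simp only: uf integral_complex_of_real)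
    then have le: "\<bar>LINT y|lborel. cmod (u y) * indicator (S k) y\<bar> \<le> M * (LINT y|lborel. indicator (S k) y)"
      using le0 by (simp only: norm_of_real ff)
    have fin: "emeasure lborel (S k) < \<infinity>"
    proof -
      have "emeasure lborel (S k) \<le> emeasure lborel (cball (0::complex) r)"
        by (intro emeasure_mono) (auto simp: S_def r_def)
      also have "\<dots> < \<infinity>" by (intro emeasure_bounded_finite bounded_cball)
      finally show ?thesis .
    qed
    have iS: "integrable lborel (indicator (S k) :: complex \<Rightarrow> real)"
      using fin by (simp add: integrable_indicator_iff)
    have iu: "integrable lborel (\<lambda>y. cmod (u y) * indicator (S k) y)"
    proof (rule Bochner_Integration.integrable_bound[OF integrable_norm[OF integrable_indicator_ball[OF u, of 0 r]]])
      show "AE y in lborel. norm (cmod (u y) * indicator (S k) y) \<le> norm (cmod (u y * indicator (cball 0 r) y))"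
        by (intro AE_I2) (auto simp: indicator_def S_def r_def norm_mult)
    qed measurable
    \<comment> \<open>The integral of |u| over \<open>S k\<close> is at least M + 1 / (k + 1) times
      the measure, and by duality at most M times the measure. The measure is finite, so it is
      zero.\<close>
    have "(M + 1 / real (Suc k)) * measure lborel (S k) = (LINT y|lborel. (M + 1 / real (Suc k)) * indicator (S k) y)"
      by simp
    also have "\<dots> \<le> (LINT y|lborel. cmod (u y) * indicator (S k) y)"
    proof (rule integral_mono[OF integrable_mult_right[OF iS] iu])
      show "(M + 1 / real (Suc k)) * indicator (S k) y \<le> cmod (u y) * indicator (S k) y" for y
        by (cases "y \<in> S k") (simp_all add: S_def)
    qed
    also have "\<dots> \<le> M * measure lborel (S k)" using le by simp
    finally have "1 / real (Suc k) * measure lborel (S k) \<le> 0" by (simp add: distrib_right)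
    then have "measure lborel (S k) \<le> 0" by (simp add: divide_le_0_iff)
    then have "measure lborel (S k) = 0" using measure_nonneg[of lborel "S k"] by linarith
    then show ?thesis using fin by (auto simp: measure_def enn2real_eq_0_iff)
  qed
  have "AE y in lborel. y \<notin> S k" for k using null[of k] by (intro AE_not_in null_setsI) auto
  then have "AE y in lborel. \<forall>k. y \<notin> S k" by (simp add: AE_all_countable)
  then show ?thesis
  proof eventually_elim
    case (elim y)
    show ?case
    proof (rule ccontr)
      assume "\<not> cmod (u y) \<le> M"
      then have p: "0 < cmod (u y) - M" by simp
      obtain n1 where n1: "inverse (real (Suc n1)) < cmod (u y) - M" using reals_Archimedean[OF p] by blast
      obtain n2 where n2: "cmod y \<le> real n2" using real_arch_simple by blast
      define k where "k = max n1 n2"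
      have "1 / real (Suc k) \<le> 1 / real (Suc n1)" by (intro divide_left_mono) (auto simp: k_def)
      then have "y \<in> S k" using n1 n2 by (auto simp: S_def k_def inverse_eq_divide)
      then show False using elim by blast
    qed
  qed
qed

theorem theorem1:
  fixes \<phi> :: "complex \<Rightarrow> real"
  assumes "smooth \<phi>"
    and "\<And>bs. length bs \<ge> 2 \<Longrightarrow> \<exists>C. \<forall>z. \<bar>dpart bs \<phi> z\<bar> \<le> C"
  shows "\<exists>C. \<forall>(lam::real) (u::complex \<Rightarrow> complex).
           lam \<ge> 0 \<and> u \<in> borel_measurable lborel \<and> integrable lborel (\<lambda>z. (cmod (u z))\<^sup>2)
           \<and> weak_eigen \<phi> (lam\<^sup>2) u
           \<longrightarrow> (AE z in lborel. cmod (u z) \<le> C * sqrt (normsq u))"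
proof -
  have "\<exists>C. \<forall>z. \<bar>dpart [c, d] \<phi> z\<bar> \<le> C" for c d by (rule assms(2)) simp
  then obtain B where B: "\<And>c d z. \<bar>dpart [c, d] \<phi> z\<bar> \<le> B c d" by metis
  define M where "M = max (max (B True True) (B True False)) (max (B False True) (B False False))"
  have M: "\<bar>pd d (pd e \<phi>) z\<bar> \<le> M" if "d = 1 \<or> d = \<i>" "e = 1 \<or> e = \<i>" for d e z
    using that B[where c = True and d = True and z = z] B[where c = True and d = False and z = z]
      B[where c = False and d = True and z = z] B[where c = False and d = False and z = z]
    by (auto simp: M_def pd1_eq_pd pd2_eq_pd)
  obtain C where C: "0 \<le> C"
    "\<And>u \<mu> eps x. u \<in> borel_measurable lborel \<Longrightarrow> integrable lborel (\<lambda>z. (cmod (u z))\<^sup>2) \<Longrightarrow>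
      weak_eigen \<phi> \<mu> u \<Longrightarrow> 0 < eps \<Longrightarrow> eps \<le> 1 \<Longrightarrow>
      cmod (approx u eps x) \<le> C / eps\<^sup>2 * (LINT y|lborel. cmod (u y * indicator (cball x eps) y)) \<and>
      cmod (magnetic.L (pd \<i> \<phi>) (\<lambda>z. - pd 1 \<phi> z) (approx u eps) x + of_real (4 * \<mu>) * approx u eps x)
        \<le> C / eps\<^sup>2 * (LINT y|lborel. cmod (u y * indicator (cball x eps) y))"
    using approx_equation_bound[OF assms(1) M] by blast
  interpret magnetic "pd \<i> \<phi>" "\<lambda>z. - pd 1 \<phi> z" "2 * M"
  proof
    show "smooth (pd \<i> \<phi>)" "smooth (\<lambda>z. - pd 1 \<phi> z)" using assms(1) by auto
    show "\<bar>pd 1 (\<lambda>z. - pd 1 \<phi> z) z - pd \<i> (pd \<i> \<phi>) z\<bar> \<le> 2 * M" for z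
      using M[of 1 1 z] M[of \<i> \<i> z] by (simp add: pd_minus smooth_pd_1 assms(1))
  qed
  \<comment> \<open>The constant of \<open>sup_bound\<close> at b = 2 M, times the factor 16 C^2
    with which \<open>schur\<close> bounds both the approximant and the error in its equation. M and
    C depend on phi alone.\<close>
  define H where "H = (2 + 2 * M + (2 * M)\<^sup>2) * (4 + 133 * (10 + 8 * (2 * M))) * (16 * C\<^sup>2)"
  show ?thesis
  proof (intro exI[of _ "sqrt H / bump_mass"] allI impI)
    fix lam :: real and u :: "complex \<Rightarrow> complex"
    assume "lam \<ge> 0 \<and> u \<in> borel_measurable lborel \<and> integrable lborel (\<lambda>z. (cmod (u z))\<^sup>2) \<and> weak_eigen \<phi> (lam\<^sup>2) u"
    then have u: "u \<in> borel_measurable lborel" "integrable lborel (\<lambda>z. (cmod (u z))\<^sup>2)" and w: "weak_eigen \<phi> (lam\<^sup>2) u"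
      by auto
    define I where "I = (normsq u)"
    have I0: "0 \<le> I" unfolding I_def by (intro Bochner_Integration.integral_nonneg) simp
    have H0: "0 \<le> H" using b_nonneg unfolding H_def by simp
    have sup: "cmod (approx u eps x) \<le> sqrt H * sqrt I" if e: "0 < eps" "eps \<le> 1" for eps x
    proof -
      have t: "test_fun (approx u eps)" by (rule test_fun_approx[OF u e(1)])
      \<comment> \<open>E = 4 lam^2, since \<open>magH\<close> is built from halved
        derivatives.\<close>
      have t2: "test_fun (\<lambda>x. L (approx u eps) x + of_real (4 * lam\<^sup>2) * approx u eps x)"
        by (intro test_fun_add test_fun_L test_fun_mult smooth_const t)
      have "(normsq (approx u eps)) \<le> 16 * C\<^sup>2 * I"
        unfolding I_def using C(2)[OF u w e] by (intro schur[OF u t e(1) C(1)]) blast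
      moreover have "(LINT x|lborel. (cmod (L (approx u eps) x + of_real (4 * lam\<^sup>2) * approx u eps x))\<^sup>2) \<le> 16 * C\<^sup>2 * I"
        unfolding I_def using C(2)[OF u w e] by (intro schur[OF u t2 e(1) C(1)]) blast
      ultimately have "(cmod (approx u eps x))\<^sup>2 \<le> H * I"
        using sup_bound[OF t, of "4 * lam\<^sup>2" "16 * C\<^sup>2 * I" x] unfolding H_def by (simp add: mult.assoc)
      then show ?thesis unfolding real_sqrt_mult[symmetric] by (rule real_le_rsqrt)
    qed
    show "AE z in lborel. cmod (u z) \<le> sqrt H / bump_mass * sqrt (normsq u)"
      unfolding I_def[symmetric]
    \<comment> \<open>All approximants are bounded by \<open>sqrt H * sqrt I\<close>; the bound
      survives in the weak limit \<open>bump_mass\<close> times u, and dividing by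
      \<open>bump_mass\<close> yields the dual inequality for u.\<close>
    proof (rule AE_bound_by_duality[OF u])
      fix g :: "complex \<Rightarrow> complex" assume g: "continuous_on UNIV g" "bsupp g"
      define eps where "eps n = 1 / real (Suc n)" for n
      have e: "0 < eps n" "eps n \<le> 1" for n by (simp_all add: eps_def)
      have e0: "eps \<longlonglongrightarrow> 0" unfolding eps_def using LIMSEQ_Suc[OF lim_1_over_n] .
      have ig: "integrable lborel g" by (rule integrable_bsupp[OF g])
      have "cmod (LINT x|lborel. approx u (eps n) x * g x) \<le> sqrt H * sqrt I * (LINT y|lborel. cmod (g y))" for n
      proof -
        have "cmod (LINT x|lborel. approx u (eps n) x * g x) \<le> (LINT x|lborel. sqrt H * sqrt I * cmod (g x))"
        proof (rule order_trans[OF integral_norm_bound integral_mono])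
          have "continuous_on UNIV (approx u (eps n))"
            by (rule smooth_continuous_on[OF test_fun_smooth[OF test_fun_approx[OF u e(1)]]])
          then have "integrable lborel (\<lambda>x. approx u (eps n) x * g x)"
            using g by (intro integrable_bsupp continuous_intros bsupp_mult(1))
          then show "integrable lborel (\<lambda>x. cmod (approx u (eps n) x * g x))" by (rule integrable_norm)
          show "cmod (approx u (eps n) x * g x) \<le> sqrt H * sqrt I * cmod (g x)" for x
            unfolding norm_mult by (intro mult_right_mono sup e) simp
        qed (use ig in simp)
        then show ?thesis by simp
      qed
      then have "cmod (of_real bump_mass * (LINT y|lborel. u y * g y)) \<le> sqrt H * sqrt I * (LINT y|lborel. cmod (g y))"
        by (intro LIMSEQ_le_const2[OF tendsto_norm[OF approx_weak_limit[OF u g e e0]]]) blast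
      then have "bump_mass * cmod (LINT y|lborel. u y * g y) \<le> sqrt H * sqrt I * (LINT y|lborel. cmod (g y))"
        using bump_mass_pos by (simp add: norm_mult)
      then show "cmod (LINT y|lborel. u y * g y) \<le> sqrt H / bump_mass * sqrt I * (LINT y|lborel. cmod (g y))"
        using bump_mass_pos by (simp add: pos_le_divide_eq mult_ac)
    next
      show "0 \<le> sqrt H / bump_mass * sqrt I" using bump_mass_pos H0 I0 by simp
    qed
  qed
qed

end
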